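(* Let $M=\{M_i\}_{1\le i\le m}$ be a family of germs of real analytic totally real $n$-dimensional submanifolds of $\mathbb C^n$ passing through the origin, with anti-holomorphic involutions $\rho_i(z)=B_i\bar z+R_i(\bar z)$, $F_{i,j}=\rho_i\circ\rho_j$, and $G$ the group generated by the $F_{i,j}$, $1\le i,j\le m$. Assume that $G$ is abelian and that the linear parts $D_{i,j}=\mathrm{diag}(\mu_{i,j,1},\dots,\mu_{i,j,n})$ of the $F_{i,j}$ at $0$ are diagonal; put $D=\{D_{i,j}\}$. Let $\mathcal I$ be a monomial ideal of $\mathcal O_n$ left invariant by $D$ and by the $B_i$'s. Assume that either $D$ is diophantine, or $\mathcal I$ is properly embedded and $D$ is diophantine on $\mathcal I$; that $M$ is non-resonant on $\mathcal I$; and that $G$ is formally linearizable on $\mathcal I$. Then there exists a complex analytic subvariety $\mathcal S$ passing through the origin and intersecting each totally real submanifold $M_i$. In a good holomorphic coordinate system at the origin, $\mathcal S$ is a finite intersection of finite unions of complex coordinate hyperplanes, $$\mathcal S=\bigcap_i\bigcup_j\{z_{i_j}=0\},$$ and for each $k$ the intersection $M_k\cap\mathcal S$ is given by $$M_k\cap\mathcal S=\Big\{z\in\bigcap_i\bigcup_j\{z_{i_j}=0\}\;:\;B_k\bar z=z\Big\}.$$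
   Context: Each $M_i$ is locally the fixed point set of a germ of anti-holomorphic involution $\rho_i(z)=B_i\bar z+R_i(\bar z)$, with $R_i$ a germ of holomorphic map, $R_i(0)=0$, $DR_i(0)=0$, $B_i$ invertible, $B_i\bar B_i=\mathrm{Id}$. The tangent spaces $\{z=B_i\bar z\}$ at $0$ are pairwise distinct. $F_{i,j}$ is a germ of holomorphic diffeomorphism with linear part $D_{i,j}=B_i\bar B_j$. $\mathcal O_n$ (resp. $\widehat{\mathcal O}_n$): germs of holomorphic functions at $0\in\mathbb C^n$ (resp. formal power series). For $Q\in\mathbb N^n$: $|Q|=\sum q_k$, $x^Q=\prod x_k^{q_k}$, $\mu_{i,j}^Q=\prod_k\mu_{i,j,k}^{q_k}$. A monomial ideal is one generated by monomials; $\widehat{\mathcal I}$ is the ideal generated by $\mathcal I$ in $\widehat{\mathcal O}_n$. $\mathcal I$ is left invariant by a matrix $B$ if $f(Bx)\in\mathcal I$ for all $f\in\mathcal I$. $\mathcal I$ is properly embedded if it has a set of monomial generators not involving some nonempty set of variables. $\omega_k(D)=\inf\{\max_{i,j}|\mu_{i,j}^Q-\mu_{i,j,k'}|\ne0: 2\le|Q|\le2^k,\ 1\le k'\le n\}$, and $\omega_k(D,\mathcal I)$ is the same with the additional restriction $x^Q\notin\mathcal I$ (only nonzero values of the maximum are considered). $D$ is diophantine (resp. on $\mathcal I$) if $-\sum_{k\ge1}2^{-k}\ln\omega_k(D)<+\infty$ (resp. $-\sum_{k\ge1}2^{-k}\ln\omega_k(D,\mathcal I)<+\infty$). $M$ is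 non-resonant on $\mathcal I$ if for every monomial $z^Q\notin\mathcal I$ with $|Q|\ge2$ and every pair $(i,k)$, $1\le i\le m$, $1\le k\le n$, there is $j$ with $\bar\mu_{i,j}^Q\ne\mu_{i,j,k}^{-1}$. $G$ is formally linearizable on $\mathcal I$ if there is a formal diffeomorphism $\hat\Phi$ of $(\mathbb C^n,0)$, tangent to the identity at $0$, such that $\hat\Phi^{-1}\circ F_{i,j}\circ\hat\Phi-D_{i,j}x$ has all components in $\widehat{\mathcal I}$ for all $i,j$. *)

theory Defs
  imports "HOL-Analysis.Analysis" "HOL-Algebra.Ideal"
begin

section \<open>Power series in several variables\<close>

text \<open>A multi-index indexed by the coordinates \<open>'n\<close> is a function \<open>'n \<Rightarrow> nat\<close>; a formal power
  series is the family of its coefficients.\<close>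

type_synonym 'n fseries = "('n \<Rightarrow> nat) \<Rightarrow> complex"

definition mdeg :: "('n::finite \<Rightarrow> nat) \<Rightarrow> nat" where
  "mdeg Q = (\<Sum>k\<in>UNIV. Q k)"

definition mpow :: "'a::comm_semiring_1 ^ 'n::finite \<Rightarrow> ('n \<Rightarrow> nat) \<Rightarrow> 'a" where
  "mpow x Q = (\<Prod>k\<in>UNIV. x $ k ^ Q k)"

definition mono_series :: "('n::finite \<Rightarrow> nat) \<Rightarrow> 'n fseries" where
  "mono_series Q = (\<lambda>P. if P = Q then 1 else 0)"

definition formal_ring :: "'n::finite fseries ring" where
  "formal_ring = \<lparr>carrier = UNIV,
     mult = (\<lambda>f g Q. \<Sum>P\<in>{..Q}. f P * g (Q - P)),
     one = mono_series (\<lambda>_. 0),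
     zero = (\<lambda>_. 0),
     add = (\<lambda>f g Q. f Q + g Q)\<rparr>"

text \<open>Germs at 0 of holomorphic functions are identified with their Taylor series, i.e. with the
  convergent power series.\<close>

definition convergent_series :: "'n::finite fseries \<Rightarrow> bool" where
  "convergent_series c \<longleftrightarrow>
     (\<forall>\<^sub>F z in nhds (0 :: complex ^ 'n). (\<lambda>Q. c Q * mpow z Q) summable_on UNIV)"

definition germ_ring :: "'n::finite fseries ring" where
  "germ_ring = formal_ring\<lparr>carrier := {c. convergent_series c}\<rparr>"


section \<open>Holomorphic and real analytic maps\<close>

definition has_expansion :: "(complex ^ 'n::finite \<Rightarrow> complex) \<Rightarrow> complex ^ 'n \<Rightarrow> 'n fseries \<Rightarrow> bool"
  where "has_expansion f p c \<longleftrightarrow>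
     (\<forall>\<^sub>F z in nhds 0. ((\<lambda>Q. c Q * mpow z Q) has_sum f (p + z)) UNIV)"

definition holo_at :: "(complex ^ 'n::finite \<Rightarrow> complex) \<Rightarrow> complex ^ 'n \<Rightarrow> bool" where
  "holo_at f p \<longleftrightarrow> (\<exists>c. has_expansion f p c)"

definition holo_map_at :: "(complex ^ 'n::finite \<Rightarrow> complex ^ 'k::finite) \<Rightarrow> complex ^ 'n \<Rightarrow> bool" where
  "holo_map_at f p \<longleftrightarrow> (\<forall>k. holo_at (\<lambda>z. f z $ k) p)"

definition real_analytic_at :: "(real ^ 'n::finite \<Rightarrow> complex) \<Rightarrow> real ^ 'n \<Rightarrow> bool" where
  "real_analytic_at f p \<longleftrightarrow>
     (\<exists>c. \<forall>\<^sub>F x in nhds 0. ((\<lambda>Q. c Q * of_real (mpow x Q)) has_sum f (p + x)) UNIV)"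

definition biholomorphic_map ::
  "(complex ^ 'n::finite \<Rightarrow> complex ^ 'n) \<Rightarrow> (complex ^ 'n) set \<Rightarrow> (complex ^ 'n) set \<Rightarrow> bool" where
  "biholomorphic_map \<psi> U V \<longleftrightarrow> open U \<and> open V \<and> \<psi> ` U = V \<and> (\<forall>z\<in>U. holo_map_at \<psi> z) \<and>
     (\<exists>\<phi>. (\<forall>w\<in>V. holo_map_at \<phi> w) \<and> (\<forall>z\<in>U. \<phi> (\<psi> z) = z))"

definition analytic_subvariety :: "(complex ^ 'n::finite) set \<Rightarrow> (complex ^ 'n) set \<Rightarrow> bool" where
  "analytic_subvariety U S \<longleftrightarrow> S \<subseteq> U \<and>
     (\<forall>p\<in>U. \<exists>N \<F>. open N \<and> p \<in> N \<and> N \<subseteq> U \<and> finite \<F> \<and> (\<forall>f\<in>\<F>. \<forall>q\<in>N. holo_at f q) \<and>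
        S \<inter> N = {z \<in> N. \<forall>f\<in>\<F>. f z = 0})"

text \<open>Germ at 0 of a real analytic submanifold of \<open>\<complex>\<^sup>n\<close> of real dimension \<open>n\<close>, given by a local
  parametrization \<open>\<gamma>\<close>; \<open>range T\<close> is its tangent space, which must satisfy \<open>T M \<inter> \<i> T M = 0\<close>.\<close>

definition totally_real_germ :: "(complex ^ 'n::finite) set \<Rightarrow> bool" where
  "totally_real_germ M \<longleftrightarrow>
     (\<exists>(\<gamma> :: real ^ 'n \<Rightarrow> complex ^ 'n) \<gamma>' W U.
        open W \<and> 0 \<in> W \<and> open U \<and> 0 \<in> U \<and> \<gamma> 0 = 0 \<and> homeomorphism W (M \<inter> U) \<gamma> \<gamma>' \<and>
        (\<forall>x\<in>W. (\<forall>k. real_analytic_at (\<lambda>y. \<gamma> y $ k) x) \<and>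
           (\<exists>T. (\<gamma> has_derivative T) (at x) \<and> inj T \<and>
                range T \<inter> (\<lambda>v. \<i> *s v) ` range T = {0})))"


section \<open>Formal maps\<close>

type_synonym 'n fmap = "'n \<Rightarrow> 'n fseries"

text \<open>\<open>fsubst f \<Phi>\<close> is \<open>f \<circ> \<Phi>\<close> for \<open>\<Phi>\<close> without constant term: then \<open>\<Phi>\<^sup>P\<close> has order at least \<open>|P|\<close>,
  so that only the finitely many \<open>P\<close> with \<open>|P| \<le> |Q|\<close> contribute to the coefficient at \<open>Q\<close>.\<close>

definition fsubst :: "'n::finite fseries \<Rightarrow> 'n fmap \<Rightarrow> 'n fseries" where
  "fsubst f \<Phi> = (\<lambda>Q. \<Sum>P | mdeg P \<le> mdeg Q.
     f P * finprod formal_ring (\<lambda>k. \<Phi> k [^]\<^bsub>formal_ring\<^esub> P k) UNIV Q)"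

definition fcomp_map :: "'n::finite fmap \<Rightarrow> 'n fmap \<Rightarrow> 'n fmap" where
  "fcomp_map \<Phi> \<Psi> = (\<lambda>k. fsubst (\<Phi> k) \<Psi>)"

definition linear_fmap :: "complex ^ 'n ^ 'n::finite \<Rightarrow> 'n fmap" where
  "linear_fmap A = (\<lambda>k Q. \<Sum>j\<in>UNIV. A $ k $ j * mono_series (\<lambda>l. if l = j then 1 else 0) Q)"

definition tangent_to_id :: "'n::finite fmap \<Rightarrow> bool" where
  "tangent_to_id \<Phi> \<longleftrightarrow> (\<forall>k Q. mdeg Q \<le> 1 \<longrightarrow> \<Phi> k Q = linear_fmap (mat 1) k Q)"

text \<open>Only meaningful for maps holomorphic at 0, whose expansion there is unique.\<close>

definition taylor_map :: "(complex ^ 'n::finite \<Rightarrow> complex ^ 'n) \<Rightarrow> 'n fmap" where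
  "taylor_map F = (\<lambda>k. THE c. has_expansion (\<lambda>z. F z $ k) 0 c)"

definition diag_mat :: "complex ^ 'n \<Rightarrow> complex ^ 'n ^ 'n::finite" where
  "diag_mat d = (\<chi> k l. if k = l then d $ k else 0)"

definition cnj_vec :: "complex ^ 'n \<Rightarrow> complex ^ 'n::finite" where
  "cnj_vec z = (\<chi> k. cnj (z $ k))"


section \<open>Monomial ideals\<close>

definition monomial_ideal :: "'n::finite fseries set \<Rightarrow> bool" where
  "monomial_ideal I \<longleftrightarrow> (\<exists>A. I = genideal germ_ring (mono_series ` A))"

definition properly_embedded :: "'n::finite fseries set \<Rightarrow> bool" where
  "properly_embedded I \<longleftrightarrow> (\<exists>A V. V \<noteq> {} \<and> I = genideal germ_ring (mono_series ` A) \<and>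
     (\<forall>Q\<in>A. \<forall>k\<in>V. Q k = 0))"

definition left_invariant :: "'n::finite fseries set \<Rightarrow> complex ^ 'n ^ 'n \<Rightarrow> bool" where
  "left_invariant I A \<longleftrightarrow> (\<forall>f\<in>I. fsubst f (linear_fmap A) \<in> I)"

text \<open>A monomial ideal is generated by the monomials it contains, so this is its zero set.\<close>

definition zero_locus :: "'n::finite fseries set \<Rightarrow> (complex ^ 'n) set" where
  "zero_locus I = {z. \<forall>Q. mono_series Q \<in> I \<longrightarrow> mpow z Q = 0}"


section \<open>Groups of germs and arithmetic conditions\<close>

text \<open>Germs of biholomorphisms fixing 0 are handled through representatives; \<open>inv\<close> adds every
  representative of the inverse germ.\<close>

inductive_set generated_group ::
  "(complex ^ 'n::finite \<Rightarrow> complex ^ 'n) set \<Rightarrow> (complex ^ 'n \<Rightarrow> complex ^ 'n) set"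
  for X where
  one: "id \<in> generated_group X"
| gen: "f \<in> X \<Longrightarrow> f \<in> generated_group X"
| comp: "f \<in> generated_group X \<Longrightarrow> g \<in> generated_group X \<Longrightarrow> f \<circ> g \<in> generated_group X"
| inv: "f \<in> generated_group X \<Longrightarrow> holo_map_at g 0 \<Longrightarrow> g 0 = 0 \<Longrightarrow>
    \<forall>\<^sub>F z in nhds 0. f (g z) = z \<and> g (f z) = z \<Longrightarrow> g \<in> generated_group X"

definition abelian_germs :: "(complex ^ 'n::finite \<Rightarrow> complex ^ 'n) set \<Rightarrow> bool" where
  "abelian_germs G \<longleftrightarrow> (\<forall>f\<in>G. \<forall>g\<in>G. \<forall>\<^sub>F z in nhds 0. f (g z) = g (f z))"

definition formally_linearizable_on ::
  "('m \<Rightarrow> 'm \<Rightarrow> complex ^ 'n::finite \<Rightarrow> complex ^ 'n) \<Rightarrow> ('m \<Rightarrow> 'm \<Rightarrow> complex ^ 'n) \<Rightarrow>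
   'n fseries set \<Rightarrow> bool" where
  "formally_linearizable_on F \<mu> I \<longleftrightarrow>
     (\<exists>\<Phi> \<Psi>. tangent_to_id \<Phi> \<and>
        fcomp_map \<Phi> \<Psi> = linear_fmap (mat 1) \<and> fcomp_map \<Psi> \<Phi> = linear_fmap (mat 1) \<and>
        (\<forall>k. \<Psi> k (\<lambda>_. 0) = 0) \<and>
        (\<forall>i j k. (\<lambda>Q. fcomp_map \<Psi> (fcomp_map (taylor_map (F i j)) \<Phi>) k Q
                      - linear_fmap (diag_mat (\<mu> i j)) k Q) \<in> genideal formal_ring I))"

definition non_resonant_on :: "('m \<Rightarrow> 'm \<Rightarrow> complex ^ 'n::finite) \<Rightarrow> 'n fseries set \<Rightarrow> bool" where
  "non_resonant_on \<mu> I \<longleftrightarrow>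
     (\<forall>Q. mono_series Q \<notin> I \<and> mdeg Q \<ge> 2 \<longrightarrow>
        (\<forall>i k. \<exists>j. cnj (mpow (\<mu> i j) Q) \<noteq> inverse (\<mu> i j $ k)))"

definition divisor ::
  "('m::finite \<Rightarrow> 'm \<Rightarrow> complex ^ 'n::finite) \<Rightarrow> ('n \<Rightarrow> nat) \<Rightarrow> 'n \<Rightarrow> real" where
  "divisor \<mu> Q k = Max (range (\<lambda>(i, j). cmod (mpow (\<mu> i j) Q - \<mu> i j $ k)))"

text \<open>The infimum of \<open>divisor\<close> over the multi-indices in \<open>E\<close>; when all divisors vanish there is no
  constraint and the value is set to 1, so that \<open>ln\<close> contributes nothing.\<close>

definition omega ::
  "('m::finite \<Rightarrow> 'm \<Rightarrow> complex ^ 'n::finite) \<Rightarrow> ('n \<Rightarrow> nat) set \<Rightarrow> nat \<Rightarrow> real" where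
  "omega \<mu> E k =
     (let S = {d. \<exists>Q k'. Q \<in> E \<and> 2 \<le> mdeg Q \<and> mdeg Q \<le> 2 ^ k \<and> d = divisor \<mu> Q k' \<and> d \<noteq> 0}
      in if S = {} then 1 else Inf S)"

text \<open>\<open>omega\<close> is positive and eventually nonincreasing in \<open>k\<close>, so the terms \<open>- ln (omega \<mu> E k) / 2 ^ k\<close>
  are bounded below by a summable sequence, and their sum is \<open>< \<infinity>\<close> iff it converges. The term
  \<open>k = 0\<close> vanishes.\<close>

definition diophantine_over ::
  "('m::finite \<Rightarrow> 'm \<Rightarrow> complex ^ 'n::finite) \<Rightarrow> ('n \<Rightarrow> nat) set \<Rightarrow> bool" where
  "diophantine_over \<mu> E \<longleftrightarrow> summable (\<lambda>k. - ln (omega \<mu> E k) / 2 ^ k)"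

definition diophantine :: "('m::finite \<Rightarrow> 'm \<Rightarrow> complex ^ 'n::finite) \<Rightarrow> bool" where
  "diophantine \<mu> \<longleftrightarrow> diophantine_over \<mu> UNIV"

definition diophantine_on ::
  "('m::finite \<Rightarrow> 'm \<Rightarrow> complex ^ 'n::finite) \<Rightarrow> 'n fseries set \<Rightarrow> bool" where
  "diophantine_on \<mu> I \<longleftrightarrow> diophantine_over \<mu> {Q. mono_series Q \<notin> I}"

end

theory Submission
  imports Defs "HOL-Library.Function_Algebras"
begin

text \<open>Let \<open>Z\<close> be the zero set of the ideal, a union of coordinate subspaces, and \<open>E\<close> the set of
  monomials that do not vanish identically on \<open>Z\<close>; a convergent series is determined on \<open>Z\<close> by its
  coefficients in \<open>E\<close>. Since \<open>B\<^sub>i\<close> intertwines \<open>cnj D\<^sub>i\<^sub>j\<close> with the inverse of \<open>D\<^sub>i\<^sub>j\<close>, non-resonance of the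
  family \<open>M\<close> says that for fixed \<open>i\<close> no monomial of \<open>E\<close> of degree at least 2 is resonant for all the
  \<open>D\<^sub>i\<^sub>j\<close>. Hence the formal linearization \<open>\<Phi>\<close> is uniquely determined on \<open>E\<close> by a recursion with small
  divisors, and it converges by the majorant method and Brjuno's estimate. The estimate compares
  \<open>\<mu>\<^sup>Q\<close> and \<open>\<mu>\<^sup>P\<close> for \<open>P \<le> Q\<close> through \<open>\<mu>\<^sup>R \<mu>\<^sub>l - \<mu>\<^sub>l\<close> with \<open>R = Q - P\<close>; choosing \<open>l\<close> in the support
  of \<open>R\<close> keeps \<open>x\<^sup>R x\<^sub>l\<close> in \<open>E\<close>, because \<open>E\<close> depends only on supports. Finally
  \<open>\<rho>\<^sub>i \<circ> \<Phi> \<circ> (B\<^sub>i cnj)\<close> satisfies the same recursion, so \<open>\<Phi>\<close> linearizes the involutions on \<open>Z\<close> as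
  well, and \<open>\<Phi> Z\<close> is the required variety.\<close>

section \<open>Multi-indices and the ring of formal power series\<close>

text \<open>The recursion holds for all pairs (i, j) at once with the same unknown coefficient, so
  at each step the pair attaining the maximum in \<open>divisor\<close> can be chosen. The obstacle
  is that small divisors accumulate along nested compositions. They are absorbed by a weight
  \<open>G\<close> on multi-indices which is superadditive, allows a loss of the logarithm of the
  divisor at each splitting, and grows at most linearly in the degree. The moduli of the
  coefficients times \<open>exp (- G)\<close> then obey a recursion without divisors, and undoing
  the weight only shrinks the radius. Exponents outside \<open>E\<close> do not interfere:
  \<open>E\<close> contains with an exponent all smaller ones, so a coefficient of a composition at
  an exponent of \<open>E\<close> involves only inner coefficients in \<open>E\<close>. Elsewhere
  the map may be replaced by the identity, which keeps it invertible and changes nothing that is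
  seen on \<open>Z\<close>. For the unit ideal the zero set is empty, and the origin takes its
  place.\<close>

lemma finite_atMost_fun: "finite {..Q :: 'n::finite \<Rightarrow> nat}"
proof (rule finite_subset)
  show "{..Q} \<subseteq> PiE UNIV (\<lambda>k. {..Q k})"
    by (auto simp: le_fun_def)
qed (auto intro: finite_PiE)

lemma index_le_mdeg: "Q k \<le> mdeg Q"
  unfolding mdeg_def by (rule member_le_sum) auto

lemma finite_mdeg_le: "finite {Q :: 'n::finite \<Rightarrow> nat. mdeg Q \<le> N}"
proof (rule finite_subset)
  show "{Q :: 'n \<Rightarrow> nat. mdeg Q \<le> N} \<subseteq> {..\<lambda>_. N}"
    using index_le_mdeg order_trans by (fastforce simp: le_fun_def)
qed (rule finite_atMost_fun)

lemma mdeg_zero [simp]: "mdeg (0 :: 'n::finite \<Rightarrow> nat) = 0" "mdeg (\<lambda>_ :: 'n. 0) = 0"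
  by (auto simp: mdeg_def)

lemma mdeg_eq_0_iff: "mdeg (Q :: 'n::finite \<Rightarrow> nat) = 0 \<longleftrightarrow> Q = 0"
  by (auto simp: mdeg_def)

lemma mdeg_plus: "mdeg (P + Q) = mdeg P + mdeg (Q :: 'n::finite \<Rightarrow> nat)"
  by (simp add: mdeg_def sum.distrib)

lemma le_imp_ex_plus: "P \<le> (Q :: 'n \<Rightarrow> nat) \<Longrightarrow> Q = P + (Q - P)"
  by (auto simp: le_fun_def fun_eq_iff)

lemma le_plus_fun: "P \<le> P + (Q :: 'n \<Rightarrow> nat)" "Q \<le> P + (Q :: 'n \<Rightarrow> nat)"
  by (auto simp: le_fun_def)

lemma diff_plus_fun [simp]: "P + (Q :: 'n \<Rightarrow> nat) - P = Q"
  by (auto simp: fun_eq_iff)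

lemma mdeg_mono: "P \<le> (Q :: 'n::finite \<Rightarrow> nat) \<Longrightarrow> mdeg P \<le> mdeg Q"
  by (auto simp: mdeg_def le_fun_def intro: sum_mono)

lemma mdeg_diff: "P \<le> (Q :: 'n::finite \<Rightarrow> nat) \<Longrightarrow> mdeg (Q - P) = mdeg Q - mdeg P"
  by (metis add_diff_cancel_left' le_imp_ex_plus mdeg_plus)

lemma mdeg_strict_mono: "P \<le> (Q :: 'n::finite \<Rightarrow> nat) \<Longrightarrow> P \<noteq> Q \<Longrightarrow> mdeg P < mdeg Q"
  by (metis add.right_neutral le_add1 le_imp_ex_plus le_neq_implies_less mdeg_eq_0_iff mdeg_mono
      mdeg_plus add_cancel_right_right)

definition unit_index :: "'n \<Rightarrow> 'n \<Rightarrow> nat" where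
  "unit_index k = (\<lambda>l. if l = k then 1 else 0)"

lemma mdeg_unit_index [simp]: "mdeg (unit_index k :: 'n::finite \<Rightarrow> nat) = 1"
  by (simp add: mdeg_def unit_index_def)

lemma unit_index_inject [simp]: "unit_index k = unit_index l \<longleftrightarrow> k = l"
  by (auto simp: unit_index_def fun_eq_iff split: if_splits)

lemma mdeg_eq_1E:
  assumes "mdeg (Q :: 'n::finite \<Rightarrow> nat) = 1"
  obtains k where "Q = unit_index k"
proof -
  have "Q \<noteq> 0" using assms mdeg_eq_0_iff[of Q] by simp
  then obtain k where k: "Q k \<noteq> 0" by (auto simp: fun_eq_iff)
  then have le: "unit_index k \<le> Q" by (auto simp: unit_index_def le_fun_def)
  then have "Q = unit_index k"
    using mdeg_strict_mono[OF le] assms by auto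
  then show ?thesis by (rule that)
qed

lemma mpow_plus: "mpow x (P + Q) = mpow x P * mpow x (Q :: 'n::finite \<Rightarrow> nat)"
  by (simp add: mpow_def power_add prod.distrib)

lemma mpow_zero [simp]: "mpow x (0 :: 'n::finite \<Rightarrow> nat) = 1" "mpow x (\<lambda>_ :: 'n. 0) = 1"
  by (simp_all add: mpow_def)

lemma mpow_unit_index [simp]: "mpow x (unit_index k :: 'n::finite \<Rightarrow> nat) = x $ k"
proof -
  have "mpow x (unit_index k) = (\<Prod>l\<in>UNIV. if l = k then x $ k else 1)"
    unfolding mpow_def unit_index_def by (rule prod.cong) auto
  then show ?thesis by simp
qed

text \<open>The coefficient type is left open because the majorant method multiplies real series of
  absolute values alongside complex ones.\<close>

type_synonym ('n, 'a) series = "('n \<Rightarrow> nat) \<Rightarrow> 'a"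

definition smul :: "('n, 'a::comm_semiring_1) series \<Rightarrow> ('n, 'a) series \<Rightarrow> ('n, 'a) series" where
  "smul f g = (\<lambda>Q. \<Sum>P\<in>{..Q}. f P * g (Q - P))"

definition sone :: "('n, 'a::comm_semiring_1) series" where
  "sone = (\<lambda>Q. if Q = 0 then 1 else 0)"

lemma smul_commute: "smul f g = smul g (f :: ('n::finite, 'a::comm_semiring_1) series)"
proof
  fix Q :: "'n \<Rightarrow> nat"
  have *: "Q - (Q - P) = P" if "P \<le> Q" for P
    using that by (auto simp: le_fun_def fun_eq_iff)
  show "smul f g Q = smul g f Q"
    unfolding smul_def
    by (rule sum.reindex_bij_witness[of _ "\<lambda>P. Q - P" "\<lambda>P. Q - P"])
      (auto simp: * mult.commute, auto simp: le_fun_def)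
qed

text \<open>Both sides sum over the ordered decompositions of \<open>Q\<close> into three parts; the
  reindexing exchanges the sum of the first two parts for the second part.\<close>

lemma smul_assoc: "smul (smul f g) h = smul f (smul g (h :: ('n::finite, 'a::comm_semiring_1) series))"
proof
  fix Q :: "'n \<Rightarrow> nat"
  have "smul (smul f g) h Q = (\<Sum>P\<in>{..Q}. \<Sum>P'\<in>{..P}. f P' * g (P - P') * h (Q - P))"
    by (simp add: smul_def sum_distrib_right)
  also have "\<dots> = (\<Sum>(P, P')\<in>(SIGMA P:{..Q}. {..P}). f P' * g (P - P') * h (Q - P))"
    by (rule sum.Sigma) (auto simp: finite_atMost_fun)
  also have "\<dots> = (\<Sum>(P, P')\<in>(SIGMA P:{..Q}. {..Q - P}). f P * g P' * h (Q - P - P'))"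
  proof (rule sum.reindex_bij_witness[of _ "\<lambda>(P, P'). (P + P', P)" "\<lambda>(P, P'). (P', P - P')"])
    fix a assume "a \<in> (SIGMA P:{..Q}. {..Q - P})"
    then obtain P P' where a: "a = (P, P')" "P \<le> Q" "P' \<le> Q - P" by auto
    have "P + P' \<le> Q"
      using a(2,3) by (simp add: le_fun_def le_diff_conv2 add.commute)
    then show "(case a of (P, P') \<Rightarrow> (P + P', P)) \<in> (SIGMA P:{..Q}. {..P})"
      using a by (auto simp: le_plus_fun)
  next
    fix a assume "a \<in> (SIGMA P:{..Q}. {..P})"
    then obtain P P' where a: "a = (P, P')" "P \<le> Q" "P' \<le> P" by auto
    have "Q - P' - (P - P') = Q - P" using a
      by (auto simp: le_fun_def fun_eq_iff)
    then show "(case case a of (P, P') \<Rightarrow> (P', P - P') of (P, P') \<Rightarrow> f P * g P' * h (Q - P - P')) =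
        (case a of (P, P') \<Rightarrow> f P' * g (P - P') * h (Q - P))"
      using a by simp
  qed (auto simp: le_fun_def fun_eq_iff diff_le_mono intro: order_trans)
  also have "\<dots> = (\<Sum>P\<in>{..Q}. \<Sum>P'\<in>{..Q - P}. f P * g P' * h (Q - P - P'))"
    by (rule sum.Sigma[symmetric]) (auto simp: finite_atMost_fun)
  also have "\<dots> = smul f (smul g h) Q"
    by (simp add: smul_def sum_distrib_left mult.assoc)
  finally show "smul (smul f g) h Q = smul f (smul g h) Q" .
qed

lemma smul_sone [simp]: "smul sone f = (f :: ('n::finite, 'a::comm_semiring_1) series)"
proof
  fix Q :: "'n \<Rightarrow> nat"
  have "smul sone f Q = (\<Sum>P\<in>{0}. sone P * f (Q - P))"
    unfolding smul_def
    by (rule sum.mono_neutral_right) (auto simp: sone_def finite_atMost_fun le_fun_def)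
  then show "smul sone f Q = f Q"
    by (simp add: sone_def fun_diff_def)
qed

lemma smul_sone_right [simp]: "smul f sone = (f :: ('n::finite, 'a::comm_semiring_1) series)"
  by (subst smul_commute) simp

lemma smul_add_left: "smul (\<lambda>Q. f Q + g Q) h = (\<lambda>Q. smul f h Q + smul g (h :: ('n, 'a::comm_semiring_1) series) Q)"
  by (simp add: smul_def distrib_right sum.distrib)

lemma mono_series_zero: "mono_series 0 = sone" "mono_series (\<lambda>_. 0) = sone"
  by (auto simp: mono_series_def sone_def fun_eq_iff)

lemma formal_ring_simps [simp]:
  "carrier formal_ring = UNIV" "f \<otimes>\<^bsub>formal_ring\<^esub> g = smul f g" "\<one>\<^bsub>formal_ring\<^esub> = sone"
  "\<zero>\<^bsub>formal_ring\<^esub> = (\<lambda>_. 0)" "f \<oplus>\<^bsub>formal_ring\<^esub> g = (\<lambda>Q. f Q + g Q)"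
  by (auto simp: formal_ring_def smul_def mono_series_zero)

lemma cring_formal_ring: "cring (formal_ring :: ('n::finite) fseries ring)"
proof (rule cringI)
  show "abelian_group (formal_ring :: 'n fseries ring)"
  proof (rule abelian_groupI)
    fix x :: "'n fseries"
    show "\<exists>y\<in>carrier formal_ring. y \<oplus>\<^bsub>formal_ring\<^esub> x = \<zero>\<^bsub>formal_ring\<^esub>"
      by (rule bexI[of _ "\<lambda>Q. - x Q"]) auto
  qed (auto simp: algebra_simps)
  show "comm_monoid (formal_ring :: 'n fseries ring)"
    by (rule comm_monoidI) (auto simp: smul_assoc, subst smul_commute, simp)
qed (auto simp: smul_add_left)

section \<open>Products of series along lists of variables\<close>

fun sprod :: "('n \<Rightarrow> ('n, 'a::comm_semiring_1) series) \<Rightarrow> 'n list \<Rightarrow> ('n, 'a) series" where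
  "sprod d [] = sone"
| "sprod d (k # ks) = smul (d k) (sprod d ks)"

lemma sprod_append:
  "sprod d (ks @ ls) = smul (sprod d ks) (sprod (d :: 'n::finite \<Rightarrow> ('n, 'a::comm_semiring_1) series) ls)"
  by (induction ks) (auto simp: smul_assoc)

text \<open>Writing a monomial as a list of variables turns all statements about
  \<open>\<Phi>\<^sup>P\<close> into inductions over lists.\<close>

definition index_list :: "('n::finite \<Rightarrow> nat) \<Rightarrow> 'n list" where
  "index_list P = concat (map (\<lambda>k. replicate (P k) k) (SOME xs. distinct xs \<and> set xs = UNIV))"

lemma index_list_enum:
  obtains xs :: "'n::finite list" where "distinct xs" "set xs = UNIV"
    "\<And>P. index_list P = concat (map (\<lambda>k. replicate (P k) k) xs)"
proof -
  have "\<exists>xs :: 'n list. distinct xs \<and> set xs = UNIV"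
    using finite_distinct_list[of "UNIV :: 'n set"] by auto
  from someI_ex[OF this] show ?thesis
    by (intro that) (auto simp: index_list_def)
qed

lemma prod_index_list:
  fixes f :: "'n::finite \<Rightarrow> 'a::comm_monoid_mult"
  shows "prod_list (map f (index_list P)) = (\<Prod>k\<in>UNIV. f k ^ P k)"
proof -
  obtain xs :: "'n list" where xs: "distinct xs" "set xs = UNIV"
    "\<And>P. index_list P = concat (map (\<lambda>k. replicate (P k) k) xs)"
    using index_list_enum by blast
  have "prod_list (map f (concat (map (\<lambda>k. replicate (P k) k) ys))) = (\<Prod>k\<leftarrow>ys. f k ^ P k)" for ys
    by (induction ys) (auto simp: prod_list_replicate)
  moreover have "(\<Prod>k\<leftarrow>xs. f k ^ P k) = (\<Prod>k\<in>UNIV. f k ^ P k)"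
    using prod.distinct_set_conv_list[OF xs(1), of "\<lambda>k. f k ^ P k"] xs(2) by simp
  ultimately show ?thesis by (simp add: xs(3))
qed

lemma length_index_list [simp]: "length (index_list P) = mdeg (P :: 'n::finite \<Rightarrow> nat)"
proof -
  obtain xs :: "'n list" where xs: "distinct xs" "set xs = UNIV"
    "\<And>P. index_list P = concat (map (\<lambda>k. replicate (P k) k) xs)"
    using index_list_enum by blast
  show ?thesis
    using xs sum_list_distinct_conv_sum_set[OF xs(1), of P]
    by (simp add: mdeg_def length_concat o_def)
qed

lemma index_list_zero [simp]: "index_list (0 :: 'n::finite \<Rightarrow> nat) = []" "index_list (\<lambda>_ :: 'n. 0) = []"
  using length_index_list[of "0 :: 'n \<Rightarrow> nat"] by (auto simp: zero_fun_def simp del: length_index_list)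

lemma index_list_unit [simp]: "index_list (unit_index k :: 'n::finite \<Rightarrow> nat) = [k]"
proof -
  obtain xs :: "'n list" where xs: "distinct xs" "set xs = UNIV"
    "\<And>P. index_list P = concat (map (\<lambda>k. replicate (P k) k) xs)"
    using index_list_enum by blast
  have "set (index_list (unit_index k)) \<subseteq> {k}"
    by (auto simp: xs(3) unit_index_def split: if_splits)
  moreover have "length (index_list (unit_index k)) = 1" by simp
  ultimately show ?thesis
    by (auto simp: length_Suc_conv simp del: length_index_list)
qed

lemma mpow_index_list: "mpow x P = prod_list (map (\<lambda>k. x $ k) (index_list P))"
  by (simp add: mpow_def prod_index_list)

text \<open>Leads from the algebraic definition of \<open>fsubst\<close> to lists: a power is a
  product along a constant list, and \<open>index_list P\<close> concatenates these blocks.\<close>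

lemma finprod_formal_ring:
  "finprod formal_ring (\<lambda>k. \<Phi> k [^]\<^bsub>formal_ring\<^esub> P k) UNIV = sprod \<Phi> (index_list (P :: 'n::finite \<Rightarrow> nat))"
proof -
  interpret cring "formal_ring :: 'n fseries ring" by (rule cring_formal_ring)
  obtain xs :: "'n list" where xs: "distinct xs" "set xs = UNIV"
    "\<And>P. index_list P = concat (map (\<lambda>k. replicate (P k) k) xs)"
    using index_list_enum by blast
  have pow: "f k [^]\<^bsub>formal_ring\<^esub> m = sprod f (replicate m k)" for f :: "'n fmap" and m :: nat and k
  proof (induction m)
    case (Suc m)
    have "f k [^]\<^bsub>formal_ring\<^esub> Suc m = smul (f k [^]\<^bsub>formal_ring\<^esub> m) (f k)" by simp
    then show ?case using Suc by (metis replicate_Suc sprod.simps(2) smul_commute)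
  qed simp
  have "finprod formal_ring (\<lambda>k. \<Phi> k [^]\<^bsub>formal_ring\<^esub> P k) (set ys) =
      sprod \<Phi> (concat (map (\<lambda>k. replicate (P k) k) ys))" if "distinct ys" for ys
    using that
  proof (induction ys)
    case (Cons y ys)
    then show ?case by (simp add: finprod_insert sprod_append pow del: nat_pow_Suc)
  qed simp
  from this[OF xs(1)] show ?thesis by (simp add: xs(2,3))
qed

lemma fsubst_eq: "fsubst f \<Phi> Q = (\<Sum>P | mdeg P \<le> mdeg Q. f P * sprod \<Phi> (index_list P) Q)"
  by (simp add: fsubst_def finprod_formal_ring)

section \<open>Absolute convergence on polydiscs\<close>

definition absconv :: "('n::finite, 'a::real_normed_field) series \<Rightarrow> real \<Rightarrow> bool" where
  "absconv c r \<longleftrightarrow> (\<lambda>Q. norm (c Q) * r ^ mdeg Q) summable_on UNIV"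

text \<open>The weighted l1 norm. On absolutely convergent series it bounds the values on
  \<open>polydisc r\<close> and is submultiplicative, which is what composition requires.\<close>

definition snorm :: "('n::finite, 'a::real_normed_field) series \<Rightarrow> real \<Rightarrow> real" where
  "snorm c r = (\<Sum>\<^sub>\<infinity>Q. norm (c Q) * r ^ mdeg Q)"

definition seval :: "'n::finite fseries \<Rightarrow> complex ^ 'n \<Rightarrow> complex" where
  "seval c z = (\<Sum>\<^sub>\<infinity>Q. c Q * mpow z Q)"

definition polydisc :: "real \<Rightarrow> (complex ^ 'n::finite) set" where
  "polydisc r = {z. \<forall>k. norm (z $ k) \<le> r}"

lemma norm_mpow_le:
  fixes z :: "complex ^ 'n::finite"
  assumes "z \<in> polydisc r"
  shows "norm (mpow z Q) \<le> r ^ mdeg Q"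
proof -
  have "norm (mpow z Q) = (\<Prod>k\<in>UNIV. norm (z $ k) ^ Q k)"
    by (simp add: mpow_def norm_power flip: prod_norm)
  also have "\<dots> \<le> (\<Prod>k\<in>UNIV. r ^ Q k)"
    using assms by (intro prod_mono) (auto simp: polydisc_def intro: power_mono)
  also have "\<dots> = r ^ mdeg Q"
    by (simp add: mdeg_def power_sum)
  finally show ?thesis .
qed

lemma polydisc_mono: "r \<le> s \<Longrightarrow> polydisc r \<subseteq> polydisc s"
  by (auto simp: polydisc_def intro: order_trans)

lemma polydisc_nonneg: "z \<in> polydisc r \<Longrightarrow> 0 \<le> r"
  unfolding polydisc_def using norm_ge_zero order_trans by blast

lemma eventually_polydisc:
  "eventually P (nhds (0 :: complex ^ 'n::finite)) \<longleftrightarrow> (\<exists>r>0. \<forall>z\<in>polydisc r. P z)"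
proof
  assume "eventually P (nhds (0 :: complex ^ 'n))"
  then obtain e where e: "e > 0" "\<And>z. dist z 0 < e \<Longrightarrow> P z"
    by (auto simp: eventually_nhds_metric)
  \<comment> \<open>The Euclidean norm is at most the sum of the coordinate norms; the factor 2
    makes the resulting bound strict.\<close>
  define r where "r = e / (2 * CARD('n))"
  have r: "r > 0" using e by (simp add: r_def)
  have "P z" if "z \<in> polydisc r" for z
  proof -
    have "norm z \<le> (\<Sum>k\<in>UNIV. norm (z $ k))"
      unfolding norm_vec_def by (rule L2_set_le_sum) auto
    also have "\<dots> \<le> (\<Sum>k\<in>(UNIV :: 'n set). r)"
      using that by (intro sum_mono) (auto simp: polydisc_def)
    also have "\<dots> < e" using e by (simp add: r_def)
    finally show ?thesis by (intro e) simp
  qed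
  with r show "\<exists>r>0. \<forall>z\<in>polydisc r. P z" by blast
next
  assume "\<exists>r>0. \<forall>z\<in>polydisc r. P z"
  then obtain r where r: "r > 0" "\<And>z. z \<in> polydisc r \<Longrightarrow> P z" by blast
  have "P z" if "dist z 0 < r" for z
    using that by (intro r) (auto simp: polydisc_def intro: order_trans[OF Finite_Cartesian_Product.norm_nth_le] less_imp_le)
  then show "eventually P (nhds 0)" using r by (auto simp: eventually_nhds_metric)
qed

lemma absconv_mono:
  assumes "absconv c r" "0 \<le> s" "s \<le> r"
  shows "absconv c s"
  unfolding absconv_def
  by (rule summable_on_comparison_test[OF assms(1)[unfolded absconv_def]])
    (use assms in \<open>auto intro!: mult_left_mono power_mono\<close>)

lemma snorm_nonneg: "0 \<le> r \<Longrightarrow> 0 \<le> snorm c r"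
  unfolding snorm_def by (rule infsum_nonneg) auto

lemma absconv_has_sum: "absconv c r \<Longrightarrow> ((\<lambda>Q. norm (c Q) * r ^ mdeg Q) has_sum snorm c r) UNIV"
  unfolding absconv_def snorm_def by (rule has_sum_infsum)

lemma absconv_comparison:
  assumes "absconv g r" "\<And>Q. norm (f Q) \<le> norm (g Q)" "0 \<le> r"
  shows "absconv f r" "snorm f r \<le> snorm g r"
proof -
  show *: "absconv f r"
    unfolding absconv_def
    by (rule summable_on_comparison_test[OF assms(1)[unfolded absconv_def]])
      (use assms in \<open>auto intro!: mult_right_mono\<close>)
  show "snorm f r \<le> snorm g r"
    by (rule has_sum_mono[OF absconv_has_sum[OF *] absconv_has_sum[OF assms(1)]])
      (use assms in \<open>auto intro!: mult_right_mono\<close>)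
qed

lemma absconvI_bound:
  assumes "\<And>N. (\<Sum>Q | mdeg Q \<le> N. norm (c Q) * r ^ mdeg Q) \<le> K" "0 \<le> r"
  shows "absconv c r"
  unfolding absconv_def
proof (rule nonneg_bounded_partial_sums_imp_summable_on[where C = K])
  have "sum (\<lambda>Q. norm (c Q) * r ^ mdeg Q) X \<le> K" if X: "finite X" for X
  proof -
    obtain N where N: "\<And>Q. Q \<in> X \<Longrightarrow> mdeg Q \<le> N"
      using finite_nat_set_iff_bounded_le[of "mdeg ` X"] X by auto
    have "sum (\<lambda>Q. norm (c Q) * r ^ mdeg Q) X \<le> (\<Sum>Q | mdeg Q \<le> N. norm (c Q) * r ^ mdeg Q)"
      using N assms by (intro sum_mono2) (auto simp: finite_mdeg_le)
    then show ?thesis using assms(1)[of N] by linarith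
  qed
  then show "\<forall>\<^sub>F X in finite_subsets_at_top UNIV. sum (\<lambda>Q. norm (c Q) * r ^ mdeg Q) X \<le> K"
    unfolding eventually_finite_subsets_at_top by auto
qed (use assms in auto)

lemma absconv_partial_le:
  assumes "absconv c r" "0 \<le> r" "finite X"
  shows "(\<Sum>Q\<in>X. norm (c Q) * r ^ mdeg Q) \<le> snorm c r"
  unfolding snorm_def
  by (rule finite_sum_le_infsum) (use assms in \<open>auto simp: absconv_def\<close>)

lemma seval_abs_summable:
  assumes "absconv c r" "z \<in> polydisc r"
  shows "(\<lambda>Q. norm (c Q * mpow z Q)) summable_on UNIV"
proof (rule Infinite_Sum.abs_summable_on_comparison_test')
  show "(\<lambda>Q. norm (c Q) * r ^ mdeg Q) summable_on UNIV"
    using assms(1) by (simp add: absconv_def)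
qed (use norm_mpow_le[OF assms(2)] in \<open>auto simp: norm_mult intro!: mult_left_mono\<close>)

lemma seval_has_sum:
  assumes "absconv c r" "z \<in> polydisc r"
  shows "((\<lambda>Q. c Q * mpow z Q) has_sum seval c z) UNIV"
  unfolding seval_def using abs_summable_summable[OF seval_abs_summable[OF assms]]
  by (rule has_sum_infsum)

lemma norm_seval_le:
  assumes "absconv c r" "z \<in> polydisc r"
  shows "norm (seval c z) \<le> snorm c r"
  by (rule norm_infsum_le[OF seval_has_sum[OF assms] absconv_has_sum[OF assms(1)]])
    (use norm_mpow_le[OF assms(2)] in \<open>auto simp: norm_mult intro!: mult_left_mono\<close>)

text \<open>An estimate of Schwarz type: a series of order \<open>m\<close> gains the
  \<open>m\<close>-th power of the ratio of radii. With \<open>m = 1\<close> it makes inner maps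
  small enough for composition, with \<open>m = 2\<close> it bounds Taylor remainders.\<close>

lemma snorm_shrink:
  assumes "absconv c r" "0 < s" "s \<le> r" "\<And>Q. mdeg Q < m \<Longrightarrow> c Q = 0"
  shows "snorm c s \<le> (s / r) ^ m * snorm c r"
proof (rule has_sum_mono[OF absconv_has_sum has_sum_cmult_right[OF absconv_has_sum[OF assms(1)]]])
  show "absconv c s" using assms by (intro absconv_mono[OF assms(1)]) auto
  fix Q
  show "norm (c Q) * s ^ mdeg Q \<le> (s / r) ^ m * (norm (c Q) * r ^ mdeg Q)"
  proof (cases "mdeg Q < m")
    case False
    have r: "r > 0" using assms by simp
    have "s ^ mdeg Q = (s / r) ^ mdeg Q * r ^ mdeg Q"
      using r by (simp add: power_divide)
    also have "\<dots> \<le> (s / r) ^ m * r ^ mdeg Q"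
      using False r assms by (intro mult_right_mono power_decreasing) auto
    finally have "norm (c Q) * s ^ mdeg Q \<le> norm (c Q) * ((s / r) ^ m * r ^ mdeg Q)"
      by (rule mult_left_mono) simp
    then show ?thesis by (simp only: mult_ac)
  qed (use assms in simp)
qed

text \<open>Absolute convergence allows the double sum over pairs to be regrouped by the sum of the
  two indices, and each group is finite.\<close>

lemma cauchy_product:
  fixes a b :: "('n::finite \<Rightarrow> nat) \<Rightarrow> 'a::{real_normed_field, banach}"
  assumes a: "(\<lambda>Q. norm (a Q)) summable_on UNIV" and b: "(\<lambda>Q. norm (b Q)) summable_on UNIV"
  shows "(smul a b has_sum infsum a UNIV * infsum b UNIV) UNIV"
proof -
  let ?h = "\<lambda>(A, B). a A * b B"
  have abs: "(\<lambda>x. norm (?h x)) summable_on UNIV \<times> UNIV"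
    using a b unfolding Infinite_Sum.abs_summable_on_Sigma_iff
    by (auto simp: norm_mult abs_mult infsum_cmult_right' infsum_nonneg
        intro!: summable_on_cmult_left summable_on_cmult_right)
  have sum: "?h summable_on UNIV \<times> UNIV"
    by (rule abs_summable_summable[OF abs])
  have "infsum ?h (UNIV \<times> UNIV) = (\<Sum>\<^sub>\<infinity>A. \<Sum>\<^sub>\<infinity>B. a A * b B)"
    using infsum_Sigma'_banach[of "\<lambda>A B. a A * b B" UNIV "\<lambda>_. UNIV"] sum by simp
  also have "\<dots> = infsum a UNIV * infsum b UNIV"
    by (simp add: infsum_cmult_right' infsum_cmult_left')
  finally have "(?h has_sum infsum a UNIV * infsum b UNIV) (UNIV \<times> UNIV)"
    using sum by (metis has_sum_infsum)
  also have "?this \<longleftrightarrow> ((\<lambda>(Q, P). a P * b (Q - P)) has_sum infsum a UNIV * infsum b UNIV) (Sigma UNIV atMost)"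
    by (rule has_sum_reindex_bij_witness[of _ "\<lambda>(Q, P). (P, Q - P)" "\<lambda>(A, B). (A + B, A)"])
      (auto simp: le_plus_fun le_imp_ex_plus[symmetric])
  finally have *: "((\<lambda>(Q, P). a P * b (Q - P)) has_sum infsum a UNIV * infsum b UNIV) (Sigma UNIV atMost)" .
  show ?thesis
    by (rule has_sum_SigmaD[OF *]) (auto simp: smul_def finite_atMost_fun intro: has_sum_finite)
qed

lemma smul_mpow: "smul f g Q * mpow z Q = smul (\<lambda>Q. f Q * mpow z Q) (\<lambda>Q. g Q * mpow z (Q :: 'n::finite \<Rightarrow> nat)) Q"
  unfolding smul_def sum_distrib_right
proof (rule sum.cong)
  fix P assume "P \<in> {..Q}"
  then have "mpow z Q = mpow z P * mpow z (Q - P)"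
    by (metis atMost_iff le_imp_ex_plus mpow_plus)
  then show "f P * g (Q - P) * mpow z Q = f P * mpow z P * (g (Q - P) * mpow z (Q - P))"
    by (simp add: mult_ac)
qed simp

lemma norm_smul_le: "norm (smul f g Q) \<le> smul (\<lambda>Q. norm (f Q)) (\<lambda>Q. norm (g Q)) Q"
  for f g :: "('n::finite, 'a::real_normed_field) series"
  unfolding smul_def by (rule order_trans[OF norm_sum]) (simp add: norm_mult)

lemma smul_scale:
  "smul f g Q * r ^ mdeg Q = smul (\<lambda>Q. f Q * r ^ mdeg Q) (\<lambda>Q. g Q * r ^ mdeg (Q :: 'n::finite \<Rightarrow> nat)) Q"
  unfolding smul_def sum_distrib_right
proof (rule sum.cong)
  fix P assume "P \<in> {..Q}"
  then have "r ^ mdeg Q = r ^ mdeg P * r ^ mdeg (Q - P)"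
    by (metis atMost_iff le_imp_ex_plus mdeg_plus power_add)
  then show "f P * g (Q - P) * r ^ mdeg Q = f P * r ^ mdeg P * (g (Q - P) * r ^ mdeg (Q - P))"
    by (simp add: mult_ac)
qed simp

lemma absconv_smul:
  fixes f g :: "('n::finite, 'a::{real_normed_field, banach}) series"
  assumes "absconv f r" "absconv g r" "0 \<le> r"
  shows "absconv (smul f g) r" "snorm (smul f g) r \<le> snorm f r * snorm g r"
proof -
  let ?w = "\<lambda>f Q. norm (f Q) * r ^ mdeg Q"
  have *: "(smul (?w f) (?w g) has_sum snorm f r * snorm g r) UNIV"
    unfolding snorm_def using assms by (intro cauchy_product) (auto simp: absconv_def)
  have le: "?w (smul f g) Q \<le> smul (?w f) (?w g) Q" for Q
    unfolding smul_scale[symmetric] using assms by (intro mult_right_mono norm_smul_le) auto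
  show conv: "absconv (smul f g) r"
    unfolding absconv_def
    by (rule summable_on_comparison_test[OF has_sum_imp_summable[OF *]]) (use le assms in auto)
  show "snorm (smul f g) r \<le> snorm f r * snorm g r"
    by (rule has_sum_mono[OF absconv_has_sum[OF conv] *]) (use le in auto)
qed

lemma seval_smul:
  assumes "absconv f r" "absconv g r" "z \<in> polydisc r"
  shows "seval (smul f g) z = seval f z * seval g z"
proof -
  have "(\<lambda>Q. smul f g Q * mpow z Q) = smul (\<lambda>Q. f Q * mpow z Q) (\<lambda>Q. g Q * mpow z Q)"
    by (rule ext) (rule smul_mpow)
  then show ?thesis
    using cauchy_product[OF seval_abs_summable seval_abs_summable, OF assms(1,3,2,3)]
    by (simp add: seval_def infsumI)
qed

lemma absconv_finite:
  assumes "finite {Q. c Q \<noteq> 0}"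
  shows "absconv c r"
  unfolding absconv_def
  using assms by (subst summable_on_cong_neutral[of "{Q. c Q \<noteq> 0}" _ _ "\<lambda>Q. norm (c Q) * r ^ mdeg Q"]) auto

lemma seval_finite:
  assumes "finite A" "\<And>Q. Q \<notin> A \<Longrightarrow> c Q = 0"
  shows "seval c z = (\<Sum>Q\<in>A. c Q * mpow z Q)"
  unfolding seval_def
  using assms by (subst infsum_cong_neutral[of A _ _ "\<lambda>Q. c Q * mpow z Q"]) auto

lemma snorm_finite:
  assumes "finite A" "\<And>Q. Q \<notin> A \<Longrightarrow> c Q = 0"
  shows "snorm c r = (\<Sum>Q\<in>A. norm (c Q) * r ^ mdeg Q)"
  unfolding snorm_def
  using assms by (subst infsum_cong_neutral[of A _ _ "\<lambda>Q. norm (c Q) * r ^ mdeg Q"]) auto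

lemma sone_conv: "absconv sone r" "snorm (sone :: ('n::finite, 'a::real_normed_field) series) r = 1" "seval sone z = 1"
proof -
  have *: "{Q :: 'n \<Rightarrow> nat. (sone Q :: 'a) \<noteq> 0} \<subseteq> {0}" by (auto simp: sone_def)
  show "absconv sone r" by (rule absconv_finite) (auto simp: sone_def)
  show "snorm (sone :: ('n, 'a) series) r = 1"
    by (subst snorm_finite[of "{0}"]) (auto simp: sone_def)
  show "seval sone z = 1"
    by (subst seval_finite[of "{0}"]) (auto simp: sone_def)
qed

lemma absconv_sprod:
  fixes d :: "'n::finite \<Rightarrow> ('n, 'a::{real_normed_field, banach}) series"
  assumes "\<And>k. absconv (d k) r" "0 \<le> r"
  shows "absconv (sprod d ks) r \<and> snorm (sprod d ks) r \<le> prod_list (map (\<lambda>k. snorm (d k) r) ks)"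
proof (induction ks)
  case (Cons k ks)
  have "snorm (sprod d (k # ks)) r \<le> snorm (d k) r * snorm (sprod d ks) r"
    using absconv_smul(2)[of "d k" r "sprod d ks"] assms Cons by simp
  also have "\<dots> \<le> snorm (d k) r * prod_list (map (\<lambda>k. snorm (d k) r) ks)"
    using Cons assms by (intro mult_left_mono snorm_nonneg) auto
  finally show ?case using Cons assms by (auto intro: absconv_smul)
qed (simp add: sone_conv)

lemma seval_sprod:
  assumes "\<And>k. absconv (d k) r" "z \<in> polydisc r"
  shows "seval (sprod d ks) z = prod_list (map (\<lambda>k. seval (d k) z) ks)"
proof (induction ks)
  case (Cons k ks)
  have "absconv (sprod d ks) r"
    using absconv_sprod[of d r ks] assms polydisc_nonneg by blast
  then show ?case using Cons assms by (simp add: seval_smul[of _ r])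
qed (simp add: sone_conv)

lemma prod_list_le_power:
  fixes f :: "'n \<Rightarrow> real"
  assumes "\<And>k. 0 \<le> f k" "\<And>k. f k \<le> \<rho>"
  shows "prod_list (map f ks) \<le> \<rho> ^ length ks" "0 \<le> prod_list (map f ks)"
proof -
  have "0 \<le> prod_list (map f ks) \<and> prod_list (map f ks) \<le> \<rho> ^ length ks"
  proof (induction ks)
    case (Cons k ks)
    have "f k * prod_list (map f ks) \<le> \<rho> * \<rho> ^ length ks"
      using Cons assms[of k] by (intro mult_mono) auto
    then show ?case using Cons assms by auto
  qed simp
  then show "prod_list (map f ks) \<le> \<rho> ^ length ks" "0 \<le> prod_list (map f ks)" by auto
qed

lemma snorm_sprod_le:
  fixes d :: "'n::finite \<Rightarrow> ('n, 'a::{real_normed_field, banach}) series"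
  assumes "\<And>k. absconv (d k) r" "0 \<le> r" "\<And>k. snorm (d k) r \<le> \<rho>"
  shows "snorm (sprod d ks) r \<le> \<rho> ^ length ks"
proof -
  have "snorm (sprod d ks) r \<le> prod_list (map (\<lambda>k. snorm (d k) r) ks)"
    using absconv_sprod[of d r ks] assms by blast
  also have "\<dots> \<le> \<rho> ^ length ks"
    using assms by (intro prod_list_le_power snorm_nonneg) auto
  finally show ?thesis .
qed

section \<open>Composition of power series\<close>

text \<open>Each factor has order at least 1, so the order of the product is at least the number of
  factors.\<close>

lemma sprod_eq_0:
  assumes "\<And>k. d k 0 = 0" "mdeg Q < length ks"
  shows "sprod d ks Q = (0 :: 'a::comm_semiring_1)"
  using assms(2)
proof (induction ks arbitrary: Q)
  case (Cons k ks)
  have "d k P * sprod d ks (Q - P) = 0" if "P \<le> Q" for P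
  proof (cases "P = 0")
    case False
    then have "mdeg (Q - P) < mdeg Q"
      using that mdeg_mono[OF that] mdeg_eq_0_iff[of P] by (simp add: mdeg_diff)
    then show ?thesis using Cons.IH[of "Q - P"] Cons.prems by (simp del: fun_diff_def minus_apply)
  qed (simp add: assms)
  then show ?case by (simp add: smul_def)
qed simp

text \<open>Inner series with constant terms are allowed here, at the price of an infinite sum in
  each coefficient. This is what re-expansion at a point other than 0 needs.\<close>

definition series_comp :: "'n::finite fseries \<Rightarrow> ('n \<Rightarrow> 'n fseries) \<Rightarrow> 'n fseries" where
  "series_comp c d = (\<lambda>Q. \<Sum>\<^sub>\<infinity>P. c P * sprod d (index_list P) Q)"

lemma series_comp_eq_fsubst:
  assumes "\<And>k. d k 0 = 0"
  shows "series_comp c d = fsubst c d"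
proof
  fix Q
  have "series_comp c d Q = (\<Sum>\<^sub>\<infinity>P\<in>{P. mdeg P \<le> mdeg Q}. c P * sprod d (index_list P) Q)"
    unfolding series_comp_def by (rule infsum_cong_neutral) (auto simp: not_le sprod_eq_0 assms)
  also have "\<dots> = fsubst c d Q"
    by (simp add: fsubst_eq infsum_finite[OF finite_mdeg_le])
  finally show "series_comp c d Q = fsubst c d Q" .
qed

text \<open>By submultiplicativity the power with exponent \<open>P\<close> has norm at most
  \<open>\<rho> ^ mdeg P\<close>, so \<open>snorm c \<rho>\<close> dominates the double sum. The
  weight \<open>w\<close> is either a power of the radius, for convergence of the composition, or a
  monomial in \<open>z\<close>, for its value.\<close>

lemma series_comp_abs_summable:
  fixes w :: "('n::finite \<Rightarrow> nat) \<Rightarrow> complex"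
  assumes c: "absconv c \<rho>" and d: "\<And>k. absconv (d k) r" "\<And>k. snorm (d k) r \<le> \<rho>"
    and w: "\<And>Q. norm (w Q) \<le> r ^ mdeg Q" and r: "0 \<le> r"
  shows "(\<lambda>x. norm (case x of (P, Q) \<Rightarrow> c P * (sprod d (index_list P) Q * w Q))) summable_on UNIV \<times> UNIV"
proof -
  let ?s = "\<lambda>P. sprod d (index_list P)"
  have s: "absconv (?s P) r" for P using absconv_sprod[of d r] d(1) r by blast
  have le: "norm (?s P Q * w Q) \<le> norm (?s P Q) * r ^ mdeg Q" for P Q
    using w by (simp add: norm_mult mult_left_mono)
  have sw: "(\<lambda>Q. norm (?s P Q * w Q)) summable_on UNIV" for P
    by (rule Infinite_Sum.abs_summable_on_comparison_test'[OF s[unfolded absconv_def] le])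
  have "(\<Sum>\<^sub>\<infinity>Q. norm (?s P Q * w Q)) \<le> \<rho> ^ mdeg P" for P
  proof -
    have "(\<Sum>\<^sub>\<infinity>Q. norm (?s P Q * w Q)) \<le> snorm (?s P) r"
      unfolding snorm_def using le by (intro infsum_mono sw s[unfolded absconv_def])
    also have "\<dots> \<le> \<rho> ^ mdeg P"
      using snorm_sprod_le[of d r \<rho> "index_list P"] d r by simp
    finally show ?thesis .
  qed
  then have "norm (c P) * (\<Sum>\<^sub>\<infinity>Q. norm (?s P Q * w Q)) \<le> norm (c P) * \<rho> ^ mdeg P" for P
    by (simp add: mult_left_mono)
  then have "(\<lambda>P. norm (norm (c P) * (\<Sum>\<^sub>\<infinity>Q. norm (?s P Q * w Q)))) summable_on UNIV"
    by (intro Infinite_Sum.abs_summable_on_comparison_test'[OF c[unfolded absconv_def]])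
      (simp add: abs_mult infsum_nonneg)
  then show ?thesis
    using sw unfolding Infinite_Sum.abs_summable_on_Sigma_iff
    by (auto simp: norm_mult infsum_cmult_right' mult.assoc intro!: summable_on_cmult_right)
qed

lemma series_comp_has_sum:
  fixes w :: "('n::finite \<Rightarrow> nat) \<Rightarrow> complex"
  assumes c: "absconv c \<rho>" and d: "\<And>k. absconv (d k) r" "\<And>k. snorm (d k) r \<le> \<rho>"
    and w: "\<And>Q. norm (w Q) \<le> r ^ mdeg Q" and r: "0 \<le> r"
  shows "(\<lambda>Q. norm (series_comp c d Q * w Q)) summable_on UNIV"
    and "((\<lambda>P. c P * (\<Sum>\<^sub>\<infinity>Q. sprod d (index_list P) Q * w Q)) has_sum (\<Sum>\<^sub>\<infinity>Q. series_comp c d Q * w Q)) UNIV"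
proof -
  let ?s = "\<lambda>P. sprod d (index_list P)"
  let ?h = "\<lambda>P Q. c P * (?s P Q * w Q)"
  have abs: "(\<lambda>x. norm (case x of (P, Q) \<Rightarrow> ?h P Q)) summable_on UNIV \<times> UNIV"
    by (rule series_comp_abs_summable[OF assms])
  have "(\<lambda>x. norm (case x of (Q, P) \<Rightarrow> ?h P Q)) summable_on UNIV \<times> UNIV"
    using abs by (subst summable_on_swap) (simp add: case_prod_beta')
  then have Qsum: "(\<lambda>Q. \<Sum>\<^sub>\<infinity>P. norm (?h P Q)) summable_on UNIV"
      and Psum: "\<And>Q. (\<lambda>P. norm (?h P Q)) summable_on UNIV"
    unfolding Infinite_Sum.abs_summable_on_Sigma_iff
    by (auto simp: infsum_nonneg)
  have inner: "series_comp c d Q * w Q = (\<Sum>\<^sub>\<infinity>P. ?h P Q)" for Q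
    unfolding series_comp_def by (simp add: mult.assoc flip: infsum_cmult_left')
  show "(\<lambda>Q. norm (series_comp c d Q * w Q)) summable_on UNIV"
    by (rule Infinite_Sum.abs_summable_on_comparison_test'[OF Qsum])
      (unfold inner, rule norm_infsum_bound[OF Psum])
  have sum: "(\<lambda>(P, Q). ?h P Q) summable_on UNIV \<times> UNIV"
    by (rule abs_summable_summable[OF abs])
  have "(\<Sum>\<^sub>\<infinity>Q. series_comp c d Q * w Q) = (\<Sum>\<^sub>\<infinity>P. \<Sum>\<^sub>\<infinity>Q. ?h P Q)"
    unfolding inner by (rule infsum_swap_banach[OF sum, symmetric])
  also have "\<dots> = infsum (\<lambda>(P, Q). ?h P Q) (UNIV \<times> UNIV)"
    using infsum_Sigma'_banach[of ?h UNIV "\<lambda>_. UNIV"] sum by simp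
  finally have "((\<lambda>(P, Q). ?h P Q) has_sum (\<Sum>\<^sub>\<infinity>Q. series_comp c d Q * w Q)) (UNIV \<times> UNIV)"
    using has_sum_infsum[OF sum] by simp
  then show "((\<lambda>P. c P * (\<Sum>\<^sub>\<infinity>Q. ?s P Q * w Q)) has_sum (\<Sum>\<^sub>\<infinity>Q. series_comp c d Q * w Q)) UNIV"
  proof (rule has_sum_SigmaD)
    fix P
    have "(\<lambda>Q. norm (?s P Q * w Q)) summable_on UNIV"
    proof (rule Infinite_Sum.abs_summable_on_comparison_test')
      show "(\<lambda>Q. norm (?s P Q) * r ^ mdeg Q) summable_on UNIV"
        using absconv_sprod[of d r] d(1) r by (auto simp: absconv_def)
    qed (use w in \<open>auto simp: norm_mult mult_left_mono\<close>)
    then have "((\<lambda>Q. ?s P Q * w Q) has_sum (\<Sum>\<^sub>\<infinity>Q. ?s P Q * w Q)) UNIV"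
      by (rule has_sum_infsum[OF abs_summable_summable])
    from has_sum_cmult_right[OF this, of "c P"]
    show "((\<lambda>Q. case (P, Q) of (P, Q) \<Rightarrow> ?h P Q) has_sum c P * (\<Sum>\<^sub>\<infinity>Q. ?s P Q * w Q)) UNIV"
      by simp
  qed
qed

theorem seval_series_comp:
  assumes c: "absconv c \<rho>" and d: "\<And>k. absconv (d k) r" "\<And>k. snorm (d k) r \<le> \<rho>" and r: "0 \<le> r"
  shows "absconv (series_comp c d) r"
    and "z \<in> polydisc r \<Longrightarrow> seval (series_comp c d) z = seval c (\<chi> k. seval (d k) z)"
proof -
  have "(\<lambda>Q. norm (series_comp c d Q * of_real (r ^ mdeg Q))) summable_on UNIV"
    using r by (intro series_comp_has_sum(1)[OF c d]) (auto simp: norm_power)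
  then show "absconv (series_comp c d) r"
    using r by (simp add: absconv_def norm_mult norm_power)
  assume z: "z \<in> polydisc r"
  have "((\<lambda>P. c P * seval (sprod d (index_list P)) z) has_sum seval (series_comp c d) z) UNIV"
    unfolding seval_def by (rule series_comp_has_sum(2)[OF c d norm_mpow_le[OF z] r])
  then show "seval (series_comp c d) z = seval c (\<chi> k. seval (d k) z)"
    unfolding seval_def[of c] mpow_index_list
    by (simp add: seval_sprod[OF d(1) z] infsumI vec_lambda_inverse)
qed

lemma uniform_snorm_bound:
  fixes c :: "'i::finite \<Rightarrow> ('n::finite, 'a::real_normed_field) series"
  assumes "0 \<le> r"
  shows "\<exists>K>0. \<forall>k. snorm (c k) r \<le> K"
proof (intro exI conjI allI)
  have pos: "0 \<le> snorm (c k) r" for k using assms by (rule snorm_nonneg)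
  then show "0 < (\<Sum>k\<in>UNIV. snorm (c k) r) + 1"
    by (intro add_nonneg_pos sum_nonneg) auto
  fix k
  show "snorm (c k) r \<le> (\<Sum>k\<in>UNIV. snorm (c k) r) + 1"
    using member_le_sum[of k UNIV "\<lambda>k. snorm (c k) r"] pos by simp
qed

text \<open>Inner series without constant term become small when the radius shrinks, so no bound on
  them has to be assumed. The radius \<open>s\<close> is chosen so that
  \<open>s / r * K \<le> \<rho>\<close>.\<close>

lemma seval_fsubst:
  assumes c: "absconv c \<rho>" "\<rho> > 0" and d: "\<And>k. absconv (d k) r" "r > 0" "\<And>k. d k 0 = 0"
  obtains s where "s > 0" "s \<le> r" "absconv (fsubst c d) s" "\<And>k. snorm (d k) s \<le> \<rho>"
    "\<And>z. z \<in> polydisc s \<Longrightarrow> seval (fsubst c d) z = seval c (\<chi> k. seval (d k) z)"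
proof -
  obtain K where K: "\<And>k. snorm (d k) r \<le> K" "K > 0"
    using uniform_snorm_bound[of r d] d(2) by auto
  define s where "s = min r (\<rho> * r / K)"
  have s: "s > 0" "s \<le> r" "s / r * K \<le> \<rho>"
    using K d c by (auto simp: s_def min_def field_simps)
  have "snorm (d k) s \<le> \<rho>" for k
  proof -
    have "snorm (d k) s \<le> (s / r) ^ 1 * snorm (d k) r"
      using d s by (intro snorm_shrink) (auto simp: mdeg_eq_0_iff)
    also have "\<dots> \<le> s / r * K" using mult_left_mono[OF K(1)[of k], of "s / r"] s d by simp
    finally show ?thesis using s by simp
  qed
  moreover have ds: "absconv (d k) s" for k using s d by (intro absconv_mono[OF d(1)]) auto
  ultimately show ?thesis
    using seval_series_comp[OF c(1) ds] s
    by (intro that[of s]) (auto simp: series_comp_eq_fsubst d(3))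
qed

section \<open>Expansions of holomorphic functions\<close>

text \<open>Once the lower coefficients are known to vanish, division by \<open>t ^ n\<close> leaves
  a series that is 0 on a punctured disc; its limit at 0 is \<open>a n\<close>.\<close>

lemma powser_zero_coeffs:
  fixes a :: "nat \<Rightarrow> 'a::{real_normed_field, banach}"
  assumes s: "s > 0" and sums: "\<And>t. norm t < s \<Longrightarrow> (\<lambda>n. a n * t ^ n) sums 0"
  shows "a n = 0"
proof (induction n rule: less_induct)
  case (less n)
  have "(\<lambda>m. a (m + n) * t ^ m) sums 0" if "norm t < s" "t \<noteq> 0" for t
  proof -
    have "(\<lambda>m. a (m + n) * t ^ (m + n)) sums 0"
      using sums[OF that(1)] less by (subst sums_iff_shift) simp
    from sums_mult2[OF this, of "inverse (t ^ n)"] show ?thesis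
      using that(2) by (simp add: power_add mult.assoc)
  qed
  then have "((\<lambda>_. 0) \<longlongrightarrow> a (0 + n)) (at (0 :: 'a))"
    using powser_limit_0_strong[OF s, of "\<lambda>m. a (m + n)" "\<lambda>_. 0"] by auto
  then show "a n = 0"
    using LIM_unique[OF tendsto_const[of "0 :: 'a" "at 0"]] by (metis add_0)
qed

lemma absconv_restrict: "absconv c r \<Longrightarrow> 0 \<le> r \<Longrightarrow> absconv (\<lambda>Q. if P Q then c Q else 0) r"
  by (rule absconv_comparison) auto

text \<open>Multiplying the coordinate \<open>z $ k\<close> by a parameter \<open>t\<close> turns
  the value into a power series in \<open>t\<close>, whose coefficients are the slices with fixed
  exponent in the variable \<open>k\<close>.\<close>

lemma seval_slice:
  fixes z :: "complex ^ 'n::finite"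
  assumes c: "absconv c r" and zero: "\<And>z :: complex ^ 'n. z \<in> polydisc r \<Longrightarrow> seval c z = 0" and z: "z \<in> polydisc r"
  shows "seval (\<lambda>Q. if Q k = m then c Q else 0) z = 0"
proof -
  let ?s = "\<lambda>m Q. if Q k = m then c Q else 0"
  have r: "0 \<le> r" by (rule polydisc_nonneg[OF z])
  have "(\<lambda>m. seval (?s m) z * t ^ m) sums 0" if t: "norm t < 1" for t
  proof -
    define y where "y = (\<chi> l. if l = k then t * z $ l else z $ l)"
    have "norm (t * z $ k) \<le> r"
      using t z mult_mono[of "norm t" 1 "norm (z $ k)" r] by (simp add: norm_mult polydisc_def)
    then have y: "y \<in> polydisc r" using z by (auto simp: y_def polydisc_def)
    have mp: "mpow y Q = t ^ Q k * mpow z Q" for Q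
    proof -
      have "mpow y Q = y $ k ^ Q k * (\<Prod>l\<in>UNIV - {k}. y $ l ^ Q l)"
        unfolding mpow_def by (rule prod.remove) auto
      also have "(\<Prod>l\<in>UNIV - {k}. y $ l ^ Q l) = (\<Prod>l\<in>UNIV - {k}. z $ l ^ Q l)"
        by (rule prod.cong) (auto simp: y_def)
      also have "y $ k ^ Q k * \<dots> = t ^ Q k * (z $ k ^ Q k * (\<Prod>l\<in>UNIV - {k}. z $ l ^ Q l))"
        by (simp add: y_def power_mult_distrib)
      also have "z $ k ^ Q k * (\<Prod>l\<in>UNIV - {k}. z $ l ^ Q l) = mpow z Q"
        unfolding mpow_def by (rule prod.remove[symmetric]) auto
      finally show ?thesis .
    qed
    have "((\<lambda>Q. c Q * (t ^ Q k * mpow z Q)) has_sum 0) UNIV"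
      using seval_has_sum[OF c y] zero[OF y] by (simp add: mp)
    also have "?this \<longleftrightarrow> ((\<lambda>(m, Q). c Q * (t ^ Q k * mpow z Q)) has_sum 0) (Sigma UNIV (\<lambda>m. {Q. Q k = m}))"
      by (rule has_sum_reindex_bij_witness[of _ snd "\<lambda>Q. (Q k, Q)"]) auto
    finally have *: "((\<lambda>(m, Q). c Q * (t ^ Q k * mpow z Q)) has_sum 0) (Sigma UNIV (\<lambda>m. {Q. Q k = m}))" .
    have "((\<lambda>m. seval (?s m) z * t ^ m) has_sum 0) UNIV"
    proof (rule has_sum_SigmaD[OF *])
      fix m
      have "((\<lambda>Q. t ^ m * (?s m Q * mpow z Q)) has_sum t ^ m * seval (?s m) z) UNIV"
        by (intro has_sum_cmult_right seval_has_sum[OF absconv_restrict[OF c r] z])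
      then show "((\<lambda>Q. case (m, Q) of (m, Q) \<Rightarrow> c Q * (t ^ Q k * mpow z Q)) has_sum seval (?s m) z * t ^ m) {Q. Q k = m}"
        by (subst has_sum_cong_neutral[where T = UNIV and g = "\<lambda>Q. t ^ m * (?s m Q * mpow z Q)"])
          (auto simp: mult_ac)
    qed
    then show ?thesis by (rule has_sum_imp_sums)
  qed
  then show ?thesis by (rule powser_zero_coeffs[of 1, rotated]) auto
qed

text \<open>The exponents are fixed one variable at a time by \<open>seval_slice\<close>. At the end
  a single term is left, and it is tested at a point with no zero coordinate.\<close>

lemma seval_eq_0_imp:
  assumes c: "absconv c r" "r > 0" and zero: "\<And>z :: complex ^ 'n::finite. z \<in> polydisc r \<Longrightarrow> seval c z = 0"
  shows "c Q = 0"
proof -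
  have r: "0 \<le> r" using c by simp
  have "seval (\<lambda>P. if \<forall>k\<in>S. P k = Q k then c P else 0) z = 0"
    if "z \<in> polydisc r" and S: "finite S" for S and z :: "complex ^ 'n"
    using S that(1)
  proof (induction S arbitrary: z rule: finite_induct)
    case (insert k S)
    have "(\<lambda>P. if \<forall>k\<in>insert k S. P k = Q k then c P else 0) =
        (\<lambda>P. if P k = Q k then if \<forall>k\<in>S. P k = Q k then c P else 0 else 0)"
      by auto
    then show ?case
      using insert by (simp only:) (intro seval_slice[of _ r] absconv_restrict[OF c(1) r], auto)
  qed (use zero in simp)
  from this[of "\<chi> k. of_real r" UNIV]
  have "seval (\<lambda>P. if P = Q then c P else 0) (\<chi> k. of_real r) = 0"
    using r by (simp add: polydisc_def fun_eq_iff)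
  then have "c Q * mpow (\<chi> k. of_real r) Q = 0"
    by (subst (asm) seval_finite[of "{Q}"]) auto
  then show ?thesis using c by (auto simp: mpow_def)
qed

text \<open>Setting the coordinates outside \<open>K\<close> to 0 removes exactly the monomials that
  involve them, so the remaining series vanishes on a full polydisc. Applied to coordinate subspaces
  inside the zero set of the ideal.\<close>

lemma seval_eq_0_on_subspace_imp:
  fixes c :: "'n::finite fseries"
  assumes c: "absconv c r" "r > 0"
    and zero: "\<And>z :: complex ^ 'n. z \<in> polydisc r \<Longrightarrow> (\<And>k. k \<notin> K \<Longrightarrow> z $ k = 0) \<Longrightarrow> seval c z = 0"
    and Q: "\<And>k. k \<notin> K \<Longrightarrow> Q k = 0"
  shows "c Q = 0"
proof -
  let ?K = "\<lambda>Q. \<forall>k. k \<notin> K \<longrightarrow> Q k = 0"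
  let ?c = "\<lambda>Q. if ?K Q then c Q else 0"
  have r: "0 \<le> r" using c by simp
  have "?c Q = 0"
  proof (rule seval_eq_0_imp)
    fix z :: "complex ^ 'n" assume z: "z \<in> polydisc r"
    define y where "y = (\<chi> k. if k \<in> K then z $ k else 0)"
    have y: "y \<in> polydisc r" using z r by (auto simp: y_def polydisc_def)
    have "c Q * mpow y Q = ?c Q * mpow z Q" for Q
    proof (cases "?K Q")
      case True
      then have "mpow y Q = mpow z Q"
        unfolding mpow_def by (intro prod.cong) (auto simp: y_def)
      then show ?thesis using True by simp
    next
      case False
      then obtain k where "k \<notin> K" "Q k \<noteq> 0" by blast
      then have "mpow y Q = 0" unfolding mpow_def
        by (intro prod_zero) (auto simp: y_def intro!: bexI[of _ k])
      moreover have "?c Q = 0" using False by (rule if_not_P)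
      ultimately show ?thesis by simp
    qed
    then have "seval ?c z = seval c y" by (simp add: seval_def)
    also have "\<dots> = 0" using y by (intro zero) (auto simp: y_def)
    finally show "seval ?c z = 0" .
  qed (use c absconv_restrict[OF c(1) r] in auto)
  then show ?thesis using Q by simp
qed

section \<open>Linear operations on series, and expansions at a point\<close>

lemma absconv_add:
  fixes f g :: "('n::finite, 'a::real_normed_field) series"
  assumes "absconv f r" "absconv g r" "0 \<le> r"
  shows "absconv (\<lambda>Q. f Q + g Q) r"
  unfolding absconv_def
proof (rule summable_on_comparison_test[OF summable_on_add[OF assms(1,2)[unfolded absconv_def]]])
  fix Q
  show "norm (f Q + g Q) * r ^ mdeg Q \<le> norm (f Q) * r ^ mdeg Q + norm (g Q) * r ^ mdeg Q"
    using assms(3) norm_triangle_ineq[of "f Q" "g Q"]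
    by (simp add: mult_right_mono flip: distrib_right)
qed (use assms in auto)

lemma seval_add:
  assumes "absconv f r" "absconv g r" "z \<in> polydisc r"
  shows "seval (\<lambda>Q. f Q + g Q) z = seval f z + seval g z"
  using has_sum_add[OF seval_has_sum seval_has_sum, OF assms(1,3,2,3)]
  by (simp add: seval_def infsumI distrib_right)

lemma absconv_cmult:
  fixes f :: "('n::finite, 'a::real_normed_field) series"
  assumes "absconv f r"
  shows "absconv (\<lambda>Q. a * f Q) r"
  using summable_on_cmult_right[OF assms[unfolded absconv_def], of "norm a"]
  by (simp add: absconv_def norm_mult mult.assoc)

lemma seval_cmult: "seval (\<lambda>Q. a * f Q) z = a * seval f z"
  by (simp add: seval_def infsum_cmult_right' mult.assoc)

lemma absconv_sum:
  fixes f :: "'i \<Rightarrow> ('n::finite, 'a::real_normed_field) series"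
  assumes "\<And>i. i \<in> A \<Longrightarrow> absconv (f i) r" "0 \<le> r"
  shows "absconv (\<lambda>Q. \<Sum>i\<in>A. f i Q) r"
  using assms(1)
proof (induction A rule: infinite_finite_induct)
  case (insert i A)
  then have "absconv (\<lambda>Q. f i Q + (\<Sum>i\<in>A. f i Q)) r" using assms(2) by (intro absconv_add) auto
  then show ?case using insert by simp
qed (auto intro: absconv_finite)

lemma seval_zero: "seval c 0 = c 0"
proof -
  have "seval c 0 = (\<Sum>\<^sub>\<infinity>Q\<in>{0}. c Q * mpow 0 Q)"
    unfolding seval_def by (rule infsum_cong_neutral) (auto simp: mpow_def fun_eq_iff)
  then show ?thesis by simp
qed

text \<open>At the point with all coordinates \<open>r\<close> every monomial has modulus
  \<open>r ^ mdeg Q\<close>, and summability of a complex family is absolute; pointwise summation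
  near 0 thus yields absolute convergence on a polydisc.\<close>

lemma has_expansion_iff:
  fixes c :: "'n::finite fseries"
  shows "has_expansion f p c \<longleftrightarrow> (\<exists>r>0. absconv c r \<and> (\<forall>z\<in>polydisc r. f (p + z) = seval c z))"
proof
  assume "has_expansion f p c"
  then obtain r where r: "r > 0" "\<And>z. z \<in> polydisc r \<Longrightarrow> ((\<lambda>Q. c Q * mpow z Q) has_sum f (p + z)) UNIV"
    unfolding has_expansion_def eventually_polydisc by blast
  define x :: "complex ^ 'n" where "x = (\<chi> k. of_real r)"
  have x: "x \<in> polydisc r" using r by (simp add: x_def polydisc_def)
  have "norm (mpow x Q) = r ^ mdeg Q" for Q
    using r by (simp add: x_def mpow_def mdeg_def norm_power power_sum flip: prod_norm)
  moreover have "(\<lambda>Q. norm (c Q * mpow x Q)) summable_on UNIV"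
    using has_sum_imp_summable[OF r(2)[OF x]] by (simp add: summable_on_iff_abs_summable_on_complex)
  ultimately have "absconv c r" by (simp add: absconv_def norm_mult)
  then show "\<exists>r>0. absconv c r \<and> (\<forall>z\<in>polydisc r. f (p + z) = seval c z)"
    using r by (intro exI[of _ r]) (auto simp: seval_def infsumI[symmetric])
next
  assume "\<exists>r>0. absconv c r \<and> (\<forall>z\<in>polydisc r. f (p + z) = seval c z)"
  then show "has_expansion f p c"
    unfolding has_expansion_def eventually_polydisc using seval_has_sum by metis
qed

lemma has_expansionE:
  assumes "has_expansion f p c"
  obtains r where "r > 0" "absconv c r" "\<And>z. z \<in> polydisc r \<Longrightarrow> f (p + z) = seval c z"
  using assms unfolding has_expansion_iff by blast

lemma has_expansion_value: "has_expansion f p c \<Longrightarrow> c 0 = f p"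
proof -
  assume "has_expansion f p c"
  then obtain r where "r > 0" "\<And>z. z \<in> polydisc r \<Longrightarrow> f (p + z) = seval c z"
    by (metis has_expansionE)
  from this(2)[of 0] this(1) show "c 0 = f p"
    by (simp add: polydisc_def seval_zero)
qed

lemma has_expansion_unique:
  fixes c :: "'n::finite fseries"
  assumes "has_expansion f p c" "has_expansion f p d"
  shows "c = d"
proof
  fix Q
  obtain r s where r: "r > 0" "absconv c r" "\<And>z. z \<in> polydisc r \<Longrightarrow> f (p + z) = seval c z"
    and s: "s > 0" "absconv d s" "\<And>z. z \<in> polydisc s \<Longrightarrow> f (p + z) = seval d z"
    using assms by (metis has_expansionE)
  define t where "t = min r s"
  have t: "t > 0" "absconv c t" "absconv d t" "polydisc t \<subseteq> polydisc r" "polydisc t \<subseteq> polydisc s"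
    using r s by (auto simp: t_def intro: absconv_mono intro!: polydisc_mono)
  have "c Q + (- 1) * d Q = 0"
  proof (rule seval_eq_0_imp)
    show "absconv (\<lambda>Q. c Q + (- 1) * d Q) t" using t by (intro absconv_add absconv_cmult) auto
    fix z :: "complex ^ 'n" assume z: "z \<in> polydisc t"
    have "seval (\<lambda>Q. c Q + (- 1) * d Q) z = seval c z + seval (\<lambda>Q. (- 1) * d Q) z"
      using t z by (intro seval_add[of _ t] absconv_cmult)
    also have "\<dots> = 0"
      using r(3)[of z] s(3)[of z] subsetD[OF t(4) z] subsetD[OF t(5) z] by (subst seval_cmult) simp
    finally show "seval (\<lambda>Q. c Q + (- 1) * d Q) z = 0" .
  qed (rule t)
  then show "c Q = d Q" by simp
qed

lemma taylor_map_eq: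
  assumes "\<And>k. has_expansion (\<lambda>z. F z $ k) 0 (c k)"
  shows "taylor_map F = c"
  unfolding taylor_map_def using assms has_expansion_unique by blast

text \<open>The inner expansions lose their constant terms because \<open>f\<close> is expanded at
  \<open>g p\<close>, in the variable \<open>g (p + z) - g p\<close>.\<close>

lemma has_expansion_compose:
  assumes f: "has_expansion f (g p) c" and g: "\<And>k. has_expansion (\<lambda>z. g z $ k) p (d k)"
  shows "has_expansion (\<lambda>z. f (g z)) p (fsubst c (\<lambda>k Q. if Q = 0 then 0 else d k Q))"
proof -
  let ?d = "\<lambda>k Q. if Q = 0 then 0 else d k Q"
  obtain \<rho> where \<rho>: "\<rho> > 0" "absconv c \<rho>" "\<And>z. z \<in> polydisc \<rho> \<Longrightarrow> f (g p + z) = seval c z"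
    using f by (metis has_expansionE)
  have "\<exists>r. \<forall>k. r k > 0 \<and> absconv (d k) (r k) \<and> (\<forall>z\<in>polydisc (r k). g (p + z) $ k = seval (d k) z)"
    using g by (intro choice) (auto simp: has_expansion_iff)
  then obtain r' where r': "\<And>k. r' k > 0" "\<And>k. absconv (d k) (r' k)"
    "\<And>k z. z \<in> polydisc (r' k) \<Longrightarrow> g (p + z) $ k = seval (d k) z" by blast
  define r where "r = Min (range r')"
  have r: "r > 0" "r \<le> r' k" for k using r' by (auto simp: r_def)
  have conv: "absconv (d k) r" for k using r r' by (auto intro: absconv_mono[of _ "r' k"] less_imp_le)
  have gz: "g (p + z) $ k = seval (d k) z" if "z \<in> polydisc r" for k z
    using that r'(3) polydisc_mono[OF r(2)[of k]] by blast
  have d': "absconv (?d k) r" for k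
    using r by (intro absconv_comparison[OF conv]) (auto simp: less_imp_le)
  have sd: "seval (?d k) z = g (p + z) $ k - g p $ k" if z: "z \<in> polydisc r" for k z
  proof -
    have "d k = (\<lambda>Q. ?d k Q + d k 0 * sone Q)" by (auto simp: sone_def)
    then have "seval (d k) z = seval (\<lambda>Q. ?d k Q + d k 0 * sone Q) z" by simp
    also have "\<dots> = seval (?d k) z + seval (\<lambda>Q. d k 0 * sone Q) z"
      by (rule seval_add[OF d' _ z]) (rule absconv_cmult[OF sone_conv(1)])
    also have "seval (\<lambda>Q. d k 0 * sone Q) z = d k 0" by (simp add: seval_cmult sone_conv)
    finally have "g (p + z) $ k = seval (?d k) z + d k 0" using gz[OF z] by metis
    then show ?thesis unfolding has_expansion_value[OF g[of k]] by (simp only: add_diff_cancel_right')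
  qed
  obtain s where s: "s > 0" "s \<le> r" "absconv (fsubst c ?d) s" "\<And>k. snorm (?d k) s \<le> \<rho>"
    "\<And>z. z \<in> polydisc s \<Longrightarrow> seval (fsubst c ?d) z = seval c (\<chi> k. seval (?d k) z)"
    by (rule seval_fsubst[of c \<rho> ?d r]) (use \<rho> d' r in auto)
  have "f (g (p + z)) = seval (fsubst c ?d) z" if z: "z \<in> polydisc s" for z
  proof -
    have zr: "z \<in> polydisc r" using z polydisc_mono[OF s(2)] by blast
    have w: "(\<chi> k. seval (?d k) z) = g (p + z) - g p"
      by (simp add: vec_eq_iff sd[OF zr])
    have "absconv (?d k) s" for k using s by (intro absconv_mono[OF d']) auto
    then have "(\<chi> k. seval (?d k) z) \<in> polydisc \<rho>"
      using s(4) norm_seval_le[OF _ z] by (fastforce simp: polydisc_def intro: order_trans)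
    from \<rho>(3)[OF this] show ?thesis using s(5)[OF z] by (simp add: w)
  qed
  then show ?thesis unfolding has_expansion_iff using s by blast
qed

text \<open>Composition with the translation by \<open>p\<close>: on the polydisc of radius
  \<open>r - s\<close> its components have norm at most \<open>r\<close>, so
  \<open>seval_series_comp\<close> applies.\<close>

lemma holo_at_seval:
  fixes c :: "'n::finite fseries"
  assumes c: "absconv c r" and p: "p \<in> polydisc s" and s: "s < r"
  shows "holo_at (seval c) p"
proof -
  have s0: "0 \<le> s" by (rule polydisc_nonneg[OF p])
  define d where "d = (\<lambda>k Q. if Q = 0 then p $ k else if Q = unit_index k then 1 else (0 :: complex))"
  have ne: "unit_index k \<noteq> 0" for k :: 'n by (auto simp: unit_index_def fun_eq_iff)
  have supp: "d k Q = 0" if "Q \<notin> {0, unit_index k}" for k Q using that by (auto simp: d_def)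
  have "snorm (d k) (r - s) = norm (p $ k) + (r - s)" for k
    by (subst snorm_finite[of "{0, unit_index k}", OF _ supp]) (use ne ne[symmetric] in \<open>auto simp: d_def\<close>)
  then have 1: "snorm (d k) (r - s) \<le> r" for k using p by (simp add: polydisc_def)
  have 2: "absconv (d k) (r - s)" for k
    by (rule absconv_finite) (rule finite_subset[of _ "{0, unit_index k}"], use supp in auto)
  have "seval (d k) z = p $ k + z $ k" for k z
    by (subst seval_finite[of "{0, unit_index k}", OF _ supp]) (use ne ne[symmetric] in \<open>auto simp: d_def\<close>)
  then have "(\<chi> k. seval (d k) z) = p + z" for z by (simp add: vec_eq_iff)
  then have "has_expansion (seval c) p (series_comp c d)"
    unfolding has_expansion_iff using seval_series_comp[OF c 2 1] s
    by (intro exI[of _ "r - s"]) auto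
  then show ?thesis unfolding holo_at_def by blast
qed

section \<open>Linear maps as series, derivatives and conjugation\<close>

lemma seval_linear_fmap: "seval (linear_fmap A k) z = (A *v z) $ k" "absconv (linear_fmap A k) r"
proof -
  have eq: "linear_fmap A k Q = (\<Sum>j\<in>UNIV. A $ k $ j * mono_series (unit_index j) Q)" for Q
    by (simp add: linear_fmap_def unit_index_def)
  have supp: "linear_fmap A k Q = 0" if "Q \<notin> range unit_index" for Q
    using that by (auto simp: eq mono_series_def intro!: sum.neutral)
  have unit: "linear_fmap A k (unit_index l) = A $ k $ l" for l
    by (simp add: eq mono_series_def if_distrib cong: if_cong)
  show "seval (linear_fmap A k) z = (A *v z) $ k"
    by (subst seval_finite[of "range unit_index", OF _ supp])
      (simp_all add: sum.reindex inj_def unit matrix_vector_mult_def)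
  show "absconv (linear_fmap A k) r"
    by (rule absconv_finite) (rule finite_subset[of _ "range unit_index"], use supp in auto)
qed

lemma linear_fmap_coeff:
  "linear_fmap A k Q = (\<Sum>j\<in>UNIV. if Q = unit_index j then A $ k $ j else 0)"
  "linear_fmap A k (unit_index l) = A $ k $ l"
  "mdeg Q \<noteq> 1 \<Longrightarrow> linear_fmap A k Q = 0"
proof -
  show eq: "linear_fmap A k Q = (\<Sum>j\<in>UNIV. if Q = unit_index j then A $ k $ j else 0)" for Q
    unfolding linear_fmap_def mono_series_def unit_index_def[symmetric] by (rule sum.cong) auto
  show "linear_fmap A k (unit_index l) = A $ k $ l" by (simp add: eq)
  show "mdeg Q \<noteq> 1 \<Longrightarrow> linear_fmap A k Q = 0" by (auto simp: eq intro!: sum.neutral)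
qed

lemma linear_fmap_id:
  "linear_fmap (mat 1 :: complex ^ 'n ^ 'n::finite) k Q = (if Q = unit_index k then 1 else 0)"
proof (cases "Q = unit_index k")
  case False
  then have "linear_fmap (mat 1 :: complex ^ 'n ^ 'n) k Q = 0"
    unfolding linear_fmap_coeff(1) by (intro sum.neutral) (auto simp: mat_def)
  then show ?thesis using False by simp
qed (simp add: linear_fmap_coeff(2) mat_def)

text \<open>After the terms of degree at most 1 are split off, the rest has order 2, and
  \<open>snorm_shrink\<close> bounds it by a multiple of the squared norm.\<close>

lemma has_expansion_has_derivative:
  fixes c :: "'n::finite fseries"
  assumes "has_expansion f p c"
  shows "(f has_derivative (\<lambda>v. \<Sum>k\<in>UNIV. c (unit_index k) * v $ k)) (at p)"
proof -
  obtain r where r: "r > 0" "absconv c r" "\<And>z. z \<in> polydisc r \<Longrightarrow> f (p + z) = seval c z"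
    using assms by (metis has_expansionE)
  define L where "L = (\<lambda>v :: complex ^ 'n. \<Sum>k\<in>UNIV. c (unit_index k) * v $ k)"
  define lo hi where "lo = (\<lambda>Q. if mdeg Q \<le> 1 then c Q else 0)" and "hi = (\<lambda>Q. if mdeg Q \<le> 1 then 0 else c Q)"
  have split: "c = (\<lambda>Q. lo Q + hi Q)" by (auto simp: lo_def hi_def)
  have conv: "absconv lo r" "absconv hi r"
    using r by (auto simp: lo_def hi_def intro!: absconv_comparison[OF r(2)])
  have ne: "unit_index k \<noteq> 0" for k :: 'n by (auto simp: unit_index_def fun_eq_iff)
  have lo: "seval lo z = c 0 + L z" for z
  proof -
    have "lo Q = 0" if "Q \<notin> insert 0 (range unit_index)" for Q
    proof -
      have "\<not> mdeg Q \<le> 1"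
        using that mdeg_eq_0_iff[of Q] mdeg_eq_1E[of Q] by (metis insertCI le_Suc_eq le_zero_eq One_nat_def rangeI)
      then show ?thesis by (simp add: lo_def)
    qed
    then have "seval lo z = (\<Sum>Q\<in>insert 0 (range unit_index). lo Q * mpow z Q)"
      by (intro seval_finite) auto
    also have "\<dots> = lo 0 * mpow z 0 + (\<Sum>Q\<in>range unit_index. lo Q * mpow z Q)"
      using ne by (subst sum.insert) (auto dest: sym)
    finally show ?thesis by (simp add: sum.reindex inj_def lo_def L_def)
  qed
  define K where "K = snorm hi r / r\<^sup>2"
  have bound: "norm (f (p + z) - f p - L z) \<le> K * norm z * norm z" if z: "norm z < r" for z
  proof (cases "z = 0")
    case False
    define s where "s = norm z"
    have s: "0 < s" "s \<le> r" using z False by (auto simp: s_def)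
    have zs: "z \<in> polydisc s" by (simp add: polydisc_def s_def Finite_Cartesian_Product.norm_nth_le)
    then have zr: "z \<in> polydisc r" using polydisc_mono[OF s(2)] by blast
    have "f (p + z) = seval lo z + seval hi z"
      using r(3)[OF zr] seval_add[OF conv zr] split by simp
    moreover have "f p = c 0" using has_expansion_value[OF assms] by simp
    ultimately have "f (p + z) - f p - L z = seval hi z" by (simp add: lo)
    also have "norm \<dots> \<le> snorm hi s"
      using s by (intro norm_seval_le[OF _ zs] absconv_mono[OF conv(2)]) auto
    also have "\<dots> \<le> (s / r) ^ 2 * snorm hi r"
      using s by (intro snorm_shrink[OF conv(2)]) (auto simp: hi_def)
    finally show ?thesis by (simp add: K_def s_def power2_eq_square field_simps)
  qed (simp add: L_def)
  have bl: "bounded_linear L"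
    unfolding L_def by (intro bounded_linear_sum bounded_linear_compose[OF bounded_linear_mult_right]) (rule bounded_linear_vec_nth)
  have "((\<lambda>h. norm (f (p + h) - f p - L h) / norm h) \<longlongrightarrow> 0) (at 0)"
  proof (rule Lim_null_comparison)
    show "\<forall>\<^sub>F h in at 0. norm (norm (f (p + h) - f p - L h) / norm h) \<le> K * norm h"
      unfolding eventually_at using r(1)
      by (intro exI[of _ r]) (auto simp: divide_le_eq intro: bound)
    show "((\<lambda>h :: complex ^ 'n. K * norm h) \<longlongrightarrow> 0) (at 0)"
      by (intro tendsto_eq_intros) auto
  qed
  then show ?thesis
    unfolding has_derivative_at using bl by (simp add: L_def)
qed

lemma has_expansion_linear_part:
  assumes "\<And>k. has_expansion (\<lambda>z. F z $ k) 0 (c k)" "(F has_derivative (\<lambda>v. A *v v)) (at 0)"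
  shows "c k (unit_index l) = A $ k $ l"
proof -
  have 1: "((\<lambda>z. F z $ k) has_derivative (\<lambda>v. (A *v v) $ k)) (at 0)"
    by (rule bounded_linear.has_derivative[OF bounded_linear_vec_nth assms(2)])
  have "(\<lambda>v. (A *v v) $ k) = (\<lambda>v. \<Sum>l\<in>UNIV. c k (unit_index l) * v $ l)"
    by (rule has_derivative_unique[OF 1 has_expansion_has_derivative[OF assms(1)]])
  from fun_cong[OF this, of "axis l 1"] show ?thesis
    by (simp add: matrix_vector_mult_def axis_def if_distrib cong: if_cong)
qed

text \<open>Conjugation before and after keeps a map holomorphic. In this way a composition of two
  anti-holomorphic maps is reduced to a composition of holomorphic ones.\<close>

lemma has_expansion_cnj:
  fixes c :: "'n::finite fseries"
  assumes "has_expansion f 0 c"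
  shows "has_expansion (\<lambda>z. cnj (f (cnj_vec z))) 0 (\<lambda>Q. cnj (c Q))"
proof -
  obtain r where r: "r > 0" "absconv c r" "\<And>z. z \<in> polydisc r \<Longrightarrow> f (0 + z) = seval c z"
    using assms by (metis has_expansionE)
  have mp: "cnj (mpow (cnj_vec z) Q) = mpow z Q" for z :: "complex ^ 'n" and Q
    by (simp add: mpow_def cnj_vec_def)
  have "cnj (seval c (cnj_vec z)) = seval (\<lambda>Q. cnj (c Q)) z" for z
    unfolding seval_def infsum_cnj[symmetric] by (simp add: mp)
  moreover have "cnj_vec z \<in> polydisc r" if "z \<in> polydisc r" for z :: "complex ^ 'n"
    using that by (simp add: polydisc_def cnj_vec_def)
  ultimately show ?thesis
    unfolding has_expansion_iff using r by (intro exI[of _ r]) (auto simp: absconv_def)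
qed

lemma has_expansion_add:
  assumes "has_expansion f p c" "has_expansion g p d"
  shows "has_expansion (\<lambda>z. f z + g z) p (\<lambda>Q. c Q + d Q)"
  using assms unfolding has_expansion_def
  by eventually_elim (auto simp: distrib_right intro: has_sum_add)

lemma holo_at_mult:
  assumes "holo_at f p" "holo_at g p"
  shows "holo_at (\<lambda>z. f z * g z) p"
proof -
  obtain c d where "has_expansion f p c" "has_expansion g p d" using assms by (auto simp: holo_at_def)
  then obtain r s where r: "r > 0" "absconv c r" "\<And>z. z \<in> polydisc r \<Longrightarrow> f (p + z) = seval c z"
    and s: "s > 0" "absconv d s" "\<And>z. z \<in> polydisc s \<Longrightarrow> g (p + z) = seval d z"
    by (metis has_expansionE)
  define t where "t = min r s"
  have t: "t > 0" "absconv c t" "absconv d t" "polydisc t \<subseteq> polydisc r" "polydisc t \<subseteq> polydisc s"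
    using r s by (auto simp: t_def intro: absconv_mono intro!: polydisc_mono)
  have "has_expansion (\<lambda>z. f z * g z) p (smul c d)"
    unfolding has_expansion_iff using t r(3) s(3) absconv_smul[of c t d] seval_smul[of c t d]
    by (intro exI[of _ t]) (auto simp: subset_iff)
  then show ?thesis unfolding holo_at_def by blast
qed

lemma holo_at_const: "holo_at (\<lambda>_. a) p"
proof -
  have "((\<lambda>Q. (a * sone Q) * mpow z Q) has_sum a) UNIV" for z
  proof -
    have "z \<in> polydisc (norm z)" by (simp add: polydisc_def Finite_Cartesian_Product.norm_nth_le)
    from seval_has_sum[OF absconv_cmult[OF sone_conv(1)] this, of a]
    show ?thesis by (simp add: seval_cmult sone_conv)
  qed
  then show ?thesis unfolding holo_at_def has_expansion_def
    by (intro exI[of _ "\<lambda>Q. a * sone Q"] always_eventually allI)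
qed

lemma holo_at_prod:
  assumes "\<And>i. i \<in> A \<Longrightarrow> holo_at (f i) p"
  shows "holo_at (\<lambda>z. \<Prod>i\<in>A. f i z) p"
  using assms by (induction A rule: infinite_finite_induct) (auto intro: holo_at_mult holo_at_const)

lemma holo_at_continuous: "holo_at f p \<Longrightarrow> isCont f p"
  unfolding holo_at_def using has_expansion_has_derivative has_derivative_continuous by blast

lemma holo_map_at_continuous: "holo_map_at f p \<Longrightarrow> isCont f p"
  unfolding holo_map_at_def using holo_at_continuous
  by (fastforce simp: isCont_def intro: vec_tendstoI)

section \<open>Formal composition\<close>

text \<open>A coefficient of a product involves only coefficients at smaller exponents. This is what
  makes truncation to a down-closed set of exponents compatible with composition.\<close>

lemma sprod_cong_le:
  assumes "\<And>k P. P \<le> Q \<Longrightarrow> d k P = d' k P"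
  shows "sprod d ks Q = sprod d' ks (Q :: 'n::finite \<Rightarrow> nat)"
  using assms
proof (induction ks arbitrary: Q)
  case (Cons k ks)
  have "d k P * sprod d ks (Q - P) = d' k P * sprod d' ks (Q - P)" if "P \<le> Q" for P
  proof -
    have "sprod d ks (Q - P) = sprod d' ks (Q - P)"
      by (rule Cons.IH, rule Cons.prems) (auto simp: le_fun_def intro: order_trans[OF _ diff_le_self])
    then show ?thesis using Cons.prems that by simp
  qed
  then show ?case by (simp add: smul_def)
qed simp

text \<open>With two or more factors without constant term, each contributing part of
  \<open>Q\<close> is proper, so the factors are never evaluated at \<open>Q\<close> itself. This
  makes the recursions triangular.\<close>

lemma sprod_cong_less:
  assumes eq: "\<And>k P. P \<le> Q \<Longrightarrow> P \<noteq> Q \<Longrightarrow> d k P = d' k P"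
    and zero: "\<And>k. d k 0 = 0" "\<And>k. d' k 0 = 0" and ks: "2 \<le> length ks"
  shows "sprod d ks Q = sprod d' ks (Q :: 'n::finite \<Rightarrow> nat)"
proof -
  obtain k ls where ks': "ks = k # ls" "ls \<noteq> []" using ks by (cases ks; cases "tl ks") auto
  have "d k P * sprod d ls (Q - P) = d' k P * sprod d' ls (Q - P)" if P: "P \<le> Q" for P
  proof -
    consider "P = 0" | "P = Q" | "P \<noteq> 0" "P \<noteq> Q" by blast
    then show ?thesis
    proof cases
      case 2
      then have "sprod d ls (Q - P) = 0" "sprod d' ls (Q - P) = 0"
        using ks' zero by (auto intro!: sprod_eq_0 simp: fun_diff_def simp flip: zero_fun_def)
      then show ?thesis by simp
    next
      case 3
      have "mdeg (Q - P) < mdeg Q"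
        using 3 P mdeg_mono[OF P] mdeg_eq_0_iff[of P] by (simp add: mdeg_diff)
      then have "R \<le> Q \<and> R \<noteq> Q" if "R \<le> Q - P" for R
        using mdeg_mono[OF that] that by (auto simp: le_fun_def intro: order_trans[OF _ diff_le_self])
      then have "sprod d ls (Q - P) = sprod d' ls (Q - P)"
        by (intro sprod_cong_le eq) auto
      then show ?thesis using eq 3 P by simp
    qed (use zero in simp)
  qed
  then show ?thesis by (simp add: ks' smul_def)
qed

text \<open>The contribution to \<open>fsubst f \<Phi>\<close> of the terms of \<open>f\<close> of
  degree at least 2. For \<open>\<Phi>\<close> without constant term it depends only on coefficients
  strictly below \<open>Q\<close>, so it is the known side of each recursion.\<close>

definition nonlin :: "'n::finite fseries \<Rightarrow> 'n fmap \<Rightarrow> 'n fseries" where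
  "nonlin f \<Phi> Q = (\<Sum>P | 2 \<le> mdeg P \<and> mdeg P \<le> mdeg Q. f P * sprod \<Phi> (index_list P) Q)"

lemma nonlin_cong:
  assumes "\<And>k P. P \<le> Q \<Longrightarrow> P \<noteq> Q \<Longrightarrow> \<Phi> k P = \<Phi>' k P" "\<And>k. \<Phi> k 0 = 0" "\<And>k. \<Phi>' k 0 = 0"
  shows "nonlin f \<Phi> Q = nonlin f \<Phi>' Q"
proof -
  have "sprod \<Phi> (index_list P) Q = sprod \<Phi>' (index_list P) Q" if "2 \<le> mdeg P" for P
    by (rule sprod_cong_less) (use assms that in auto)
  then show ?thesis by (simp add: nonlin_def)
qed

lemma unit_index_neq_0 [simp]: "unit_index k \<noteq> 0"
  by (auto simp: unit_index_def fun_eq_iff)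

lemma fsubst_split:
  assumes "Q \<noteq> 0"
  shows "fsubst f \<Phi> Q = (\<Sum>k\<in>UNIV. f (unit_index k) * \<Phi> k Q) + nonlin f \<Phi> Q"
proof -
  have Q: "mdeg Q \<ge> 1" using assms mdeg_eq_0_iff[of Q] by simp
  let ?g = "\<lambda>P. f P * sprod \<Phi> (index_list P) Q"
  have un: "{P :: 'a \<Rightarrow> nat. mdeg P \<le> mdeg Q} =
      insert 0 (range unit_index \<union> {P. 2 \<le> mdeg P \<and> mdeg P \<le> mdeg Q})"
  proof (intro equalityI subsetI)
    fix P :: "'a \<Rightarrow> nat" assume "P \<in> {P. mdeg P \<le> mdeg Q}"
    moreover consider "mdeg P = 0" | "mdeg P = 1" | "2 \<le> mdeg P" by linarith
    ultimately show "P \<in> insert 0 (range unit_index \<union> {P. 2 \<le> mdeg P \<and> mdeg P \<le> mdeg Q})"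
      by cases (auto simp: mdeg_eq_0_iff, metis mdeg_eq_1E One_nat_def rangeI)
  qed (use Q in auto)
  have fin: "finite {P :: 'a \<Rightarrow> nat. 2 \<le> mdeg P \<and> mdeg P \<le> mdeg Q}"
    by (rule finite_subset[OF _ finite_mdeg_le[of "mdeg Q"]]) auto
  have "fsubst f \<Phi> Q = ?g 0 + (sum ?g (range unit_index) + nonlin f \<Phi> Q)"
    unfolding fsubst_eq un nonlin_def using fin
    by (subst sum.insert, simp, force simp: image_iff dest: sym, subst sum.union_disjoint) auto
  moreover have "?g 0 = 0" using assms by (simp add: sone_def)
  moreover have "sum ?g (range unit_index) = (\<Sum>k\<in>UNIV. f (unit_index k) * \<Phi> k Q)"
    by (simp add: sum.reindex inj_def)
  ultimately show ?thesis by simp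
qed

lemma fsubst_0: "fsubst f \<Phi> 0 = f 0"
proof -
  have "{P :: 'a \<Rightarrow> nat. mdeg P \<le> mdeg (0 :: 'a \<Rightarrow> nat)} = {0}" by (auto simp: mdeg_eq_0_iff)
  then show ?thesis by (simp add: fsubst_eq sone_def)
qed

lemma nonlin_deg_less_2: "mdeg Q < 2 \<Longrightarrow> nonlin f \<Phi> Q = 0"
  unfolding nonlin_def by (rule sum.neutral) auto

text \<open>Composition on the right with a diagonal map multiplies the coefficient at
  \<open>Q\<close> by \<open>mpow \<mu> Q\<close>. In this form the only associativity law required
  becomes a termwise identity.\<close>

lemma sprod_diag:
  "sprod (\<lambda>k Q. d k Q * mpow \<mu> Q) ks Q = sprod d ks Q * mpow \<mu> (Q :: 'n::finite \<Rightarrow> nat)"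
proof (induction ks arbitrary: Q)
  case Nil
  then show ?case by (simp add: sone_def)
next
  case (Cons k ks)
  then have "sprod (\<lambda>k Q. d k Q * mpow \<mu> Q) ks = (\<lambda>Q. sprod d ks Q * mpow \<mu> Q)" by blast
  then show ?case by (simp add: smul_mpow)
qed

lemma fsubst_diag: "fsubst f (\<lambda>k Q. \<Phi> k Q * mpow \<mu> Q) Q = fsubst f \<Phi> Q * mpow \<mu> Q"
  by (simp add: fsubst_eq sprod_diag sum_distrib_right mult.assoc)

lemma tangent_to_id_coeff:
  assumes "tangent_to_id \<Phi>"
  shows "\<Phi> k 0 = 0" "\<Phi> k (unit_index l) = (if k = l then 1 else 0)"
  using assms by (auto simp: tangent_to_id_def linear_fmap_id dest: sym)

lemma tangent_to_idI:
  assumes "\<And>k. \<Phi> k 0 = 0" "\<And>k l. \<Phi> k (unit_index l) = (if k = l then 1 else 0)"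
  shows "tangent_to_id \<Phi>"
  unfolding tangent_to_id_def
proof (intro allI impI)
  fix k Q assume "mdeg (Q :: 'a \<Rightarrow> nat) \<le> 1"
  then consider "Q = 0" | l where "Q = unit_index l"
    using mdeg_eq_0_iff[of Q] mdeg_eq_1E[of Q] by (metis One_nat_def le_Suc_eq le_zero_eq)
  then show "\<Phi> k Q = linear_fmap (mat 1) k Q"
    by cases (auto simp: assms linear_fmap_id dest: sym)
qed

definition down_closed :: "('n \<Rightarrow> nat) set \<Rightarrow> bool" where
  "down_closed E \<longleftrightarrow> (\<forall>Q\<in>E. \<forall>P\<le>Q. P \<in> E)"

text \<open>Composing with \<open>\<Psi>\<close>, which is tangent to the identity, is injective modulo the
  monomials outside \<open>E\<close>; hence only \<open>\<Psi> \<circ> \<Phi> = id\<close> is needed, and no associativity of composition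
  beyond the diagonal case.\<close>

lemma semiconjugacy_of_formal_linearization:
  assumes E: "down_closed E" and \<Phi>: "tangent_to_id \<Phi>" and inv: "fcomp_map \<Psi> \<Phi> = linear_fmap (mat 1)"
    and \<Psi>: "\<And>k. \<Psi> k 0 = 0" and f: "\<And>k. f k 0 = 0"
    and lin: "\<And>k Q. Q \<in> E \<Longrightarrow> fcomp_map \<Psi> (fcomp_map f \<Phi>) k Q = linear_fmap (diag_mat \<mu>) k Q"
    and Q: "Q \<in> E"
  shows "fsubst (f k) \<Phi> Q = \<Phi> k Q * mpow \<mu> Q"
proof -
  have \<Psi>u: "\<Psi> k (unit_index l) = (if k = l then 1 else 0)" for k l
  proof -
    have "fsubst (\<Psi> k) \<Phi> (unit_index l) = (\<Sum>j\<in>UNIV. \<Psi> k (unit_index j) * \<Phi> j (unit_index l))"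
      by (simp add: fsubst_split nonlin_deg_less_2)
    also have "\<dots> = \<Psi> k (unit_index l)"
      by (simp add: tangent_to_id_coeff[OF \<Phi>] if_distrib cong: if_cong)
    finally have "\<Psi> k (unit_index l) = fcomp_map \<Psi> \<Phi> k (unit_index l)"
      by (simp add: fcomp_map_def)
    then show ?thesis by (auto simp: inv linear_fmap_id)
  qed
  have split: "fsubst (\<Psi> k) G Q = G k Q + nonlin (\<Psi> k) G Q" if "Q \<noteq> 0" for G k Q
    using that by (simp add: fsubst_split \<Psi>u if_distrib[where f = "\<lambda>x. x * _"] cong: if_cong)
  \<comment> \<open>The two sides of the semiconjugacy, as maps. Composition with
    \<open>\<Psi>\<close> sends both to the diagonal map on \<open>E\<close>, and its triangular
    form allows them to be compared degree by degree.\<close>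
  define G where "G = fcomp_map f \<Phi>"
  define G' where "G' = (\<lambda>k Q. \<Phi> k Q * mpow \<mu> Q)"
  have G0: "G k 0 = 0" "G' k 0 = 0" for k
    by (simp_all add: G_def G'_def fcomp_map_def fsubst_0 f tangent_to_id_coeff[OF \<Phi>])
  have eq: "fsubst (\<Psi> k) G Q = fsubst (\<Psi> k) G' Q" if "Q \<in> E" for k Q
  proof -
    have "fsubst (\<Psi> k) G' Q = linear_fmap (mat 1) k Q * mpow \<mu> Q"
      unfolding G'_def fsubst_diag using inv by (auto simp: fcomp_map_def fun_eq_iff)
    also have "\<dots> = linear_fmap (diag_mat \<mu>) k Q"
    proof (cases "Q = unit_index k")
      case True
      then show ?thesis by (simp add: linear_fmap_coeff(2) mat_def diag_mat_def)
    next
      case False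
      have "linear_fmap (diag_mat \<mu>) k Q = 0"
        unfolding linear_fmap_coeff(1) using False by (intro sum.neutral) (auto simp: diag_mat_def)
      then show ?thesis using False by (simp add: linear_fmap_id)
    qed
    finally show ?thesis using lin[OF that, of k] by (simp add: G_def fcomp_map_def)
  qed
  have "\<forall>k. G k Q = G' k Q" using Q
  proof (induction "mdeg Q" arbitrary: Q rule: less_induct)
    case less
    show ?case
    proof (cases "Q = 0")
      case False
      have "nonlin (\<Psi> k) G Q = nonlin (\<Psi> k) G' Q" for k
        using less E by (intro nonlin_cong G0) (auto simp: down_closed_def mdeg_strict_mono)
      then show ?thesis using eq[OF less.prems] split[OF False] by simp
    qed (simp add: G0)
  qed
  then show ?thesis by (simp add: G_def G'_def fcomp_map_def)
qed

text \<open>The homological equation: the linear part of \<open>f\<close> contributes the eigenvalue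
  times the coefficient, and the rest is \<open>nonlin\<close>.\<close>

lemma fsubst_eq_diag_iff:
  assumes f: "\<And>l. f (unit_index l) = (if l = k then \<mu> $ k else 0)" and Q: "2 \<le> mdeg Q"
  shows "fsubst f \<Phi> Q = \<Phi> k Q * mpow \<mu> Q \<longleftrightarrow> (mpow \<mu> Q - \<mu> $ k) * \<Phi> k Q = nonlin f \<Phi> Q"
proof -
  have "Q \<noteq> 0" using Q by auto
  then have "fsubst f \<Phi> Q = \<mu> $ k * \<Phi> k Q + nonlin f \<Phi> Q"
    by (simp add: fsubst_split f if_distrib[where f = "\<lambda>x. x * _"] cong: if_cong)
  then show ?thesis by (simp add: algebra_simps) (metis add.commute)
qed

section \<open>Monomial ideals\<close>

lemma convergent_series_iff: "convergent_series c \<longleftrightarrow> (\<exists>r>0. absconv c r)"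
proof
  assume "convergent_series c"
  then have "has_expansion (seval c) 0 c"
    unfolding convergent_series_def has_expansion_def seval_def
    by eventually_elim (auto intro: has_sum_infsum)
  then show "\<exists>r>0. absconv c r" by (metis has_expansionE)
next
  assume "\<exists>r>0. absconv c r"
  then obtain r where r: "r > 0" "absconv c r" by blast
  then show "convergent_series c"
    unfolding convergent_series_def eventually_polydisc
    using seval_has_sum[OF r(2)] by (auto intro!: exI[of _ r] has_sum_imp_summable)
qed

lemma has_expansion_convergent: "has_expansion f p c \<Longrightarrow> convergent_series c"
  unfolding convergent_series_iff has_expansion_iff by blast

lemma convergent_series_closed:
  assumes "convergent_series f" "convergent_series g"
  shows "convergent_series (\<lambda>Q. f Q + g Q)" "convergent_series (smul f g)"
proof -
  obtain r s where "r > 0" "absconv f r" "s > 0" "absconv g s"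
    using assms by (auto simp: convergent_series_iff)
  then have "min r s > 0" "absconv f (min r s)" "absconv g (min r s)" by (auto intro: absconv_mono)
  then show "convergent_series (\<lambda>Q. f Q + g Q)" "convergent_series (smul f g)"
    by (auto simp: convergent_series_iff intro!: exI[of _ "min r s"] absconv_add absconv_smul(1))
qed

lemma convergent_series_finite: "finite {Q. c Q \<noteq> 0} \<Longrightarrow> convergent_series c"
  using absconv_finite[of c 1] by (auto simp: convergent_series_iff intro: exI[of _ 1])

lemma convergent_mono_series: "convergent_series (mono_series Q)"
  by (rule convergent_series_finite) (auto simp: mono_series_def)

lemma convergent_series_uminus: "convergent_series c \<Longrightarrow> convergent_series (\<lambda>Q. - c Q)"
  by (auto simp: convergent_series_iff absconv_def)

lemma germ_ring_simps [simp]: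
  "carrier germ_ring = {c. convergent_series c}" "f \<otimes>\<^bsub>germ_ring\<^esub> g = smul f g" "\<one>\<^bsub>germ_ring\<^esub> = sone"
  "\<zero>\<^bsub>germ_ring\<^esub> = (\<lambda>_. 0)" "f \<oplus>\<^bsub>germ_ring\<^esub> g = (\<lambda>Q. f Q + g Q)"
proof -
  show "f \<otimes>\<^bsub>germ_ring\<^esub> g = smul f g" "f \<oplus>\<^bsub>germ_ring\<^esub> g = (\<lambda>Q. f Q + g Q)"
    "\<one>\<^bsub>germ_ring\<^esub> = sone" "\<zero>\<^bsub>germ_ring\<^esub> = (\<lambda>_. 0)"
    by (simp_all add: germ_ring_def)
qed (simp add: germ_ring_def)

lemma convergent_series_0: "convergent_series (\<lambda>_. 0)" and convergent_series_1: "convergent_series sone"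
  by (auto intro!: convergent_series_finite simp: sone_def)

lemma cring_germ_ring: "cring (germ_ring :: ('n::finite) fseries ring)"
proof (rule cringI)
  show "abelian_group (germ_ring :: 'n fseries ring)"
  proof (rule abelian_groupI)
    fix x :: "'n fseries" assume "x \<in> carrier germ_ring"
    then show "\<exists>y\<in>carrier germ_ring. y \<oplus>\<^bsub>germ_ring\<^esub> x = \<zero>\<^bsub>germ_ring\<^esub>"
      by (intro bexI[of _ "\<lambda>Q. - x Q"]) (auto intro: convergent_series_uminus)
  qed (auto simp: algebra_simps convergent_series_closed convergent_series_0)
  show "comm_monoid (germ_ring :: 'n fseries ring)"
    by (rule comm_monoidI)
      (auto simp: smul_assoc convergent_series_closed convergent_series_1, subst smul_commute, simp)
qed (auto simp: smul_add_left)

text \<open>A product coefficient at an exponent of \<open>E\<close> only uses factors at exponents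
  below it, which lie in \<open>E\<close> again. Both rings are treated together, to serve the ideal
  and its formal extension.\<close>

lemma vanishing_ideal:
  assumes R: "R = formal_ring \<or> R = (germ_ring :: ('n::finite) fseries ring)" and E: "down_closed E"
  shows "ideal {c \<in> carrier R. \<forall>Q\<in>E. c Q = 0} R" (is "ideal ?K R")
proof (rule idealI)
  interpret cring R using R cring_formal_ring cring_germ_ring by blast
  have add: "f \<oplus>\<^bsub>R\<^esub> g = (\<lambda>Q. f Q + g Q)" "\<zero>\<^bsub>R\<^esub> = (\<lambda>_. 0)" "f \<otimes>\<^bsub>R\<^esub> g = smul f g" for f g
    using R by auto
  have uminus: "(\<lambda>Q. - c Q) \<in> carrier R" if "c \<in> carrier R" for c
    using R that convergent_series_uminus by auto
  have inv: "\<ominus>\<^bsub>R\<^esub> c = (\<lambda>Q. - c Q)" if "c \<in> carrier R" for c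
    using minus_equality[of "\<lambda>Q. - c Q" c] that uminus[OF that] by (simp add: add)
  show "ring R" by (rule ring_axioms)
  show "subgroup ?K (add_monoid R)"
  proof
    fix c assume "c \<in> ?K"
    then show "inv\<^bsub>add_monoid R\<^esub> c \<in> ?K"
      using inv[of c] uminus[of c] by (auto simp: a_inv_def)
  next
    fix c d assume "c \<in> ?K" "d \<in> ?K"
    then show "c \<otimes>\<^bsub>add_monoid R\<^esub> d \<in> ?K"
      using add.m_closed[of c d] by (auto simp: add)
  next
    show "\<one>\<^bsub>add_monoid R\<^esub> \<in> ?K" using zero_closed by (simp add: add)
  qed auto
  have smul: "smul x a Q = 0" if "a \<in> ?K" "Q \<in> E" for a x Q
    unfolding smul_def
  proof (rule sum.neutral, rule ballI)
    fix P assume "P \<in> {..Q}"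
    then have "Q - P \<in> E" using that(2) E by (auto simp: down_closed_def le_fun_def)
    then show "x P * a (Q - P) = 0" using that(1) by simp
  qed
  fix a x assume a: "a \<in> ?K" and x: "x \<in> carrier R"
  then show "x \<otimes>\<^bsub>R\<^esub> a \<in> ?K" using smul[OF a] m_closed[of x a] by (simp add: add)
  then show "a \<otimes>\<^bsub>R\<^esub> x \<in> ?K" using m_comm[of a x] a x by simp
qed

lemma genideal_vanishing:
  assumes "R = formal_ring \<or> R = germ_ring" "down_closed E"
    and "S \<subseteq> carrier R" "\<And>c Q. c \<in> S \<Longrightarrow> Q \<in> E \<Longrightarrow> c Q = 0" "c \<in> genideal R S" "Q \<in> E"
  shows "c Q = 0"
proof -
  interpret cring R using assms(1) cring_formal_ring cring_germ_ring by blast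
  have "genideal R S \<subseteq> {c \<in> carrier R. \<forall>Q\<in>E. c Q = 0}"
    using assms by (intro genideal_minimal vanishing_ideal) auto
  then show ?thesis using assms by blast
qed

text \<open>For the zero set of a monomial ideal these are the exponents of the monomials outside
  the radical, in general fewer than those outside the ideal.\<close>

definition support_set :: "(complex ^ 'n::finite) set \<Rightarrow> ('n \<Rightarrow> nat) set" where
  "support_set Z = {Q. \<exists>z\<in>Z. mpow z Q \<noteq> 0}"

lemma mpow_eq_0_iff: "mpow z Q = 0 \<longleftrightarrow> (\<exists>k. Q k \<noteq> 0 \<and> z $ k = 0)"
  for z :: "'a::idom ^ 'n::finite"
  by (auto simp: mpow_def)

lemma mpow_0_iff_zero: "Q \<noteq> 0 \<Longrightarrow> mpow (0 :: complex ^ 'n::finite) Q = 0"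
  by (auto simp: mpow_eq_0_iff fun_eq_iff)

lemma down_closed_support_set: "down_closed (support_set Z)"
  unfolding down_closed_def support_set_def
  by (auto simp: mpow_eq_0_iff le_fun_def) (metis le_zero_eq)

lemma support_set_unit:
  assumes "Q \<in> support_set Z" "Q l \<noteq> 0"
  shows "Q + unit_index l \<in> support_set Z"
  using assms unfolding support_set_def by (force simp: mpow_eq_0_iff unit_index_def)

lemma mono_in_ideal_not_support: "mono_series Q \<in> I \<Longrightarrow> Q \<notin> support_set (zero_locus I)"
  by (auto simp: support_set_def zero_locus_def)

text \<open>Membership in the zero set depends only on which coordinates vanish, and making more of
  them vanish preserves it. Hence the zero set contains the coordinate subspace of the support of
  each exponent in \<open>support_set\<close>.\<close>

lemma zero_locus_subspace:
  assumes "Q \<in> support_set (zero_locus I)" "\<And>k. Q k = 0 \<Longrightarrow> z $ k = 0"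
  shows "z \<in> zero_locus I"
  using assms unfolding support_set_def zero_locus_def by (auto simp: mpow_eq_0_iff) metis

lemma seval_vanishing_on_zero_locus:
  assumes "\<And>Q. Q \<in> support_set Z \<Longrightarrow> c Q = 0" "z \<in> Z"
  shows "seval c z = 0"
proof -
  have "c Q * mpow z Q = 0" for Q using assms by (cases "mpow z Q = 0") (auto simp: support_set_def)
  then show ?thesis unfolding seval_def by (intro infsum_0) simp
qed

lemma ideal_vanishing:
  assumes "monomial_ideal I" "c \<in> I" "Q \<in> support_set (zero_locus I)"
  shows "c Q = 0"
proof -
  obtain A where A: "I = genideal germ_ring (mono_series ` A)"
    using assms(1) by (auto simp: monomial_ideal_def)
  interpret cring germ_ring by (rule cring_germ_ring)
  have car: "mono_series ` A \<subseteq> carrier germ_ring" using convergent_mono_series by auto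
  then have "mono_series ` A \<subseteq> I" unfolding A by (rule genideal_self)
  then have *: "mono_series P Q = 0" if "P \<in> A" "Q \<in> support_set (zero_locus I)" for P Q
    using mono_in_ideal_not_support[of P I] that by (auto simp: mono_series_def)
  have "c \<in> genideal germ_ring (mono_series ` A)" using assms(2) A by simp
  from genideal_vanishing[OF disjI2[OF refl] down_closed_support_set car _ this assms(3)] *
  show ?thesis by blast
qed

lemma zero_in_zero_locus:
  assumes "monomial_ideal I" "I \<noteq> carrier germ_ring"
  shows "0 \<in> zero_locus I"
proof -
  interpret cring germ_ring by (rule cring_germ_ring)
  obtain A where A: "I = genideal germ_ring (mono_series ` A)"
    using assms(1) by (auto simp: monomial_ideal_def)
  have "ideal I germ_ring" unfolding A using convergent_mono_series by (intro genideal_ideal) auto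
  then have "mono_series 0 \<notin> I"
    using assms(2) ideal.one_imp_carrier[of I germ_ring] by (auto simp: mono_series_zero)
  then have "Q \<noteq> 0" if "mono_series Q \<in> I" for Q using that by metis
  then show ?thesis unfolding zero_locus_def by (auto intro: mpow_0_iff_zero)
qed

text \<open>The monomial composed with \<open>B\<close> lies in the ideal again, so it vanishes at
  \<open>z\<close>.\<close>

lemma zero_locus_invariant:
  assumes I: "monomial_ideal I" and B: "left_invariant I B" and z: "z \<in> zero_locus I"
  shows "B *v z \<in> zero_locus I"
  unfolding zero_locus_def
proof (intro CollectI allI impI)
  fix Q assume Q: "mono_series Q \<in> I"
  \<comment> \<open>The point need not be small: monomials and linear maps converge on every
    polydisc.\<close>
  define r where "r = norm z"
  have zr: "z \<in> polydisc r" by (simp add: r_def polydisc_def Finite_Cartesian_Product.norm_nth_le)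
  define \<rho> where "\<rho> = (\<Sum>k\<in>UNIV. snorm (linear_fmap B k) r)"
  have \<rho>: "snorm (linear_fmap B k) r \<le> \<rho>" for k
    unfolding \<rho>_def by (intro member_le_sum snorm_nonneg) (auto simp: r_def)
  have "series_comp (mono_series Q) (linear_fmap B) = fsubst (mono_series Q) (linear_fmap B)"
    by (rule series_comp_eq_fsubst) (simp add: linear_fmap_coeff)
  then have "seval (fsubst (mono_series Q) (linear_fmap B)) z = seval (mono_series Q) (\<chi> k. (B *v z) $ k)"
    using seval_series_comp(2)[of "mono_series Q" \<rho> "linear_fmap B" r z] \<rho> zr
    by (simp add: seval_linear_fmap absconv_finite mono_series_def r_def)
  also have "\<dots> = mpow (B *v z) Q"
    by (subst seval_finite[of "{Q}"]) (auto simp: mono_series_def)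
  finally have "mpow (B *v z) Q = seval (fsubst (mono_series Q) (linear_fmap B)) z" ..
  also have "\<dots> = 0"
    using B Q by (intro seval_vanishing_on_zero_locus[OF ideal_vanishing[OF I] z]) (auto simp: left_invariant_def)
  finally show "mpow (B *v z) Q = 0" .
qed

lemma zero_locus_cnj: "z \<in> zero_locus I \<Longrightarrow> cnj_vec z \<in> zero_locus I"
  by (auto simp: zero_locus_def mpow_eq_0_iff cnj_vec_def)

lemma zero_locus_eq_coordinate_hyperplanes:
  "zero_locus I = (\<Inter>J\<in>{{k. Q k \<noteq> 0} | Q. mono_series Q \<in> I}. \<Union>j\<in>J. {z. z $ j = 0})"
  by (auto simp: zero_locus_def mpow_eq_0_iff)

section \<open>The majorant method\<close>

lemma sprod_nonneg:
  fixes u :: "'n::finite \<Rightarrow> ('n, real) series"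
  assumes "\<And>k Q. 0 \<le> u k Q"
  shows "0 \<le> sprod u ks Q"
  using assms by (induction ks arbitrary: Q) (auto simp: sone_def smul_def intro!: sum_nonneg)

lemma norm_sprod_le:
  fixes d :: "'n::finite \<Rightarrow> ('n, 'a::real_normed_field) series"
  shows "norm (sprod d ks Q) \<le> sprod (\<lambda>k Q. norm (d k Q)) ks Q"
proof (induction ks arbitrary: Q)
  case (Cons k ks)
  have "norm (sprod d (k # ks) Q) \<le> smul (\<lambda>Q. norm (d k Q)) (\<lambda>Q. norm (sprod d ks Q)) Q"
    by (simp add: norm_smul_le)
  also have "\<dots> \<le> smul (\<lambda>Q. norm (d k Q)) (sprod (\<lambda>k Q. norm (d k Q)) ks) Q"
    unfolding smul_def by (intro sum_mono mult_left_mono Cons) auto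
  finally show ?case by simp
qed (simp add: sone_def)

lemma norm_nonlin_le:
  "norm (nonlin f \<Phi> Q) \<le>
    (\<Sum>P | 2 \<le> mdeg P \<and> mdeg P \<le> mdeg Q. norm (f P) * sprod (\<lambda>k Q. norm (\<Phi> k Q)) (index_list P) Q)"
  unfolding nonlin_def
  by (rule order_trans[OF norm_sum]) (auto simp: norm_mult intro!: sum_mono mult_left_mono norm_sprod_le)

lemma finite_mdeg_between: "finite {P :: 'n::finite \<Rightarrow> nat. 2 \<le> mdeg P \<and> mdeg P \<le> N}"
  by (rule finite_subset[OF _ finite_mdeg_le[of N]]) auto

text \<open>The truncation \<open>v\<close> at degree \<open>N\<close> already determines the
  products of at least two factors up to degree \<open>Suc N\<close>, and it has a finite norm at
  radius \<open>t\<close>. The linear terms account for the summand with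
  \<open>CARD('n)\<close>.\<close>

lemma majorant_step:
  fixes u a :: "'n::finite \<Rightarrow> ('n, real) series" and t V \<rho> :: real
  assumes u: "\<And>k Q. 0 \<le> u k Q" "\<And>k. u k 0 = 0" "\<And>k l. u k (unit_index l) \<le> 1"
    and a: "\<And>k P. 0 \<le> a k P" "absconv (a k) \<rho>" "0 < \<rho>"
    and rec: "\<And>k Q. 2 \<le> mdeg Q \<Longrightarrow> u k Q \<le>
        (\<Sum>P | 2 \<le> mdeg P \<and> mdeg P \<le> mdeg Q. a k P * sprod u (index_list P) Q)"
    and t: "0 < t" and V: "0 \<le> V" "V \<le> \<rho>"
    and IH: "\<And>k. (\<Sum>Q | mdeg Q \<le> N. u k Q * t ^ mdeg Q) \<le> V"
  shows "(\<Sum>Q | mdeg Q \<le> Suc N. u k Q * t ^ mdeg Q) \<le> real CARD('n) * t + (V / \<rho>)\<^sup>2 * snorm (a k) \<rho>"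
proof -
  define v where "v = (\<lambda>k Q. if mdeg Q \<le> N then u k Q else 0)"
  have v: "0 \<le> v k Q" "v k 0 = 0" for k Q using u by (auto simp: v_def)
  have v_supp: "v k Q = 0" if "Q \<notin> {Q. mdeg Q \<le> N}" for k Q using that by (simp add: v_def)
  have v_conv: "absconv (v k) t" for k
    by (rule absconv_finite, rule finite_subset[OF _ finite_mdeg_le[of N]]) (auto simp: v_def)
  have v_norm: "snorm (v k) t \<le> V" for k
  proof -
    have "snorm (v k) t = (\<Sum>Q | mdeg Q \<le> N. norm (v k Q) * t ^ mdeg Q)"
      by (rule snorm_finite[OF finite_mdeg_le v_supp])
    also have "\<dots> = (\<Sum>Q | mdeg Q \<le> N. u k Q * t ^ mdeg Q)"
      using u by (intro sum.cong) (auto simp: v_def)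
    finally show ?thesis using IH by simp
  qed
  let ?D = "{P :: 'n \<Rightarrow> nat. 2 \<le> mdeg P \<and> mdeg P \<le> Suc N}"
  have bnd: "u k Q * t ^ mdeg Q \<le> (\<Sum>P\<in>?D. a k P * (sprod v (index_list P) Q * t ^ mdeg Q))"
    if Q: "Q \<in> ?D" for Q
  proof -
    have "sprod u (index_list P) Q = sprod v (index_list P) Q" if "2 \<le> mdeg P" for P
    proof (rule sprod_cong_less)
      fix k P assume "P \<le> Q" "P \<noteq> Q"
      then have "mdeg P \<le> N" using mdeg_strict_mono[of P Q] Q by simp
      then show "u k P = v k P" by (simp add: v_def)
    qed (use u v that in auto)
    then have "u k Q \<le> (\<Sum>P | 2 \<le> mdeg P \<and> mdeg P \<le> mdeg Q. a k P * sprod v (index_list P) Q)"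
      using rec[of Q k] Q by simp
    also have "\<dots> \<le> (\<Sum>P\<in>?D. a k P * sprod v (index_list P) Q)"
      using Q a v by (intro sum_mono2 finite_mdeg_between mult_nonneg_nonneg sprod_nonneg) auto
    finally have "u k Q * t ^ mdeg Q \<le> (\<Sum>P\<in>?D. a k P * sprod v (index_list P) Q) * t ^ mdeg Q"
      using t by (intro mult_right_mono) auto
    then show ?thesis by (simp add: sum_distrib_right mult.assoc)
  qed
  have "(\<Sum>Q\<in>?D. u k Q * t ^ mdeg Q) \<le> (\<Sum>Q\<in>?D. \<Sum>P\<in>?D. a k P * (sprod v (index_list P) Q * t ^ mdeg Q))"
    by (rule sum_mono) (rule bnd)
  also have "\<dots> = (\<Sum>P\<in>?D. a k P * (\<Sum>Q\<in>?D. sprod v (index_list P) Q * t ^ mdeg Q))"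
    by (subst sum.swap) (simp add: sum_distrib_left)
  also have "\<dots> \<le> (\<Sum>P\<in>?D. a k P * V ^ mdeg P)"
  proof (intro sum_mono mult_left_mono a)
    fix P
    have "absconv (sprod v (index_list P)) t" using absconv_sprod[of v t "index_list P"] v_conv t by simp
    then have "(\<Sum>Q\<in>?D. norm (sprod v (index_list P) Q) * t ^ mdeg Q) \<le> snorm (sprod v (index_list P)) t"
      using t by (intro absconv_partial_le finite_mdeg_between) auto
    also have "\<dots> \<le> V ^ mdeg P"
      using snorm_sprod_le[of v t V "index_list P"] v_conv v_norm t by simp
    finally show "(\<Sum>Q\<in>?D. sprod v (index_list P) Q * t ^ mdeg Q) \<le> V ^ mdeg P"
      using sprod_nonneg[of v] v by simp
  qed
  \<comment> \<open>Degree at least 2 and \<open>V \<le> \<rho>\<close> produce the quadratic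
    factor, which is negligible against the linear term for small \<open>t\<close>.\<close>
  also have "\<dots> \<le> (\<Sum>P\<in>?D. (V / \<rho>)\<^sup>2 * (norm (a k P) * \<rho> ^ mdeg P))"
  proof (rule sum_mono)
    fix P assume P: "P \<in> ?D"
    have "V ^ mdeg P = (V / \<rho>) ^ mdeg P * \<rho> ^ mdeg P" using a by (simp add: power_divide)
    also have "\<dots> \<le> (V / \<rho>)\<^sup>2 * \<rho> ^ mdeg P"
      using P a V by (intro mult_right_mono power_decreasing) auto
    finally have "a k P * V ^ mdeg P \<le> a k P * ((V / \<rho>)\<^sup>2 * \<rho> ^ mdeg P)"
      using a by (intro mult_left_mono) auto
    then show "a k P * V ^ mdeg P \<le> (V / \<rho>)\<^sup>2 * (norm (a k P) * \<rho> ^ mdeg P)"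
      using a(1)[of k P] by (simp only: real_norm_def abs_of_nonneg mult_ac)
  qed
  also have "\<dots> = (V / \<rho>)\<^sup>2 * (\<Sum>P\<in>?D. norm (a k P) * \<rho> ^ mdeg P)"
    by (simp add: sum_distrib_left)
  also have "\<dots> \<le> (V / \<rho>)\<^sup>2 * snorm (a k) \<rho>"
    using a by (intro mult_left_mono absconv_partial_le finite_mdeg_between) auto
  finally have high: "(\<Sum>Q\<in>?D. u k Q * t ^ mdeg Q) \<le> (V / \<rho>)\<^sup>2 * snorm (a k) \<rho>" .
  have "(\<Sum>Q\<in>range unit_index. u k Q * t ^ mdeg Q) = (\<Sum>l\<in>UNIV. u k (unit_index l) * t)"
    by (simp add: sum.reindex inj_def)
  also have "\<dots> \<le> (\<Sum>l\<in>(UNIV :: 'n set). 1 * t)"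
    using u t by (intro sum_mono mult_right_mono) auto
  finally have low: "(\<Sum>Q\<in>range unit_index. u k Q * t ^ mdeg Q) \<le> real CARD('n) * t" by simp
  have "(\<Sum>Q | mdeg Q \<le> Suc N. u k Q * t ^ mdeg Q) = (\<Sum>Q\<in>range unit_index \<union> ?D. u k Q * t ^ mdeg Q)"
  proof (rule sum.mono_neutral_right)
    show "\<forall>Q\<in>{Q. mdeg Q \<le> Suc N} - (range unit_index \<union> ?D). u k Q * t ^ mdeg Q = 0"
    proof
      fix Q assume Q: "Q \<in> {Q. mdeg Q \<le> Suc N} - (range unit_index \<union> ?D)"
      then have "mdeg Q = 0" using mdeg_eq_1E[of Q] by fastforce
      then show "u k Q * t ^ mdeg Q = 0" using u by (simp add: mdeg_eq_0_iff)
    qed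
  qed (auto simp: finite_mdeg_le)
  also have "\<dots> = (\<Sum>Q\<in>range unit_index. u k Q * t ^ mdeg Q) + (\<Sum>Q\<in>?D. u k Q * t ^ mdeg Q)"
    by (rule sum.union_disjoint) (auto simp: finite_mdeg_between)
  finally show ?thesis using low high by linarith
qed

theorem majorant_convergence:
  fixes u a :: "'n::finite \<Rightarrow> ('n, real) series"
  assumes u: "\<And>k Q. 0 \<le> u k Q" "\<And>k. u k 0 = 0" "\<And>k l. u k (unit_index l) \<le> 1"
    and a: "\<And>k P. 0 \<le> a k P" "\<And>k. absconv (a k) \<rho>" "0 < \<rho>"
    and rec: "\<And>k Q. 2 \<le> mdeg Q \<Longrightarrow> u k Q \<le>
        (\<Sum>P | 2 \<le> mdeg P \<and> mdeg P \<le> mdeg Q. a k P * sprod u (index_list P) Q)"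
  shows "\<exists>t>0. \<forall>k. absconv (u k) t"
proof -
  define n where "n = real CARD('n)"
  obtain A where A: "\<And>k. snorm (a k) \<rho> \<le> A" "A > 0"
    using uniform_snorm_bound[of \<rho> a] a(3) by auto
  have n: "n > 0" by (simp add: n_def)
  \<comment> \<open>The bound \<open>V = 2 * n * t\<close> reproduces itself if
    \<open>V \<le> \<rho>\<close> and the quadratic term is at most \<open>n * t\<close>, that is,
    \<open>4 * n * A * t \<le> \<rho>\<^sup>2\<close>. These are the two entries of the
    minimum.\<close>
  define t where "t = min (\<rho> / (2 * n)) (\<rho>\<^sup>2 / (4 * n * A))"
  have t: "t > 0" using n A a by (simp add: t_def)
  define V where "V = 2 * n * t"
  have "2 * n * t \<le> 2 * n * (\<rho> / (2 * n))"
    using n by (intro mult_left_mono) (auto simp: t_def)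
  then have V: "0 \<le> V" "V \<le> \<rho>" using n t by (auto simp: V_def)
  have "4 * n * A * t \<le> 4 * n * A * (\<rho>\<^sup>2 / (4 * n * A))"
    using n A by (intro mult_left_mono) (auto simp: t_def)
  then have tA: "4 * n * A * t \<le> \<rho>\<^sup>2" using n A by simp
  have "(V / \<rho>)\<^sup>2 * A = n * t * (4 * n * A * t) / \<rho>\<^sup>2"
    by (simp add: V_def power2_eq_square field_simps)
  also have "\<dots> \<le> n * t * \<rho>\<^sup>2 / \<rho>\<^sup>2"
    using tA n t by (intro divide_right_mono mult_left_mono) auto
  also have "\<dots> = n * t" using a by simp
  finally have VA: "(V / \<rho>)\<^sup>2 * A \<le> n * t" .
  have bound: "\<forall>k. (\<Sum>Q | mdeg Q \<le> N. u k Q * t ^ mdeg Q) \<le> V" for N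
  proof (induction N)
    case 0
    have "(\<Sum>Q | mdeg Q \<le> 0. u k Q * t ^ mdeg Q) = 0" for k
      by (rule sum.neutral) (auto simp: mdeg_eq_0_iff u)
    then show ?case using V by simp
  next
    case (Suc N)
    show ?case
    proof
      fix k
      have "(\<Sum>Q | mdeg Q \<le> Suc N. u k Q * t ^ mdeg Q) \<le> n * t + (V / \<rho>)\<^sup>2 * snorm (a k) \<rho>"
        unfolding n_def by (rule majorant_step[OF u a(1,2,3) rec t V]) (use Suc in auto)
      also have "\<dots> \<le> n * t + (V / \<rho>)\<^sup>2 * A" using A by (intro add_left_mono mult_left_mono) auto
      also have "\<dots> \<le> V" using VA by (simp add: V_def)
      finally show "(\<Sum>Q | mdeg Q \<le> Suc N. u k Q * t ^ mdeg Q) \<le> V" .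
    qed
  qed
  have "absconv (u k) t" for k
    using bound u t by (intro absconvI_bound[of _ _ V]) auto
  then show ?thesis using t by blast
qed

section \<open>Inverse maps\<close>

lemma common_absconv_radius:
  fixes c :: "'i::finite \<Rightarrow> 'n::finite fseries"
  assumes "\<And>i. convergent_series (c i)"
  obtains r where "r > 0" "\<And>i. absconv (c i) r"
proof -
  obtain r' where r': "\<And>i. r' i > 0" "\<And>i. absconv (c i) (r' i)"
    using assms unfolding convergent_series_iff by metis
  define r where "r = Min (range r')"
  have "r > 0" "\<And>i. r \<le> r' i" using r' by (auto simp: r_def)
  then show ?thesis using r' by (intro that[of r]) (auto intro: absconv_mono less_imp_le)
qed

definition feval :: "'n::finite fmap \<Rightarrow> complex ^ 'n \<Rightarrow> complex ^ 'n" where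
  "feval \<Phi> z = (\<chi> k. seval (\<Phi> k) z)"

lemma has_expansion_seval: "convergent_series c \<Longrightarrow> has_expansion (seval c) 0 c"
  unfolding convergent_series_iff has_expansion_iff by auto

lemma eventually_seval_fsubst:
  assumes c: "convergent_series c" and d: "\<And>k. convergent_series (d k)" "\<And>k. d k 0 = 0"
  shows "convergent_series (fsubst c d)"
    and "\<forall>\<^sub>F z in nhds 0. seval (fsubst c d) z = seval c (feval d z)"
proof -
  obtain \<rho> where \<rho>: "\<rho> > 0" "absconv c \<rho>" using c by (auto simp: convergent_series_iff)
  obtain r where r: "r > 0" "\<And>k. absconv (d k) r" using common_absconv_radius[of d] d(1) by blast
  obtain s where s: "s > 0" "absconv (fsubst c d) s"
    "\<And>z. z \<in> polydisc s \<Longrightarrow> seval (fsubst c d) z = seval c (\<chi> k. seval (d k) z)"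
    by (rule seval_fsubst[of c \<rho> d r]) (use \<rho> r d in auto)
  then show "convergent_series (fsubst c d)" "\<forall>\<^sub>F z in nhds 0. seval (fsubst c d) z = seval c (feval d z)"
    unfolding convergent_series_iff eventually_polydisc feval_def by blast+
qed

lemma tendsto_feval:
  assumes "\<And>k. convergent_series (\<Phi> k)" "\<And>k. \<Phi> k 0 = 0"
  shows "filterlim (feval \<Phi>) (nhds 0) (nhds 0)"
proof (rule vec_tendstoI)
  fix k
  have "isCont (seval (\<Phi> k)) 0"
    using has_expansion_seval[OF assms(1)] by (intro holo_at_continuous) (auto simp: holo_at_def)
  then show "((\<lambda>z. feval \<Phi> z $ k) \<longlongrightarrow> 0 $ k) (nhds 0)"
    using assms(2) unfolding feval_def isCont_def tendsto_at_iff_tendsto_nhds by (simp add: seval_zero)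
qed

text \<open>The inverse is a fixed point of \<open>T\<close>. Since \<open>nonlin\<close> looks only
  at lower exponents, the \<open>m\<close>-th iterate is final up to degree \<open>m\<close>, and
  the fixed point is read off degree by degree.\<close>

lemma formal_right_inverse:
  fixes \<Phi> :: "'n::finite fmap"
  assumes \<Phi>: "tangent_to_id \<Phi>"
  obtains \<Psi> where "tangent_to_id \<Psi>" "fcomp_map \<Phi> \<Psi> = linear_fmap (mat 1)"
    "\<And>k Q. 2 \<le> mdeg Q \<Longrightarrow> \<Psi> k Q = - nonlin (\<Phi> k) \<Psi> Q"
proof -
  define T where "T = (\<lambda>\<Psi> k Q. linear_fmap (mat 1) k Q - nonlin (\<Phi> k) \<Psi> Q)"
  define it where "it = (\<lambda>m. (T ^^ m) (linear_fmap (mat 1)))"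
  have it_Suc: "it (Suc m) = T (it m)" for m by (simp add: it_def)
  have T0: "T \<Psi> k 0 = 0" for \<Psi> k by (simp add: T_def linear_fmap_coeff(3) nonlin_deg_less_2)
  have it0: "it m k 0 = 0" for m k
    by (cases m) (simp add: it_def linear_fmap_coeff(3), simp add: it_Suc T0)
  have stable: "\<forall>k m. mdeg Q \<le> m \<longrightarrow> it (Suc m) k Q = it m k Q" for Q
  proof (induction "mdeg Q" arbitrary: Q rule: less_induct)
    case less
    show ?case
    proof (intro allI impI)
      fix k m assume m: "mdeg Q \<le> m"
      show "it (Suc m) k Q = it m k Q"
      proof (cases "Q = 0")
        case False
        then obtain m' where m': "m = Suc m'" using m mdeg_eq_0_iff[of Q] by (cases m) auto
        have "nonlin (\<Phi> k) (it m) Q = nonlin (\<Phi> k) (it m') Q"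
        proof (intro nonlin_cong it0)
          fix k P assume "P \<le> Q" "P \<noteq> Q"
          then have "mdeg P < mdeg Q" by (rule mdeg_strict_mono)
          then show "it m k P = it m' k P" using less m m' by auto
        qed
        then show ?thesis using m' by (simp add: it_Suc T_def)
      qed (simp add: it0)
    qed
  qed
  have stable': "it (mdeg Q + j) k Q = it (mdeg Q) k Q" for Q k j
    by (induction j) (use stable in auto)
  define \<Psi> where "\<Psi> = (\<lambda>k Q. it (mdeg Q) k Q)"
  have \<Psi>0: "\<Psi> k 0 = 0" for k by (simp add: \<Psi>_def it0)
  have \<Psi>: "\<Psi> k Q = linear_fmap (mat 1) k Q - nonlin (\<Phi> k) \<Psi> Q" for k Q
  proof -
    have "\<Psi> k Q = it (Suc (mdeg Q)) k Q" using stable by (simp add: \<Psi>_def)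
    also have "\<dots> = linear_fmap (mat 1) k Q - nonlin (\<Phi> k) (it (mdeg Q)) Q"
      by (simp add: it_Suc T_def)
    also have "nonlin (\<Phi> k) (it (mdeg Q)) Q = nonlin (\<Phi> k) \<Psi> Q"
    proof (intro nonlin_cong it0 \<Psi>0)
      fix l P assume "P \<le> Q" "P \<noteq> Q"
      then have "mdeg P < mdeg Q" by (rule mdeg_strict_mono)
      then show "it (mdeg Q) l P = \<Psi> l P"
        using stable'[of P "mdeg Q - mdeg P" l] by (simp add: \<Psi>_def)
    qed
    finally show ?thesis .
  qed
  show ?thesis
  proof (rule that[of \<Psi>])
    show "tangent_to_id \<Psi>"
      by (rule tangent_to_idI) (auto simp: \<Psi>0 \<Psi>[of _ "unit_index _"] linear_fmap_id nonlin_deg_less_2)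
    show "fcomp_map \<Phi> \<Psi> = linear_fmap (mat 1)"
    proof (intro ext)
      fix k Q
      show "fcomp_map \<Phi> \<Psi> k Q = linear_fmap (mat 1) k Q"
      proof (cases "Q = 0")
        case True
        then show ?thesis
          by (simp add: fcomp_map_def fsubst_0 tangent_to_id_coeff[OF \<Phi>] linear_fmap_coeff(3))
      next
        case False
        then have "fsubst (\<Phi> k) \<Psi> Q = \<Psi> k Q + nonlin (\<Phi> k) \<Psi> Q"
          by (simp add: fsubst_split tangent_to_id_coeff[OF \<Phi>] if_distrib[where f = "\<lambda>x. x * _"] cong: if_cong)
        then show ?thesis using \<Psi>[of k Q] by (simp add: fcomp_map_def)
      qed
    qed
    show "\<Psi> k Q = - nonlin (\<Phi> k) \<Psi> Q" if "2 \<le> mdeg Q" for k Q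
      using that \<Psi>[of k Q] by (simp add: linear_fmap_coeff(3))
  qed
qed

text \<open>The inverse solves a recursion whose divisors are all 1, so
  \<open>majorant_convergence\<close> applies without a weight.\<close>

lemma convergent_right_inverse:
  fixes \<Phi> :: "'n::finite fmap"
  assumes \<Phi>: "tangent_to_id \<Phi>" "\<And>k. convergent_series (\<Phi> k)"
  obtains \<Psi> where "tangent_to_id \<Psi>" "\<And>k. convergent_series (\<Psi> k)"
    "\<forall>\<^sub>F z in nhds 0. feval \<Phi> (feval \<Psi> z) = z"
proof -
  obtain \<Psi> where \<Psi>: "tangent_to_id \<Psi>" "fcomp_map \<Phi> \<Psi> = linear_fmap (mat 1)"
    "\<And>k Q. 2 \<le> mdeg Q \<Longrightarrow> \<Psi> k Q = - nonlin (\<Phi> k) \<Psi> Q"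
    using formal_right_inverse[OF \<Phi>(1)] by metis
  obtain \<rho> where \<rho>: "\<rho> > 0" "\<And>k. absconv (\<Phi> k) \<rho>" using common_absconv_radius[of \<Phi>] \<Phi>(2) by blast
  have "\<exists>t>0. \<forall>k. absconv (\<lambda>Q. norm (\<Psi> k Q)) t"
  proof (rule majorant_convergence[where a = "\<lambda>k Q. norm (\<Phi> k Q)"])
    fix k Q assume "2 \<le> mdeg (Q :: 'n \<Rightarrow> nat)"
    then show "norm (\<Psi> k Q) \<le> (\<Sum>P | 2 \<le> mdeg P \<and> mdeg P \<le> mdeg Q.
        norm (\<Phi> k P) * sprod (\<lambda>k Q. norm (\<Psi> k Q)) (index_list P) Q)"
      using norm_nonlin_le[of "\<Phi> k" \<Psi> Q] by (simp add: \<Psi>(3))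
  qed (use \<rho> in \<open>auto simp: absconv_def tangent_to_id_coeff[OF \<Psi>(1)]\<close>)
  then have conv: "convergent_series (\<Psi> k)" for k
    by (auto simp: convergent_series_iff absconv_def)
  have "\<forall>\<^sub>F z in nhds 0. \<forall>k\<in>UNIV. seval (fsubst (\<Phi> k) \<Psi>) z = seval (\<Phi> k) (feval \<Psi> z)"
    using eventually_seval_fsubst(2)[OF \<Phi>(2) conv tangent_to_id_coeff(1)[OF \<Psi>(1)]]
    by (subst eventually_ball_finite_distrib) auto
  then have "\<forall>\<^sub>F z in nhds 0. feval \<Phi> (feval \<Psi> z) = z"
  proof eventually_elim
    case (elim z)
    have "seval (\<Phi> k) (feval \<Psi> z) = z $ k" for k
    proof -
      have "seval (\<Phi> k) (feval \<Psi> z) = seval (fcomp_map \<Phi> \<Psi> k) z"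
        using elim by (simp add: fcomp_map_def)
      then show ?thesis by (simp add: \<Psi>(2) seval_linear_fmap)
    qed
    then show ?case by (simp add: feval_def[of \<Phi>] vec_eq_iff)
  qed
  then show ?thesis using \<Psi>(1) conv by (intro that)
qed

text \<open>The right inverse \<open>\<Psi>\<close> has a right inverse \<open>\<Theta>\<close> in
  turn. Near 0 the composition of all three maps equals both \<open>\<Phi>\<close> and
  \<open>\<Theta>\<close>, so \<open>\<Psi>\<close> is a left inverse too.\<close>

theorem convergent_inverse:
  fixes \<Phi> :: "'n::finite fmap"
  assumes \<Phi>: "tangent_to_id \<Phi>" "\<And>k. convergent_series (\<Phi> k)"
  obtains \<Psi> where "tangent_to_id \<Psi>" "\<And>k. convergent_series (\<Psi> k)"
    "\<forall>\<^sub>F z in nhds 0. feval \<Phi> (feval \<Psi> z) = z" "\<forall>\<^sub>F z in nhds 0. feval \<Psi> (feval \<Phi> z) = z"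
proof -
  obtain \<Psi> where \<Psi>: "tangent_to_id \<Psi>" "\<And>k. convergent_series (\<Psi> k)"
    "\<forall>\<^sub>F z in nhds 0. feval \<Phi> (feval \<Psi> z) = z"
    using convergent_right_inverse[OF \<Phi>] by metis
  obtain \<Theta> where \<Theta>: "tangent_to_id \<Theta>" "\<And>k. convergent_series (\<Theta> k)"
    "\<forall>\<^sub>F z in nhds 0. feval \<Psi> (feval \<Theta> z) = z"
    using convergent_right_inverse[OF \<Psi>(1,2)] by metis
  have "\<forall>\<^sub>F z in nhds 0. feval \<Phi> (feval \<Psi> (feval \<Theta> z)) = feval \<Theta> z"
    using \<Psi>(3) tendsto_feval[of \<Theta>] \<Theta>(2) tangent_to_id_coeff(1)[OF \<Theta>(1)]
    by (auto simp: filterlim_iff)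
  with \<Theta>(3) have "\<forall>\<^sub>F z in nhds 0. feval \<Psi> (feval \<Phi> z) = z"
    by eventually_elim metis
  then show ?thesis using \<Psi> by (intro that)
qed

section \<open>Brjuno's estimate\<close>

text \<open>Records how far the small divisors below \<open>Q\<close> reach, with 0 if there are
  none. Under separation a proper part of a counted \<open>Q\<close> reaches at most degree
  \<open>mdeg Q - m\<close>.\<close>

definition max_counted :: "(('n::finite \<Rightarrow> nat) \<Rightarrow> bool) \<Rightarrow> ('n \<Rightarrow> nat) \<Rightarrow> nat" where
  "max_counted C Q = Max (insert 0 (mdeg ` {P. P \<le> Q \<and> C P}))"

text \<open>Superadditive in \<open>Q\<close>, with a gain of 1 at the indices with a small divisor (those
  satisfying \<open>C\<close>); this replaces the usual count of small divisors over a tree.\<close>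

definition brjuno_count :: "(('n::finite \<Rightarrow> nat) \<Rightarrow> bool) \<Rightarrow> nat \<Rightarrow> ('n \<Rightarrow> nat) \<Rightarrow> real" where
  "brjuno_count C m Q = max 0 (max (2 * mdeg Q / m - 2) ((mdeg Q + max_counted C Q) / m - 1))"

lemma finite_counted: "finite (mdeg ` {P :: 'n::finite \<Rightarrow> nat. P \<le> Q \<and> C P})"
  by (rule finite_imageI, rule finite_subset[OF _ finite_atMost_fun[of Q]]) auto

lemma max_counted_le: "(\<And>P. P \<le> Q \<Longrightarrow> C P \<Longrightarrow> mdeg P \<le> b) \<Longrightarrow> max_counted C Q \<le> b"
  unfolding max_counted_def using finite_counted[of Q C] by auto

lemma max_counted_ge: "P \<le> Q \<Longrightarrow> C P \<Longrightarrow> mdeg P \<le> max_counted C Q"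
  unfolding max_counted_def using finite_counted[of Q C] by (intro Max_ge) auto

lemma max_counted_mono: "P \<le> Q \<Longrightarrow> max_counted C P \<le> max_counted C Q"
  by (rule max_counted_le) (auto intro: max_counted_ge order_trans)

lemma max_counted_le_mdeg: "max_counted C Q \<le> mdeg Q"
  by (rule max_counted_le) (rule mdeg_mono)

lemma brjuno_count_nonneg: "0 \<le> brjuno_count C m Q"
  by (simp add: brjuno_count_def)

lemma brjuno_count_mono:
  assumes "P \<le> Q"
  shows "brjuno_count C m P \<le> brjuno_count C m Q"
  unfolding brjuno_count_def
  using mdeg_mono[OF assms] max_counted_mono[OF assms, of C]
  by (intro max.mono diff_mono divide_right_mono) auto

lemma brjuno_count_le:
  assumes "m > 0"
  shows "brjuno_count C m Q \<le> max 0 (2 * mdeg Q / m - 1)"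
proof -
  have "(mdeg Q + max_counted C Q) / m \<le> 2 * mdeg Q / m"
    using max_counted_le_mdeg[of C Q] by (intro divide_right_mono) auto
  then show ?thesis unfolding brjuno_count_def by (auto simp: max_def)
qed

lemma brjuno_count_counted:
  assumes "C Q" "m < mdeg Q" "m > 0"
  shows "brjuno_count C m Q = 2 * mdeg Q / m - 1"
proof -
  have "max_counted C Q = mdeg Q"
    using max_counted_ge[of Q Q C] max_counted_le_mdeg[of C Q] assms by simp
  moreover have "1 \<le> mdeg Q / m" using assms by simp
  ultimately show ?thesis unfolding brjuno_count_def by (auto simp: max_def)
qed

text \<open>At a counted index the value is \<open>2 * mdeg Q / m - 1\<close>, one more than the
  first branch of the maximum. By \<open>large\<close> and \<open>sep\<close> a proper part of a
  counted index stays at least 1 below it, which leaves room for the gain.\<close>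

lemma brjuno_count_superadditive:
  assumes m: "m > 0" and large: "\<And>Q. C Q \<Longrightarrow> m < mdeg Q"
    and sep: "\<And>P Q. C P \<Longrightarrow> C Q \<Longrightarrow> P \<le> Q \<Longrightarrow> P \<noteq> Q \<Longrightarrow> mdeg P + m \<le> mdeg Q"
    and ne: "Q1 \<noteq> 0" "Q2 \<noteq> 0"
  shows "brjuno_count C m Q1 + brjuno_count C m Q2 + (if C (Q1 + Q2) then 1 else 0)
      \<le> brjuno_count C m (Q1 + Q2)"
proof -
  let ?g = "brjuno_count C m"
  let ?Q = "Q1 + Q2"
  have le: "Q1 \<le> ?Q" "Q2 \<le> ?Q" by (rule le_plus_fun)+
  have neQ: "Q1 \<noteq> ?Q" "Q2 \<noteq> ?Q" using ne by auto
  have up: "?g P \<le> 2 * mdeg P / m - 1" if "?g P \<noteq> 0" for P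
    using brjuno_count_le[OF m, of C P] brjuno_count_nonneg[of C m P] that by (auto simp: max_def split: if_splits)
  have low: "2 * mdeg ?Q / m - 2 \<le> ?g ?Q" by (simp add: brjuno_count_def)
  have single: "?g P \<le> 2 * mdeg ?Q / m - 2" if C: "C ?Q" and P: "P \<le> ?Q" "P \<noteq> ?Q" for P
  proof -
    have Q1: "1 \<le> mdeg ?Q / m" using large[OF C] m by simp
    have dP: "real (mdeg P) / m \<le> mdeg ?Q / m" using mdeg_mono[OF P(1)] by (simp add: divide_right_mono)
    have "max_counted C P \<le> mdeg ?Q - m"
    proof (rule max_counted_le)
      fix R assume R: "R \<le> P" "C R"
      then have "R \<le> ?Q" "R \<noteq> ?Q" using P by (auto intro: order_trans dest: antisym)
      then show "mdeg R \<le> mdeg ?Q - m" using sep[OF R(2) C] by simp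
    qed
    then have "real (max_counted C P) + m \<le> mdeg ?Q" using large[OF C] by linarith
    then have "(real (max_counted C P) + m) / m \<le> mdeg ?Q / m" by (rule divide_right_mono) simp
    then have "real (max_counted C P) / m + 1 \<le> mdeg ?Q / m" using m by (simp add: add_divide_distrib)
    then show ?thesis using Q1 dP unfolding brjuno_count_def by (simp add: add_divide_distrib)
  qed
  have counted: "?g ?Q = 2 * mdeg ?Q / m - 1" "1 < real (mdeg ?Q) / m" if "C ?Q"
    using brjuno_count_counted[of C ?Q m] that large[OF that] m by auto
  consider "?g Q1 = 0" "?g Q2 = 0" | "?g Q1 = 0" "?g Q2 \<noteq> 0" | "?g Q1 \<noteq> 0" "?g Q2 = 0"
    | "?g Q1 \<noteq> 0" "?g Q2 \<noteq> 0" by blast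
  then show ?thesis
  proof cases
    case 1
    then show ?thesis using counted brjuno_count_nonneg[of C m ?Q] by auto
  next
    case 2
    then show ?thesis using counted single[of Q2] le neQ brjuno_count_mono[OF le(2), of C m] by auto
  next
    case 3
    then show ?thesis using counted single[of Q1] le neQ brjuno_count_mono[OF le(1), of C m] by auto
  next
    case 4
    \<comment> \<open>Each positive count falls short of \<open>2 * mdeg P / m\<close> by at least
      1; together this is the \<open>- 2\<close> in the first branch of
      \<open>brjuno_count\<close>.\<close>
    have "2 * real (mdeg ?Q) / m = 2 * mdeg Q1 / m + 2 * mdeg Q2 / m"
      by (simp add: mdeg_plus add_divide_distrib algebra_simps)
    with up[OF 4(1)] up[OF 4(2)] have "?g Q1 + ?g Q2 \<le> 2 * mdeg ?Q / m - 2"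
      by linarith
    then show ?thesis using counted low by auto
  qed
qed

text \<open>The weight adds up the counts of all levels with costs \<open>a \<nu>\<close>. Level
  \<open>\<nu>\<close> counts at most \<open>2 * mdeg Q / 2 ^ \<nu>\<close>, so Brjuno's sum is what
  makes the total finite and of linear growth.\<close>

theorem brjuno_weight:
  fixes \<delta> :: "('n::finite \<Rightarrow> nat) \<Rightarrow> 'k::finite \<Rightarrow> real" and w :: "nat \<Rightarrow> real"
  assumes w: "\<And>\<nu>. 0 < w \<nu>" "\<And>\<nu>. w \<nu> \<le> 1" and \<theta>: "0 < \<theta>" "\<theta> \<le> 1"
    and bound: "\<And>Q k \<nu>. Q \<in> E \<Longrightarrow> 2 \<le> mdeg Q \<Longrightarrow> mdeg Q \<le> 2 ^ \<nu> \<Longrightarrow> w \<nu> \<le> \<delta> Q k"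
    and sep: "\<And>P Q k \<nu>. P \<in> E \<Longrightarrow> Q \<in> E \<Longrightarrow> 2 \<le> mdeg P \<Longrightarrow> 2 \<le> mdeg Q \<Longrightarrow> P \<le> Q \<Longrightarrow> P \<noteq> Q \<Longrightarrow>
      \<delta> P k < \<theta> * w \<nu> \<Longrightarrow> \<delta> Q k < \<theta> * w \<nu> \<Longrightarrow> mdeg P + 2 ^ \<nu> \<le> mdeg Q"
    and summable: "summable (\<lambda>\<nu>. - ln (w \<nu>) / 2 ^ \<nu>)"
  obtains G :: "('n \<Rightarrow> nat) \<Rightarrow> real" and K :: real where "\<And>Q. 0 \<le> G Q" "\<And>Q. G Q \<le> K * mdeg Q"
    "\<And>P Q. P \<noteq> 0 \<Longrightarrow> Q \<noteq> 0 \<Longrightarrow> G P + G Q \<le> G (P + Q)"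
    "\<And>P Q k. P \<noteq> 0 \<Longrightarrow> Q \<noteq> 0 \<Longrightarrow> P + Q \<in> E \<Longrightarrow> G P + G Q \<le> G (P + Q) + ln (\<delta> (P + Q) k)"
proof -
  define C where "C = (\<lambda>\<nu> k Q. Q \<in> E \<and> 2 \<le> mdeg Q \<and> \<delta> Q k < \<theta> * w \<nu>)"
  \<comment> \<open>The shift to \<open>Suc \<nu>\<close> is deliberate: a divisor that is small at
    level \<open>\<nu>\<close> but not at the next one is bounded below by the next
    threshold.\<close>
  define a where "a = (\<lambda>\<nu>. - ln (\<theta> * w (Suc \<nu>)))"
  define c0 where "c0 = - ln (\<theta> * w 0)"
  define g where "g = (\<lambda>\<nu> k. brjuno_count (C \<nu> k) (2 ^ \<nu>))"
  have \<theta>w: "0 < \<theta> * w \<nu>" "\<theta> * w \<nu> \<le> 1" for \<nu>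
    using w[of \<nu>] \<theta> mult_mono[of \<theta> 1 "w \<nu>" 1] by auto
  have a0: "0 \<le> a \<nu>" for \<nu> using \<theta>w[of "Suc \<nu>"] by (simp add: a_def)
  have c0: "0 \<le> c0" using \<theta>w[of 0] by (simp add: c0_def)
  have large: "2 ^ \<nu> < mdeg Q" if "C \<nu> k Q" for \<nu> k Q
  proof (rule ccontr)
    assume "\<not> 2 ^ \<nu> < mdeg Q"
    then have "w \<nu> \<le> \<delta> Q k" using that by (intro bound) (auto simp: C_def)
    moreover have "\<theta> * w \<nu> \<le> w \<nu>" using w[of \<nu>] \<theta> by (simp add: mult_le_cancel_right1)
    ultimately show False using that by (simp add: C_def)
  qed
  have level_le: "\<nu> \<le> mdeg Q" if "C \<nu> k Q" for \<nu> k Q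
    using large[OF that] less_exp[of \<nu>] by linarith
  have g0: "0 \<le> g \<nu> k Q" for \<nu> k Q by (simp add: g_def brjuno_count_nonneg)
  have g_le: "g \<nu> k Q \<le> 2 * mdeg Q / 2 ^ \<nu>" for \<nu> k Q
  proof -
    have "g \<nu> k Q \<le> max 0 (2 * mdeg Q / real (2 ^ \<nu>) - 1)"
      unfolding g_def by (rule brjuno_count_le) simp
    also have "\<dots> \<le> 2 * mdeg Q / 2 ^ \<nu>" by (simp add: max_def)
    finally show ?thesis .
  qed
  have super: "g \<nu> k P + g \<nu> k Q + (if C \<nu> k (P + Q) then 1 else 0) \<le> g \<nu> k (P + Q)"
    if "P \<noteq> 0" "Q \<noteq> 0" for \<nu> k P Q
    unfolding g_def
  proof (rule brjuno_count_superadditive)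
    fix P Q assume "C \<nu> k P" "C \<nu> k Q" "P \<le> Q" "P \<noteq> Q"
    then show "mdeg P + 2 ^ \<nu> \<le> mdeg Q" by (intro sep) (auto simp: C_def)
  qed (use that large in auto)
  have sum_a: "summable (\<lambda>\<nu>. a \<nu> / 2 ^ \<nu>)"
  proof -
    have "summable (\<lambda>\<nu>. - ln (w (Suc \<nu>)) / 2 ^ Suc \<nu>)" using summable by (subst summable_Suc_iff)
    then have "summable (\<lambda>\<nu>. 2 * (- ln (w (Suc \<nu>)) / 2 ^ Suc \<nu>))" by (rule summable_mult)
    moreover have "summable (\<lambda>\<nu>. - ln \<theta> * (1 / 2) ^ \<nu>)" by (intro summable_mult summable_geometric) simp
    ultimately have "summable (\<lambda>\<nu>. - ln \<theta> * (1 / 2) ^ \<nu> + 2 * (- ln (w (Suc \<nu>)) / 2 ^ Suc \<nu>))"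
      by (intro summable_add)
    moreover have "- ln \<theta> * (1 / 2) ^ \<nu> + 2 * (- ln (w (Suc \<nu>)) / 2 ^ Suc \<nu>) = a \<nu> / 2 ^ \<nu>" for \<nu>
      using w[of "Suc \<nu>"] \<theta> by (simp add: a_def ln_mult power_divide diff_divide_distrib)
    ultimately show ?thesis by simp
  qed
  have ag_le: "a \<nu> * g \<nu> k Q \<le> 2 * mdeg Q * (a \<nu> / 2 ^ \<nu>)" for \<nu> k Q
    using mult_left_mono[OF g_le a0, of \<nu> \<nu> k Q] by (simp add: mult_ac)
  have sum_ag: "summable (\<lambda>\<nu>. a \<nu> * g \<nu> k Q)" for k Q
    by (rule summable_comparison_test'[OF summable_mult[OF sum_a, of "2 * mdeg Q"], of 0])
      (use ag_le a0 g0 in auto)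
  define H where "H = (\<lambda>k Q. \<Sum>\<nu>. a \<nu> * g \<nu> k Q)"
  have H0: "0 \<le> H k Q" for k Q unfolding H_def using a0 g0 by (intro suminf_nonneg sum_ag) auto
  define S where "S = (\<Sum>\<nu>. a \<nu> / 2 ^ \<nu>)"
  have H_le: "H k Q \<le> 2 * mdeg Q * S" for k Q
  proof -
    have "H k Q \<le> (\<Sum>\<nu>. 2 * mdeg Q * (a \<nu> / 2 ^ \<nu>))"
      unfolding H_def by (intro suminf_le ag_le sum_ag summable_mult sum_a)
    then show ?thesis unfolding S_def by (simp only: suminf_mult[OF sum_a])
  qed
  have H_super: "H k P + H k Q \<le> H k (P + Q)"
    and H_super_counted: "C \<nu> k (P + Q) \<Longrightarrow> H k P + H k Q + a \<nu> \<le> H k (P + Q)"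
    if ne: "P \<noteq> 0" "Q \<noteq> 0" for k \<nu> P Q
  proof -
    have fin: "finite {\<nu>. C \<nu> k (P + Q)}"
    proof (rule finite_subset)
      show "{\<nu>. C \<nu> k (P + Q)} \<subseteq> {..mdeg (P + Q)}" using level_le by auto
    qed simp
    define D where "D = (\<lambda>\<nu>. if C \<nu> k (P + Q) then a \<nu> else 0)"
    have sum_D: "summable D" unfolding D_def by (rule summable_If_finite) (rule fin)
    have "(\<Sum>\<nu>. a \<nu> * g \<nu> k P + a \<nu> * g \<nu> k Q + D \<nu>) \<le> H k (P + Q)"
      unfolding H_def
    proof (intro suminf_le summable_add sum_ag sum_D)
      fix \<nu>
      show "a \<nu> * g \<nu> k P + a \<nu> * g \<nu> k Q + D \<nu> \<le> a \<nu> * g \<nu> k (P + Q)"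
        using mult_left_mono[OF super[OF ne, of \<nu> k] a0[of \<nu>]] by (auto simp: D_def algebra_simps split: if_splits)
    qed
    moreover have "(\<Sum>\<nu>. a \<nu> * g \<nu> k P + a \<nu> * g \<nu> k Q + D \<nu>) = H k P + H k Q + suminf D"
      unfolding H_def by (simp add: suminf_add[symmetric] sum_ag sum_D summable_add)
    ultimately have *: "H k P + H k Q + suminf D \<le> H k (P + Q)" by simp
    have D0: "0 \<le> D \<nu>" for \<nu> using a0 by (simp add: D_def)
    have "0 \<le> suminf D" using D0 sum_D by (intro suminf_nonneg)
    then show "H k P + H k Q \<le> H k (P + Q)" using * by simp
    assume "C \<nu> k (P + Q)"
    then have "a \<nu> \<le> suminf D" using sum_le_suminf[OF sum_D, of "{\<nu>}"] D0 by (simp add: D_def)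
    then show "H k P + H k Q + a \<nu> \<le> H k (P + Q)" using * by simp
  qed
  \<comment> \<open>A splitting into nonzero parts raises the first term by exactly
    \<open>c0\<close>, which pays for a divisor that is small at no level. All other divisors are
    paid by \<open>H\<close>.\<close>
  define G where "G = (\<lambda>Q. c0 * real (mdeg Q - 1) + (\<Sum>k\<in>UNIV. H k Q))"
  have c0_super: "c0 * real (mdeg P - 1) + c0 * real (mdeg Q - 1) + c0 = c0 * real (mdeg (P + Q) - 1)"
    if "P \<noteq> 0" "Q \<noteq> 0" for P Q :: "'n \<Rightarrow> nat"
  proof -
    have "mdeg P \<ge> 1" "mdeg Q \<ge> 1" using that mdeg_eq_0_iff[of P] mdeg_eq_0_iff[of Q] by auto
    then have "real (mdeg P - 1) + real (mdeg Q - 1) + 1 = real (mdeg (P + Q) - 1)"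
      by (simp add: mdeg_plus of_nat_diff)
    then show ?thesis by (metis distrib_left mult.right_neutral)
  qed
  show ?thesis
  proof (rule that[of G "c0 + real CARD('k) * (2 * S)"])
    fix P Q :: "'n \<Rightarrow> nat" and k
    show "0 \<le> G Q" unfolding G_def using c0 H0 by (intro add_nonneg_nonneg mult_nonneg_nonneg sum_nonneg) auto
    have "(\<Sum>k\<in>UNIV. H k Q) \<le> (\<Sum>k\<in>(UNIV :: 'k set). 2 * mdeg Q * S)" by (intro sum_mono H_le)
    moreover have "c0 * real (mdeg Q - 1) \<le> c0 * mdeg Q" using c0 by (intro mult_left_mono) auto
    ultimately show "G Q \<le> (c0 + real CARD('k) * (2 * S)) * mdeg Q" unfolding G_def by (simp add: algebra_simps)
    assume ne: "P \<noteq> 0" "Q \<noteq> 0"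
    have "(\<Sum>k\<in>UNIV. H k P) + (\<Sum>k\<in>UNIV. H k Q) \<le> (\<Sum>k\<in>UNIV. H k (P + Q))"
      unfolding sum.distrib[symmetric] by (intro sum_mono H_super ne)
    then have G_super: "G P + G Q + c0 \<le> G (P + Q)" using c0_super[OF ne] unfolding G_def by linarith
    then show "G P + G Q \<le> G (P + Q)" using c0 by linarith
    assume E: "P + Q \<in> E"
    have deg: "2 \<le> mdeg (P + Q)"
      using ne mdeg_eq_0_iff[of P] mdeg_eq_0_iff[of Q] by (simp add: mdeg_plus)
    have \<delta>_ln: "ln (\<theta> * w \<nu>) \<le> ln (\<delta> (P + Q) k)" if "\<not> C \<nu> k (P + Q)" for \<nu>
    proof -
      have "\<theta> * w \<nu> \<le> \<delta> (P + Q) k" using that E deg by (auto simp: C_def)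
      then show ?thesis using \<theta>w(1)[of \<nu>] by simp
    qed
    show "G P + G Q \<le> G (P + Q) + ln (\<delta> (P + Q) k)"
    proof (cases "\<exists>\<nu>. C \<nu> k (P + Q)")
      case False
      then show ?thesis using G_super \<delta>_ln[of 0] by (simp add: c0_def)
    next
      case True
      have bdd: "\<forall>\<nu>. C \<nu> k (P + Q) \<longrightarrow> \<nu> \<le> mdeg (P + Q)" using level_le by auto
      \<comment> \<open>The last level at which the divisor is small. The divisor costs at most
        \<open>a \<nu>\<close>, which is the gain of the count at this level.\<close>
      define \<nu> where "\<nu> = (GREATEST \<nu>. C \<nu> k (P + Q))"
      have \<nu>: "C \<nu> k (P + Q)" unfolding \<nu>_def using True bdd by (metis GreatestI_nat)
      have "\<not> C (Suc \<nu>) k (P + Q)"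
        using bdd Greatest_le_nat[of "\<lambda>\<nu>. C \<nu> k (P + Q)" "Suc \<nu>" "mdeg (P + Q)"] by (auto simp: \<nu>_def)
      then have 1: "- a \<nu> \<le> ln (\<delta> (P + Q) k)" using \<delta>_ln[of "Suc \<nu>"] by (simp add: a_def)
      have "(\<Sum>k\<in>UNIV. H k P + H k Q) + a \<nu> = (H k P + H k Q + a \<nu>) + (\<Sum>k\<in>UNIV - {k}. H k P + H k Q)"
        by (subst sum.remove[of UNIV k]) auto
      also have "\<dots> \<le> H k (P + Q) + (\<Sum>k\<in>UNIV - {k}. H k (P + Q))"
        by (intro add_mono sum_mono H_super H_super_counted ne \<nu>)
      also have "\<dots> = (\<Sum>k\<in>UNIV. H k (P + Q))"
        by (rule sum.remove[symmetric]) auto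
      finally show ?thesis using 1 c0 c0_super[OF ne] unfolding G_def sum.distrib by linarith
    qed
  qed
qed

section \<open>Small divisors\<close>

lemma finite_divisor_range:
  "finite (range (\<lambda>(i, j). cmod (mpow (\<mu> i j) Q - \<mu> i j $ k)))"
  for \<mu> :: "'m::finite \<Rightarrow> 'm \<Rightarrow> complex ^ 'n::finite"
  by simp

lemma le_divisor: "cmod (mpow (\<mu> i j) Q - \<mu> i j $ k) \<le> divisor \<mu> Q k"
  unfolding divisor_def by (rule Max_ge[OF finite_divisor_range]) auto

lemma divisor_attained: "\<exists>i j. divisor \<mu> Q k = cmod (mpow (\<mu> i j) Q - \<mu> i j $ k)"
proof -
  obtain p where "divisor \<mu> Q k = (\<lambda>(i, j). cmod (mpow (\<mu> i j) Q - \<mu> i j $ k)) p"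
    using Max_in[OF finite_divisor_range[of \<mu> Q k]] unfolding divisor_def by blast
  then show ?thesis by (cases p) auto
qed

lemma divisor_nonneg: "0 \<le> divisor \<mu> Q k"
  using divisor_attained[of \<mu> Q k] by auto

definition divisor_values ::
  "('m::finite \<Rightarrow> 'm \<Rightarrow> complex ^ 'n::finite) \<Rightarrow> ('n \<Rightarrow> nat) set \<Rightarrow> nat \<Rightarrow> real set" where
  "divisor_values \<mu> E \<nu> =
     {d. \<exists>Q k'. Q \<in> E \<and> 2 \<le> mdeg Q \<and> mdeg Q \<le> 2 ^ \<nu> \<and> d = divisor \<mu> Q k' \<and> d \<noteq> 0}"

lemma omega_eq: "omega \<mu> E \<nu> = (if divisor_values \<mu> E \<nu> = {} then 1 else Min (divisor_values \<mu> E \<nu>))"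
  and finite_divisor_values: "finite (divisor_values \<mu> E \<nu>)"
proof -
  have "divisor_values \<mu> E \<nu> \<subseteq> (\<lambda>(Q, k). divisor \<mu> Q k) ` ({Q. mdeg Q \<le> 2 ^ \<nu>} \<times> UNIV)"
    by (auto simp: divisor_values_def)
  then show fin: "finite (divisor_values \<mu> E \<nu>)"
    by (rule finite_subset) (simp add: finite_mdeg_le)
  show "omega \<mu> E \<nu> = (if divisor_values \<mu> E \<nu> = {} then 1 else Min (divisor_values \<mu> E \<nu>))"
    using cInf_eq_Min[OF fin] unfolding omega_def divisor_values_def[symmetric] Let_def by simp
qed

lemma divisor_values_pos: "d \<in> divisor_values \<mu> E \<nu> \<Longrightarrow> 0 < d"
  using divisor_nonneg by (force simp: divisor_values_def less_le)

lemma omega_pos: "0 < omega \<mu> E \<nu>"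
  using divisor_values_pos Min_in[OF finite_divisor_values[of \<mu> E \<nu>]] by (auto simp: omega_eq)

lemma omega_le: "d \<in> divisor_values \<mu> E \<nu> \<Longrightarrow> omega \<mu> E \<nu> \<le> d"
  using Min_le[OF finite_divisor_values] by (auto simp: omega_eq)

lemma omega_bounded: "\<exists>K\<ge>1. \<forall>\<nu>. omega \<mu> E \<nu> \<le> K"
proof (cases "\<exists>\<nu>. divisor_values \<mu> E \<nu> \<noteq> {}")
  case False
  then show ?thesis by (auto simp: omega_eq)
next
  case True
  then obtain \<nu>0 d where d: "d \<in> divisor_values \<mu> E \<nu>0" by blast
  define K where "K = 1 + d + (\<Sum>\<nu><\<nu>0. omega \<mu> E \<nu>)"
  have S: "0 \<le> (\<Sum>\<nu><\<nu>0. omega \<mu> E \<nu>)" by (intro sum_nonneg) (auto intro: omega_pos less_imp_le)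
  have "omega \<mu> E \<nu> \<le> K" for \<nu>
  proof (cases "\<nu> < \<nu>0")
    case True
    then have "omega \<mu> E \<nu> \<le> (\<Sum>\<nu><\<nu>0. omega \<mu> E \<nu>)"
      by (intro member_le_sum) (auto intro: omega_pos less_imp_le)
    then show ?thesis using divisor_values_pos[OF d] by (simp add: K_def)
  next
    case False
    then have "(2::nat) ^ \<nu>0 \<le> 2 ^ \<nu>" by simp
    then have "d \<in> divisor_values \<mu> E \<nu>" using d order_trans unfolding divisor_values_def by blast
    then show ?thesis using omega_le[of d \<mu> E \<nu>] S by (simp add: K_def)
  qed
  moreover have "1 \<le> K" using S divisor_values_pos[OF d] by (simp add: K_def)
  ultimately show ?thesis by blast
qed

text \<open>Values of \<open>omega\<close> above 1 contribute terms of the wrong sign, but these are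
  at least \<open>- ln K / 2 ^ \<nu>\<close>, so cutting them off preserves summability.\<close>

lemma summable_min_omega:
  assumes "diophantine_over \<mu> E"
  shows "summable (\<lambda>\<nu>. - ln (min 1 (omega \<mu> E \<nu>)) / 2 ^ \<nu>)"
proof -
  obtain K where K: "K \<ge> 1" "\<And>\<nu>. omega \<mu> E \<nu> \<le> K" using omega_bounded by blast
  have "summable (\<lambda>\<nu>. ln K * (1 / 2) ^ \<nu>)" by (intro summable_mult summable_geometric) simp
  then have "summable (\<lambda>\<nu>. - ln (omega \<mu> E \<nu>) / 2 ^ \<nu> + ln K * (1 / 2) ^ \<nu>)"
    using assms unfolding diophantine_over_def by (intro summable_add)
  moreover have "norm (- ln (min 1 (omega \<mu> E \<nu>)) / 2 ^ \<nu>) \<le> - ln (omega \<mu> E \<nu>) / 2 ^ \<nu> + ln K * (1 / 2) ^ \<nu>" for \<nu>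
  proof -
    have pos: "0 < omega \<mu> E \<nu>" by (rule omega_pos)
    have "\<bar>ln (min 1 (omega \<mu> E \<nu>))\<bar> \<le> ln K - ln (omega \<mu> E \<nu>)"
      using pos K(1) K(2)[of \<nu>] by (cases "omega \<mu> E \<nu> \<le> 1") (auto simp: min_def ln_ge_zero)
    then have "\<bar>ln (min 1 (omega \<mu> E \<nu>))\<bar> / 2 ^ \<nu> \<le> (ln K - ln (omega \<mu> E \<nu>)) / 2 ^ \<nu>"
      by (rule divide_right_mono) simp
    then show ?thesis by (simp add: power_divide diff_divide_distrib)
  qed
  ultimately show ?thesis by (rule summable_comparison_test'[where N = 0])
qed

text \<open>A lower bound for the divisor at \<open>R + unit_index l\<close> concerns one pair (i,
  j), whereas smallness of a maximum holds for every pair. So the pair that realizes the lower bound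
  gives the contradiction.\<close>

lemma small_divisors_separated:
  fixes \<mu> :: "'m::finite \<Rightarrow> 'm \<Rightarrow> complex ^ 'n::finite"
  assumes \<mu>: "\<And>i j k. \<mu> i j $ k \<noteq> 0" and E: "down_closed E"
    and E_unit: "\<And>Q l. Q \<in> E \<Longrightarrow> Q l \<noteq> 0 \<Longrightarrow> Q + unit_index l \<in> E"
  obtains \<theta> where "0 < \<theta>" "\<theta> \<le> 1"
    "\<And>P Q k w m. P \<in> E \<Longrightarrow> Q \<in> E \<Longrightarrow> P \<le> Q \<Longrightarrow> P \<noteq> Q \<Longrightarrow> 0 < w \<Longrightarrow> w \<le> 1 \<Longrightarrow>
      (\<And>R l. R \<in> E \<Longrightarrow> 2 \<le> mdeg R \<Longrightarrow> mdeg R \<le> m \<Longrightarrow> w \<le> divisor \<mu> R l) \<Longrightarrow>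
      divisor \<mu> P k < \<theta> * w \<Longrightarrow> divisor \<mu> Q k < \<theta> * w \<Longrightarrow> mdeg P + m \<le> mdeg Q"
proof -
  define X where "X = range (\<lambda>(i, j, k). cmod (\<mu> i j $ k))"
  have X: "finite X" "X \<noteq> {}" "cmod (\<mu> i j $ k) \<in> X" for i j k
    unfolding X_def by (auto intro: range_eqI[of _ _ "(i, j, k)"])
  define lo hi where "lo = min 1 (Min X)" and "hi = max 1 (Max X)"
  have "0 < Min X" using Min_in[OF X(1,2)] \<mu> by (auto simp: X_def)
  then have lo: "0 < lo" "lo \<le> 1" "lo \<le> cmod (\<mu> i j $ k)" for i j k
    using Min_le[OF X(1) X(3)[of i j k]] by (auto simp: lo_def)
  have hi: "1 \<le> hi" "cmod (\<mu> i j $ k) \<le> hi" for i j k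
    using Max_ge[OF X(1) X(3)[of i j k]] by (auto simp: hi_def)
  \<comment> \<open>With this constant the power of \<open>\<mu> i j\<close> at \<open>P\<close> has
    modulus at least \<open>lo / 2\<close>, and the two small divisors give
    \<open>hi * x \<le> w / 2\<close>, against \<open>w \<le> hi * x\<close>.\<close>
  define \<theta> where "\<theta> = lo / (8 * hi)"
  have \<theta>: "0 < \<theta>" "\<theta> \<le> lo / 8" using lo hi by (auto simp: \<theta>_def field_simps mult_left_mono)
  have sep: "mdeg P + m \<le> mdeg Q"
    if P: "P \<in> E" and Q: "Q \<in> E" and le: "P \<le> Q" "P \<noteq> Q" and w: "0 < w" "w \<le> 1"
      and lower: "\<And>R l. R \<in> E \<Longrightarrow> 2 \<le> mdeg R \<Longrightarrow> mdeg R \<le> m \<Longrightarrow> w \<le> divisor \<mu> R l"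
      and small: "divisor \<mu> P k < \<theta> * w" "divisor \<mu> Q k < \<theta> * w" for P Q k w m
  proof (rule ccontr)
    assume "\<not> mdeg P + m \<le> mdeg Q"
    define R where "R = Q - P"
    have QR: "Q = P + R" unfolding R_def using le(1) by (rule le_imp_ex_plus)
    have "R \<noteq> 0" using le QR by auto
    then obtain l where l: "R l \<noteq> 0" by (auto simp: fun_eq_iff)
    have "R \<in> E" using E Q QR le_plus_fun(2)[of R P] by (auto simp: down_closed_def)
    then have "R + unit_index l \<in> E" using E_unit l by blast
    \<comment> \<open>The negated claim says \<open>mdeg R < m\<close>, so the additional variable
      keeps the degree within \<open>m\<close>.\<close>
    moreover have "2 \<le> mdeg (R + unit_index l)" "mdeg (R + unit_index l) \<le> m"
      using \<open>R \<noteq> 0\<close> mdeg_eq_0_iff[of R] \<open>\<not> mdeg P + m \<le> mdeg Q\<close> by (auto simp: mdeg_plus QR)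
    ultimately have "w \<le> divisor \<mu> (R + unit_index l) l" by (rule lower)
    then obtain i j where ij: "w \<le> cmod (mpow (\<mu> i j) (R + unit_index l) - \<mu> i j $ l)"
      using divisor_attained by metis
    define x where "x = cmod (mpow (\<mu> i j) R - 1)"
    have "mpow (\<mu> i j) (R + unit_index l) - \<mu> i j $ l = \<mu> i j $ l * (mpow (\<mu> i j) R - 1)"
      by (simp add: mpow_plus algebra_simps)
    then have "w \<le> cmod (\<mu> i j $ l) * x" using ij by (simp add: x_def norm_mult)
    also have "\<dots> \<le> hi * x" using hi by (intro mult_right_mono) (auto simp: x_def)
    finally have w_le: "w \<le> hi * x" .
    have sP: "cmod (mpow (\<mu> i j) P - \<mu> i j $ k) < \<theta> * w"
      and sQ: "cmod (mpow (\<mu> i j) Q - \<mu> i j $ k) < \<theta> * w"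
      using le_divisor small by (metis order_le_less_trans)+
    have "\<theta> * w \<le> lo / 8" using \<theta> w mult_mono[of \<theta> "lo / 8" w 1] lo by auto
    moreover have "cmod (\<mu> i j $ k) - cmod (mpow (\<mu> i j) P) \<le> cmod (mpow (\<mu> i j) P - \<mu> i j $ k)"
      using norm_triangle_ineq2[of "\<mu> i j $ k" "mpow (\<mu> i j) P"] by (simp add: norm_minus_commute)
    ultimately have "lo / 2 \<le> cmod (mpow (\<mu> i j) P)"
      using sP lo(1) lo(3)[of i j k] by linarith
    then have "lo / 2 * x \<le> cmod (mpow (\<mu> i j) P) * x" by (intro mult_right_mono) (auto simp: x_def)
    also have "\<dots> = cmod (mpow (\<mu> i j) Q - mpow (\<mu> i j) P)"
      by (simp add: x_def QR mpow_plus norm_mult[symmetric] algebra_simps)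
    also have "\<dots> \<le> 2 * (\<theta> * w)"
      using sP sQ norm_triangle_ineq4[of "mpow (\<mu> i j) Q - \<mu> i j $ k" "mpow (\<mu> i j) P - \<mu> i j $ k"]
      by simp
    finally have "hi * (lo / 2 * x) \<le> hi * (2 * (\<theta> * w))" using hi by (intro mult_left_mono) auto
    also have "\<dots> = lo / 2 * (w / 2)" using hi by (simp add: \<theta>_def)
    finally have "lo / 2 * (hi * x) \<le> lo / 2 * (w / 2)" by (simp add: mult_ac)
    then have "hi * x \<le> w / 2" using lo by (simp add: mult_le_cancel_left_pos)
    then show False using w_le w by simp
  qed
  show ?thesis by (rule that[OF \<theta>(1) _ sep]) (use \<theta> lo in auto)
qed

text \<open>Superadditivity collects the weights of the factors into one. Only the outermost
  splitting of \<open>Q\<close> is charged to \<open>h\<close>; this is where the divisor at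
  \<open>Q\<close> is paid later.\<close>

lemma sprod_weighted:
  fixes d :: "'n::finite \<Rightarrow> ('n, real) series"
  assumes d: "\<And>k Q. 0 \<le> d k Q" "\<And>k. d k 0 = 0"
    and G: "\<And>P Q. P \<noteq> 0 \<Longrightarrow> Q \<noteq> 0 \<Longrightarrow> G P + G Q \<le> G (P + Q)"
  shows "ks \<noteq> [] \<Longrightarrow> sprod d ks Q \<le> exp (G Q) * sprod (\<lambda>k Q. d k Q * exp (- G Q)) ks Q"
    and "2 \<le> length ks \<Longrightarrow> (\<And>P R. P \<noteq> 0 \<Longrightarrow> R \<noteq> 0 \<Longrightarrow> P + R = Q \<Longrightarrow> G P + G R \<le> h) \<Longrightarrow>
      sprod d ks Q \<le> exp h * sprod (\<lambda>k Q. d k Q * exp (- G Q)) ks Q"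
proof -
  let ?u = "\<lambda>k Q. d k Q * exp (- G Q)"
  have u: "0 \<le> ?u k Q" "?u k 0 = 0" for k Q using d by auto
  have step: "sprod d (k # ks) Q \<le> exp h * sprod ?u (k # ks) Q"
    if IH: "\<And>Q. sprod d ks Q \<le> exp (G Q) * sprod ?u ks Q" and ne: "ks \<noteq> []"
      and h: "\<And>P R. P \<noteq> 0 \<Longrightarrow> R \<noteq> 0 \<Longrightarrow> P + R = Q \<Longrightarrow> G P + G R \<le> h" for k ks Q h
  proof -
    have "d k P * sprod d ks (Q - P) \<le> exp h * (?u k P * sprod ?u ks (Q - P))" if P: "P \<le> Q" for P
    proof -
      consider "P = 0" | "P = Q" | "P \<noteq> 0" "P \<noteq> Q" by blast
      then show ?thesis
      proof cases
        case 2
        then have "sprod d ks (Q - P) = 0" "sprod ?u ks (Q - P) = 0"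
          using ne d u by (auto intro!: sprod_eq_0 simp: fun_diff_def simp flip: zero_fun_def)
        then show ?thesis by simp
      next
        case 3
        have "Q - P \<noteq> 0" using 3 P by (metis add.right_neutral le_imp_ex_plus)
        then have Gh: "G P + G (Q - P) \<le> h" using h[of P "Q - P"] 3 P by (simp add: le_imp_ex_plus[symmetric])
        have "d k P * sprod d ks (Q - P) \<le> d k P * (exp (G (Q - P)) * sprod ?u ks (Q - P))"
          using d IH by (intro mult_left_mono)
        also have "\<dots> = exp (G P + G (Q - P)) * (?u k P * sprod ?u ks (Q - P))"
          by (simp add: exp_add exp_minus field_simps)
        also have "\<dots> \<le> exp h * (?u k P * sprod ?u ks (Q - P))"
          using Gh d by (intro mult_right_mono mult_nonneg_nonneg u sprod_nonneg) auto
        finally show ?thesis .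
      qed (use d in simp)
    qed
    then show ?thesis by (auto simp: smul_def sum_distrib_left intro!: sum_mono)
  qed
  have main: "ks \<noteq> [] \<Longrightarrow> sprod d ks Q \<le> exp (G Q) * sprod ?u ks Q" for ks Q
  proof (induction ks arbitrary: Q)
    case (Cons k ks)
    show ?case
    proof (cases "ks = []")
      case True
      then show ?thesis by (simp add: exp_minus field_simps)
    next
      case False
      then show ?thesis using Cons.IH by (intro step) (auto intro: G)
    qed
  qed simp
  then show "ks \<noteq> [] \<Longrightarrow> sprod d ks Q \<le> exp (G Q) * sprod ?u ks Q" .
  assume "2 \<le> length ks" and h: "\<And>P R. P \<noteq> 0 \<Longrightarrow> R \<noteq> 0 \<Longrightarrow> P + R = Q \<Longrightarrow> G P + G R \<le> h"
  then obtain k ls where "ks = k # ls" "ls \<noteq> []" by (cases ks; cases "tl ks") auto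
  then show "sprod d ks Q \<le> exp h * sprod ?u ks Q" using step[of ls Q h k] main[of ls] h by simp
qed

text \<open>The weighted moduli \<open>u\<close> satisfy the hypothesis of
  \<open>majorant_convergence\<close>: the divisor at \<open>Q\<close> cancels against the allowance
  in the weight at the outermost splitting of \<open>Q\<close>.\<close>

theorem small_divisor_convergence:
  fixes \<mu> :: "'m::finite \<Rightarrow> 'm \<Rightarrow> complex ^ 'n::finite" and \<Phi> :: "'n fmap"
  assumes \<mu>: "\<And>i j k. \<mu> i j $ k \<noteq> 0" and E: "down_closed E"
    and E_unit: "\<And>Q l. Q \<in> E \<Longrightarrow> Q l \<noteq> 0 \<Longrightarrow> Q + unit_index l \<in> E"
    and EE': "E \<subseteq> E'" and dioph: "diophantine_over \<mu> E'"
    and nonres: "\<And>Q k. Q \<in> E \<Longrightarrow> 2 \<le> mdeg Q \<Longrightarrow> divisor \<mu> Q k \<noteq> 0"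
    and f: "\<And>i j k. convergent_series (f i j k)"
    and \<Phi>: "tangent_to_id \<Phi>"
    and rec: "\<And>Q i j k. Q \<in> E \<Longrightarrow> 2 \<le> mdeg Q \<Longrightarrow>
      (mpow (\<mu> i j) Q - \<mu> i j $ k) * \<Phi> k Q = nonlin (f i j k) \<Phi> Q"
  shows "convergent_series (\<lambda>Q. if Q \<in> E then \<Phi> k Q else 0)"
proof -
  \<comment> \<open>The nonzero divisors over \<open>E\<close> are among the values over
    \<open>E'\<close>, so \<open>omega\<close> bounds them from below. The cap at 1 makes every
    logarithmic cost nonnegative.\<close>
  define w where "w = (\<lambda>\<nu>. min 1 (omega \<mu> E' \<nu>))"
  have w: "0 < w \<nu>" "w \<nu> \<le> 1" for \<nu> using omega_pos[of \<mu> E' \<nu>] by (auto simp: w_def)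
  have lower: "w \<nu> \<le> divisor \<mu> Q k" if "Q \<in> E" "2 \<le> mdeg Q" "mdeg Q \<le> 2 ^ \<nu>" for Q \<nu> k
  proof -
    have "divisor \<mu> Q k \<in> divisor_values \<mu> E' \<nu>"
      using that nonres[of Q k] EE' by (auto simp: divisor_values_def)
    from omega_le[OF this] show ?thesis by (simp add: w_def)
  qed
  have "\<exists>\<theta>. 0 < \<theta> \<and> \<theta> \<le> 1 \<and> (\<forall>P Q k \<nu>. P \<in> E \<longrightarrow> Q \<in> E \<longrightarrow> P \<le> Q \<longrightarrow> P \<noteq> Q \<longrightarrow>
    divisor \<mu> P k < \<theta> * w \<nu> \<longrightarrow> divisor \<mu> Q k < \<theta> * w \<nu> \<longrightarrow> mdeg P + 2 ^ \<nu> \<le> mdeg Q)"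
  proof (rule small_divisors_separated[of \<mu> E], goal_cases)
    case (4 \<theta>)
    show ?case
    proof (rule exI[of _ \<theta>], intro conjI allI impI)
      fix P Q k \<nu> assume "P \<in> E" "Q \<in> E" "P \<le> Q" "P \<noteq> Q"
        "divisor \<mu> P k < \<theta> * w \<nu>" "divisor \<mu> Q k < \<theta> * w \<nu>"
      then show "mdeg P + 2 ^ \<nu> \<le> mdeg Q"
        using 4(3)[of P Q "w \<nu>" "2 ^ \<nu>" k] w lower by simp
    qed (fact 4)+
  qed (fact \<mu> E E_unit)+
  then obtain \<theta> where \<theta>: "0 < \<theta>" "\<theta> \<le> 1" and
    sep: "\<And>P Q k \<nu>. P \<in> E \<Longrightarrow> Q \<in> E \<Longrightarrow> P \<le> Q \<Longrightarrow> P \<noteq> Q \<Longrightarrow>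
      divisor \<mu> P k < \<theta> * w \<nu> \<Longrightarrow> divisor \<mu> Q k < \<theta> * w \<nu> \<Longrightarrow> mdeg P + 2 ^ \<nu> \<le> mdeg Q"
    by blast
  have sep': "mdeg P + 2 ^ \<nu> \<le> mdeg Q" if "P \<in> E" "Q \<in> E" "2 \<le> mdeg P" "2 \<le> mdeg Q" "P \<le> Q" "P \<noteq> Q"
    "divisor \<mu> P k < \<theta> * w \<nu>" "divisor \<mu> Q k < \<theta> * w \<nu>" for P Q k \<nu>
    using sep that by blast
  have "\<exists>(G :: ('n \<Rightarrow> nat) \<Rightarrow> real) (K :: real). (\<forall>Q. 0 \<le> G Q) \<and> (\<forall>Q. G Q \<le> K * mdeg Q) \<and>
    (\<forall>P Q. P \<noteq> 0 \<longrightarrow> Q \<noteq> 0 \<longrightarrow> G P + G Q \<le> G (P + Q)) \<and>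
    (\<forall>P Q k. P \<noteq> 0 \<longrightarrow> Q \<noteq> 0 \<longrightarrow> P + Q \<in> E \<longrightarrow> G P + G Q \<le> G (P + Q) + ln (divisor \<mu> (P + Q) k))"
  proof (rule brjuno_weight[of w \<theta> E "divisor \<mu>"], goal_cases)
    case (8 G K)
    show ?case
    proof (rule exI[of _ G], rule exI[of _ K], intro conjI allI impI)
      fix P Q :: "'n \<Rightarrow> nat" and k assume "P \<noteq> 0" "Q \<noteq> 0"
      then show "G P + G Q \<le> G (P + Q)" by (rule 8(3))
      assume "P + Q \<in> E"
      with \<open>P \<noteq> 0\<close> \<open>Q \<noteq> 0\<close> show "G P + G Q \<le> G (P + Q) + ln (divisor \<mu> (P + Q) k)" by (rule 8(4))
    qed (fact 8(1,2))+
  next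
    case 7
    show ?case unfolding w_def by (rule summable_min_omega[OF dioph])
  qed (fact w \<theta> | rule lower sep'; assumption)+
  then obtain G :: "('n \<Rightarrow> nat) \<Rightarrow> real" and K :: real where GK:
    "\<forall>Q. 0 \<le> G Q" "\<forall>Q. G Q \<le> K * mdeg Q" "\<forall>P Q. P \<noteq> 0 \<longrightarrow> Q \<noteq> 0 \<longrightarrow> G P + G Q \<le> G (P + Q)"
    "\<forall>P Q k. P \<noteq> 0 \<longrightarrow> Q \<noteq> 0 \<longrightarrow> P + Q \<in> E \<longrightarrow> G P + G Q \<le> G (P + Q) + ln (divisor \<mu> (P + Q) k)"
    by (elim exE conjE) (rule that)
  note G = GK(1,2)[rule_format] GK(3,4)[rule_format]
  define d where "d = (\<lambda>k Q. if Q \<in> E then cmod (\<Phi> k Q) else 0)"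
  define u where "u = (\<lambda>k Q. d k Q * exp (- G Q))"
  \<comment> \<open>The pair attaining the divisor varies with \<open>Q\<close>; summing over all
    pairs gives one majorant for every choice.\<close>
  define a where "a = (\<lambda>k P. \<Sum>i\<in>UNIV. \<Sum>j\<in>UNIV. cmod (f i j k P))"
  have d: "0 \<le> d k Q" "d k 0 = 0" for k Q by (auto simp: d_def tangent_to_id_coeff[OF \<Phi>])
  have d_sprod: "sprod (\<lambda>k Q. cmod (\<Phi> k Q)) ks Q = sprod d ks Q" if "Q \<in> E" for ks Q
    using that E by (intro sprod_cong_le) (auto simp: d_def down_closed_def)
  obtain \<rho> where \<rho>: "\<rho> > 0" "\<And>x. absconv (case x of (i, j, k) \<Rightarrow> f i j k) \<rho>"
    using common_absconv_radius[of "\<lambda>(i, j, k). f i j k"] f by (auto split: prod.splits)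
  have a_conv: "absconv (a k) \<rho>" for k
    unfolding a_def using \<rho>(1) \<rho>(2)[of "(_, _, k)"] by (intro absconv_sum) (auto simp: absconv_def)
  have u_rec: "u k Q \<le> (\<Sum>P | 2 \<le> mdeg P \<and> mdeg P \<le> mdeg Q. a k P * sprod u (index_list P) Q)"
    if Q2: "2 \<le> mdeg Q" for k Q
  proof (cases "Q \<in> E")
    case False
    have "0 \<le> a k P * sprod u (index_list P) Q" for P
      using d unfolding a_def by (intro mult_nonneg_nonneg sprod_nonneg sum_nonneg) (auto simp: u_def)
    then show ?thesis using False by (auto simp: u_def d_def intro: sum_nonneg)
  next
    case True
    obtain i j where ij: "divisor \<mu> Q k = cmod (mpow (\<mu> i j) Q - \<mu> i j $ k)"
      using divisor_attained[of \<mu> Q k] by blast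
    define \<delta> where "\<delta> = divisor \<mu> Q k"
    have \<delta>: "\<delta> > 0" using nonres[OF True Q2, of k] divisor_nonneg[of \<mu> Q k] by (simp add: \<delta>_def)
    let ?D = "{P :: 'n \<Rightarrow> nat. 2 \<le> mdeg P \<and> mdeg P \<le> mdeg Q}"
    have "\<delta> * d k Q = cmod (nonlin (f i j k) \<Phi> Q)"
      using True rec[OF True Q2, of i j k] by (simp add: d_def \<delta>_def ij norm_mult[symmetric])
    also have "\<dots> \<le> (\<Sum>P\<in>?D. cmod (f i j k P) * sprod (\<lambda>k Q. cmod (\<Phi> k Q)) (index_list P) Q)"
      by (rule norm_nonlin_le)
    also have "\<dots> \<le> (\<Sum>P\<in>?D. a k P * (exp (G Q + ln \<delta>) * sprod u (index_list P) Q))"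
    proof (rule sum_mono)
      fix P assume P: "P \<in> ?D"
      have "cmod (f i j k P) \<le> (\<Sum>j\<in>UNIV. cmod (f i j k P))" by (rule member_le_sum) auto
      also have "\<dots> \<le> a k P"
        unfolding a_def by (rule member_le_sum[where f = "\<lambda>i. \<Sum>j\<in>UNIV. cmod (f i j k P)"]) (auto intro: sum_nonneg)
      finally have 1: "cmod (f i j k P) \<le> a k P" .
      have "sprod d (index_list P) Q \<le> exp (G Q + ln \<delta>) * sprod u (index_list P) Q"
        unfolding u_def
      proof (rule sprod_weighted(2)[of d G])
        fix P R :: "'n \<Rightarrow> nat" assume "P \<noteq> 0" "R \<noteq> 0" "P + R = Q"
        then show "G P + G R \<le> G Q + ln \<delta>" using G(4)[of P R k] True by (simp add: \<delta>_def)
      qed (use P d G(3) in auto)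
      then show "cmod (f i j k P) * sprod (\<lambda>k Q. cmod (\<Phi> k Q)) (index_list P) Q
          \<le> a k P * (exp (G Q + ln \<delta>) * sprod u (index_list P) Q)"
        unfolding d_sprod[OF True] by (intro mult_mono 1 sprod_nonneg d) (auto simp: a_def intro!: sum_nonneg)
    qed
    also have "\<dots> = \<delta> * (exp (G Q) * (\<Sum>P\<in>?D. a k P * sprod u (index_list P) Q))"
      using \<delta> by (simp add: exp_add sum_distrib_left mult_ac)
    finally have "d k Q \<le> exp (G Q) * (\<Sum>P\<in>?D. a k P * sprod u (index_list P) Q)"
      using \<delta> by (simp add: mult_le_cancel_left_pos)
    then show ?thesis by (simp add: u_def exp_minus field_simps)
  qed
  have "\<exists>t>0. \<forall>k. absconv (u k) t"
  proof (rule majorant_convergence[OF _ _ _ _ a_conv \<rho>(1) u_rec])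
    show "u k (unit_index l) \<le> 1" for k l
    proof -
      have "d k (unit_index l) \<le> 1" by (auto simp: d_def tangent_to_id_coeff[OF \<Phi>])
      then show ?thesis using mult_mono[of "d k (unit_index l)" 1 "exp (- G (unit_index l))" 1] G(1) d
        by (simp add: u_def)
    qed
  qed (auto simp: u_def d a_def intro!: sum_nonneg)
  then obtain t where t: "t > 0" "\<And>k. absconv (u k) t" by blast
  \<comment> \<open>Removing the weight costs a factor \<open>exp K\<close> per degree, by the
    linear bound on \<open>G\<close>.\<close>
  define s where "s = t * exp (- K)"
  have s: "s > 0" using t by (simp add: s_def)
  have "absconv (\<lambda>Q. if Q \<in> E then \<Phi> k Q else 0) s"
    unfolding absconv_def
  proof (rule summable_on_comparison_test[OF t(2)[of k, unfolded absconv_def]])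
    fix Q
    have "exp (G Q) * s ^ mdeg Q \<le> exp (K * mdeg Q) * s ^ mdeg Q"
      using G(2)[of Q] s by (intro mult_right_mono) auto
    also have "\<dots> = t ^ mdeg Q"
      by (simp add: s_def power_mult_distrib exp_of_nat_mult[symmetric] exp_minus field_simps)
    finally have "u k Q * (exp (G Q) * s ^ mdeg Q) \<le> u k Q * t ^ mdeg Q"
      using d by (intro mult_left_mono) (auto simp: u_def)
    moreover have "norm (if Q \<in> E then \<Phi> k Q else 0) = u k Q * exp (G Q)"
      by (simp add: u_def d_def exp_minus)
    ultimately show "norm (if Q \<in> E then \<Phi> k Q else 0) * s ^ mdeg Q \<le> norm (u k Q) * t ^ mdeg Q"
      using d by (simp add: u_def mult.assoc)
  qed (use s in auto)
  then show ?thesis using s by (auto simp: convergent_series_iff)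
qed

section \<open>The linearization on the ideal\<close>

lemma fsubst_unit_index:
  "fsubst c (\<lambda>k Q. if Q = 0 then 0 else d k Q) (unit_index l) = (\<Sum>k\<in>UNIV. c (unit_index k) * d k (unit_index l))"
  by (simp add: fsubst_split nonlin_deg_less_2)

lemma has_expansion_linear: "has_expansion (\<lambda>z. (A *v z) $ k) 0 (linear_fmap A k)"
  unfolding has_expansion_iff by (auto simp: seval_linear_fmap intro: exI[of _ 1])

lemma has_expansion_comp0:
  assumes "has_expansion f 0 c" "\<And>k. has_expansion (\<lambda>z. g z $ k) 0 (d k)" "g 0 = 0"
  shows "has_expansion (\<lambda>z. f (g z)) 0 (fsubst c (\<lambda>k Q. if Q = 0 then 0 else d k Q))"
  using assms by (intro has_expansion_compose) auto

section \<open>Conjugation, limits at 0, and series restricted to the zero set\<close>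

lemma cnj_vec_mult: "cnj_vec (A *v z) = map_matrix cnj A *v cnj_vec z"
  by (simp add: cnj_vec_def matrix_vector_mult_def vec_eq_iff)

lemma cnj_vec_cnj_vec [simp]: "cnj_vec (cnj_vec z) = z"
  by (simp add: cnj_vec_def vec_eq_iff)

lemma cnj_vec_0 [simp]: "cnj_vec 0 = 0"
  by (simp add: cnj_vec_def vec_eq_iff)

lemma cnj_vec_nth: "cnj_vec z $ k = cnj (z $ k)"
  by (simp add: cnj_vec_def)

lemma isCont_nhds: "isCont f x \<Longrightarrow> filterlim f (nhds (f x)) (nhds x)"
  by (simp add: isCont_def tendsto_at_iff_tendsto_nhds)

lemma tendsto_cnj_vec: "filterlim (\<lambda>z. A *v cnj_vec z) (nhds 0) (nhds (0 :: complex ^ 'n::finite))"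
proof -
  have "continuous_on UNIV (cnj_vec :: complex ^ 'n \<Rightarrow> complex ^ 'n)"
    unfolding cnj_vec_def by (intro continuous_intros)
  then have "continuous_on UNIV (\<lambda>z :: complex ^ 'n. A *v cnj_vec z)"
    by (intro continuous_on_compose2[OF linear_continuous_on[OF matrix_vector_mul_bounded_linear[of A]]]) auto
  then have "isCont (\<lambda>z :: complex ^ 'n. A *v cnj_vec z) 0" by (simp add: continuous_on_eq_continuous_at)
  from isCont_nhds[OF this] show ?thesis by simp
qed

lemma eventually_compose0:
  assumes "filterlim g (nhds 0) (nhds 0)" "eventually P (nhds 0)"
  shows "eventually (\<lambda>z. P (g z)) (nhds 0)"
  using assms by (simp add: filterlim_iff)

lemma eventually_all_nhds:
  fixes P :: "'i::finite \<Rightarrow> 'a::topological_space \<Rightarrow> bool"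
  assumes "\<And>i. eventually (P i) (nhds x)"
  shows "eventually (\<lambda>z. \<forall>i. P i z) (nhds x)"
  using assms eventually_ball_finite_distrib[of UNIV "\<lambda>z i. P i z" "nhds x"] by simp

lemma diag_mat_mult: "diag_mat d *v z = (\<chi> k. d $ k * z $ k)"
  by (simp add: diag_mat_def matrix_vector_mult_def vec_eq_iff if_distrib[where f = "\<lambda>x. x * _"] cong: if_cong)

lemma mpow_diag: "mpow (diag_mat d *v z) Q = mpow d Q * mpow z Q"
  by (simp add: diag_mat_mult mpow_def power_mult_distrib prod.distrib)

text \<open>The zero set contains the coordinate subspace of the support of \<open>Q\<close>, and
  there the identity theorem isolates this coefficient.\<close>

lemma coeff_eq_on_support:
  assumes c: "convergent_series c" and d: "convergent_series d"
    and eq: "\<forall>\<^sub>F z in nhds 0. z \<in> zero_locus I \<longrightarrow> seval c z = seval d z"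
    and Q: "Q \<in> support_set (zero_locus I)"
  shows "c Q = d Q"
proof -
  obtain r s t where r: "r > 0" "absconv c r" and s: "s > 0" "absconv d s"
    and t: "t > 0" "\<And>z. z \<in> polydisc t \<Longrightarrow> z \<in> zero_locus I \<Longrightarrow> seval c z = seval d z"
    using c d eq unfolding convergent_series_iff eventually_polydisc by metis
  define m where "m = min t (min r s)"
  have m: "m > 0" "absconv c m" "absconv d m" "polydisc m \<subseteq> polydisc t"
    using r s t by (auto simp: m_def intro: absconv_mono intro!: polydisc_mono)
  have "c Q + (- 1) * d Q = 0"
  proof (rule seval_eq_0_on_subspace_imp[where K = "{k. Q k \<noteq> 0}" and r = m])
    show "absconv (\<lambda>Q. c Q + (- 1) * d Q) m" using m by (intro absconv_add absconv_cmult) auto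
    fix z assume z: "z \<in> polydisc m" and "\<And>k. k \<notin> {k. Q k \<noteq> 0} \<Longrightarrow> z $ k = 0"
    then have "z \<in> zero_locus I" using zero_locus_subspace[OF Q, of z] by simp
    moreover have "z \<in> polydisc t" using z m by blast
    ultimately have "seval c z = seval d z" by (rule t(2)[rotated])
    moreover have "seval (\<lambda>Q. c Q + (- 1) * d Q) z = seval c z + seval (\<lambda>Q. (- 1) * d Q) z"
      using m z by (intro seval_add[of _ m] absconv_cmult)
    ultimately show "seval (\<lambda>Q. c Q + (- 1) * d Q) z = 0"
      using seval_cmult[of "- 1" d z] by simp
  qed (use m in auto)
  then show ?thesis by simp
qed

lemma seval_eq_on_zero_locus:
  assumes "\<And>Q. Q \<in> support_set Z \<Longrightarrow> c Q = d Q" "z \<in> Z"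
  shows "seval c z = seval d z"
proof -
  have "c Q * mpow z Q = d Q * mpow z Q" for Q
    using assms by (cases "mpow z Q = 0") (auto simp: support_set_def)
  then show ?thesis unfolding seval_def by (intro infsum_cong)
qed

lemma convergent_diag: "convergent_series c \<Longrightarrow> convergent_series (\<lambda>Q. c Q * mpow \<mu> Q)"
  and seval_diag: "seval (\<lambda>Q. c Q * mpow \<mu> Q) z = seval c (diag_mat \<mu> *v z)"
  for \<mu> :: "complex ^ 'n::finite"
proof -
  show "seval (\<lambda>Q. c Q * mpow \<mu> Q) z = seval c (diag_mat \<mu> *v z)"
    by (simp add: seval_def mpow_diag mult.assoc)
  assume "convergent_series c"
  then obtain r where r: "r > 0" "absconv c r" by (auto simp: convergent_series_iff)
  define s where "s = norm \<mu> + 1"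
  have s: "s > 0" by (simp add: s_def add_nonneg_pos)
  have "\<mu> \<in> polydisc s"
    using Finite_Cartesian_Product.norm_nth_le[of \<mu>] by (auto simp: polydisc_def s_def intro: order_trans add_increasing2)
  then have le: "norm (mpow \<mu> Q) \<le> s ^ mdeg Q" for Q by (rule norm_mpow_le)
  have "absconv (\<lambda>Q. c Q * mpow \<mu> Q) (r / s)"
    unfolding absconv_def
  proof (rule summable_on_comparison_test[OF r(2)[unfolded absconv_def]])
    fix Q
    have "norm (c Q) * norm (mpow \<mu> Q) * (r / s) ^ mdeg Q \<le> norm (c Q) * s ^ mdeg Q * (r / s) ^ mdeg Q"
      using r s by (intro mult_right_mono mult_left_mono le) auto
    also have "\<dots> = norm (c Q) * r ^ mdeg Q" using s by (simp add: power_divide)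
    finally show "norm (c Q * mpow \<mu> Q) * (r / s) ^ mdeg Q \<le> norm (c Q) * r ^ mdeg Q"
      by (simp add: norm_mult)
  qed (use r s in auto)
  then show "convergent_series (\<lambda>Q. c Q * mpow \<mu> Q)" using r s by (auto simp: convergent_series_iff intro!: exI[of _ "r / s"])
qed

text \<open>The two arithmetic alternatives are merged into \<open>dioph\<close>: a condition over
  some set of exponents that contains all those outside the ideal.\<close>

locale linearizable_family =
  fixes B :: "'m::finite \<Rightarrow> complex ^ 'n ^ 'n::finite"
    and R \<rho> :: "'m \<Rightarrow> complex ^ 'n \<Rightarrow> complex ^ 'n"
    and F :: "'m \<Rightarrow> 'm \<Rightarrow> complex ^ 'n \<Rightarrow> complex ^ 'n"
    and \<mu> :: "'m \<Rightarrow> 'm \<Rightarrow> complex ^ 'n"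
    and I :: "'n fseries set"
  assumes R: "\<And>i. holo_map_at (R i) 0" "\<And>i. R i 0 = 0" "\<And>i. (R i has_derivative (\<lambda>_. 0)) (at 0)"
    and B: "\<And>i. B i ** map_matrix cnj (B i) = mat 1"
    and rho: "\<And>i z. \<rho> i z = B i *v cnj_vec z + R i (cnj_vec z)"
    and F: "\<And>i j. F i j = \<rho> i \<circ> \<rho> j"
    and linear_part: "\<And>i j. (F i j has_derivative (\<lambda>v. diag_mat (\<mu> i j) *v v)) (at 0)"
    and I: "monomial_ideal I"
    and inv_B: "\<And>i. left_invariant I (B i)"
    and dioph: "\<exists>E. {Q. mono_series Q \<notin> I} \<subseteq> E \<and> diophantine_over \<mu> E"
    and nonres: "non_resonant_on \<mu> I"
    and formal_lin: "formally_linearizable_on F \<mu> I"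
begin

abbreviation Z where "Z \<equiv> zero_locus I"
abbreviation E where "E \<equiv> support_set Z"

text \<open>The holomorphic factor of the involution, \<open>\<rho> i = h i \<circ> cnj_vec\<close>;
  power series are available for it and not for \<open>\<rho> i\<close>.\<close>

definition h where "h i w = B i *v w + R i w"

lemma rho_h: "\<rho> i z = h i (cnj_vec z)"
  by (simp add: rho h_def)

lemma h_0: "h i 0 = 0"
  by (simp add: h_def R)

lemma rho_0: "\<rho> i 0 = 0"
  by (simp add: rho_h h_0)

lemma h_expansion:
  obtains H where "\<And>i k. has_expansion (\<lambda>w. h i w $ k) 0 (H i k)"
    "\<And>i k. H i k 0 = 0" "\<And>i k l. H i k (unit_index l) = B i $ k $ l"
proof -
  obtain c where c: "\<And>i k. has_expansion (\<lambda>z. R i z $ k) 0 (c i k)"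
    using R(1) unfolding holo_map_at_def holo_at_def by metis
  have c1: "c i k (unit_index l) = 0" for i k l
    using has_expansion_linear_part[OF c, of i 0 k l] R(3) by simp
  define H where "H i k Q = linear_fmap (B i) k Q + c i k Q" for i k Q
  have 1: "has_expansion (\<lambda>w. h i w $ k) 0 (H i k)" for i k
    unfolding H_def[abs_def] h_def vector_add_component
    by (intro has_expansion_add has_expansion_linear c)
  show ?thesis
    by (rule that[OF 1]) (auto simp: has_expansion_value[OF 1] h_0, simp add: H_def linear_fmap_coeff(2) c1)
qed

lemma F_h: "F i j z = h i (cnj_vec (h j (cnj_vec z)))"
  by (simp add: F rho_h)

text \<open>The first order coefficients are computed twice, from the derivative and from the
  composition of \<open>h i\<close> with the conjugate of \<open>h j\<close>; the comparison yields
  the matrix identity.\<close>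

lemma F_expansion:
  obtains f where "\<And>i j k. has_expansion (\<lambda>z. F i j z $ k) 0 (f i j k)" "\<And>i j. taylor_map (F i j) = f i j"
    "\<And>i j k. f i j k 0 = 0" "\<And>i j k l. f i j k (unit_index l) = diag_mat (\<mu> i j) $ k $ l"
    "\<And>i j. diag_mat (\<mu> i j) = B i ** map_matrix cnj (B j)"
proof -
  obtain H where H: "\<And>i k. has_expansion (\<lambda>w. h i w $ k) 0 (H i k)"
    "\<And>i k. H i k 0 = 0" "\<And>i k l. H i k (unit_index l) = B i $ k $ l"
    using h_expansion by metis
  define f where "f i j k = fsubst (H i k) (\<lambda>l Q. if Q = 0 then 0 else cnj (H j l Q))" for i j k
  have 1: "has_expansion (\<lambda>z. F i j z $ k) 0 (f i j k)" for i j k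
    unfolding F_h f_def
    by (rule has_expansion_comp0[OF H(1)]) (use has_expansion_cnj[OF H(1)] in \<open>simp_all add: cnj_vec_nth h_0\<close>)
  have 2: "f i j k (unit_index l) = diag_mat (\<mu> i j) $ k $ l" for i j k l
    by (rule has_expansion_linear_part[OF 1 linear_part])
  have "diag_mat (\<mu> i j) $ k $ l = (B i ** map_matrix cnj (B j)) $ k $ l" for i j k l
    unfolding 2[symmetric] f_def fsubst_unit_index by (simp add: H(3) matrix_matrix_mult_def)
  then have 3: "diag_mat (\<mu> i j) = B i ** map_matrix cnj (B j)" for i j
    by (simp add: vec_eq_iff)
  show ?thesis
    by (rule that[OF 1 taylor_map_eq[OF 1] _ 2 3]) (unfold has_expansion_value[OF 1], simp add: F_h h_0)
qed

lemma D_eq: "diag_mat (\<mu> i j) = B i ** map_matrix cnj (B j)"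
  using F_expansion by metis

lemma B': "map_matrix cnj (B i) ** B i = mat 1"
  using B[of i] by (simp add: matrix_left_right_inverse)

lemma B_cancel [simp]: "B i *v (map_matrix cnj (B i) *v z) = z" "map_matrix cnj (B i) *v (B i *v z) = z"
  by (simp_all add: matrix_vector_mul_assoc B B')

lemma D_mult: "diag_mat (\<mu> i j) *v z = B i *v (map_matrix cnj (B j) *v z)"
  by (simp add: D_eq matrix_vector_mul_assoc)

lemma mu_inverse: "\<mu> i j $ k * \<mu> j i $ k = 1"
proof -
  have "diag_mat (\<mu> i j) *v (diag_mat (\<mu> j i) *v axis k 1) = axis k 1"
    by (simp add: D_mult)
  then have "(diag_mat (\<mu> i j) *v (diag_mat (\<mu> j i) *v axis k 1)) $ k = 1"
    by (simp add: axis_def)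
  then show ?thesis by (simp add: diag_mat_mult axis_def)
qed

lemma mu_nonzero: "\<mu> i j $ k \<noteq> 0"
  using mu_inverse[of i j k] by auto

text \<open>The linear part of \<open>\<rho> i\<close>, an anti-linear involution whose fixed points
  form the tangent space of the i-th submanifold.\<close>

definition reflection where "reflection i z = B i *v cnj_vec z"

lemma reflection_reflection [simp]: "reflection i (reflection i z) = z"
  by (simp add: reflection_def cnj_vec_mult)

text \<open>The linear counterpart of
  \<open>\<rho> i \<circ> F i j = F j i \<circ> \<rho> i\<close>; both sides reduce to
  \<open>B j *v cnj_vec z\<close>.\<close>

lemma reflection_D: "reflection i (diag_mat (\<mu> i j) *v z) = diag_mat (\<mu> j i) *v reflection i z"
proof -
  have "map_matrix cnj (map_matrix cnj A) = A" for A :: "complex ^ 'n ^ 'n"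
    by (simp add: vec_eq_iff)
  then show ?thesis by (simp add: reflection_def D_mult cnj_vec_mult)
qed

lemma reflection_Z: "z \<in> Z \<Longrightarrow> reflection i z \<in> Z"
  unfolding reflection_def by (intro zero_locus_invariant[OF I inv_B] zero_locus_cnj)

lemma tendsto_reflection: "filterlim (reflection i) (nhds 0) (nhds 0)"
  unfolding reflection_def[abs_def] by (rule tendsto_cnj_vec)

text \<open>\<open>B i\<close> intertwines \<open>cnj (\<mu> i j)\<close> with \<open>\<mu> j i = inverse (\<mu> i j)\<close>, so non-resonance of \<open>M\<close> is
  non-resonance of \<open>D\<close>, and a single row \<open>\<mu> i\<close> suffices.\<close>

lemma mu_cnj: "\<exists>k. \<forall>j. cnj (\<mu> i j $ l) = inverse (\<mu> i j $ k)"
proof -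
  have "\<exists>k. B i $ k $ l \<noteq> 0"
  proof (rule ccontr)
    assume "\<nexists>k. B i $ k $ l \<noteq> 0"
    then have "B i *v axis l 1 = 0"
      by (simp add: vec_eq_iff matrix_vector_mult_def axis_def if_distrib[where f = "\<lambda>x. _ * x"] cong: if_cong)
    then have "axis l 1 = (0 :: complex ^ 'n)" using B_cancel(2)[of i "axis l 1"] by simp
    then show False by (simp add: axis_eq_0_iff)
  qed
  \<comment> \<open>\<open>reflection i\<close> maps the axis vector \<open>l\<close> to column
    \<open>l\<close> of \<open>B i\<close>. Comparing eigenvalues at one nonzero entry gives the
    same \<open>k\<close> for every \<open>j\<close>.\<close>
  then obtain k where k: "B i $ k $ l \<noteq> 0" by blast
  have "cnj (\<mu> i j $ l) = inverse (\<mu> i j $ k)" for j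
  proof -
    have axis: "reflection i (\<chi> p. a p * axis l 1 $ p) $ k = cnj (a l) * B i $ k $ l" for a
    proof -
      have "reflection i (\<chi> p. a p * axis l 1 $ p) $ k = (\<Sum>p\<in>UNIV. if p = l then cnj (a l) * B i $ k $ l else 0)"
        unfolding reflection_def matrix_vector_mult_def cnj_vec_def vec_lambda_beta
        by (rule sum.cong) (auto simp: axis_def)
      then show ?thesis by simp
    qed
    have "reflection i (diag_mat (\<mu> i j) *v axis l 1) $ k = cnj (\<mu> i j $ l) * B i $ k $ l"
      unfolding diag_mat_mult by (rule axis)
    moreover have "(diag_mat (\<mu> j i) *v reflection i (axis l 1)) $ k = \<mu> j i $ k * B i $ k $ l"
      using axis[of "\<lambda>_. 1"] by (simp add: diag_mat_mult)
    ultimately have "cnj (\<mu> i j $ l) = \<mu> j i $ k" using reflection_D[of i j "axis l 1"] k by simp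
    then show ?thesis using mu_inverse[of i j k] by (simp add: inverse_unique)
  qed
  then show ?thesis by blast
qed

text \<open>For the component \<open>l\<close> the hypothesis is applied with the index
  \<open>k\<close> matched to it by \<open>mu_cnj\<close>; conjugating the inequality gives the
  claim.\<close>

lemma nonresonant:
  assumes "Q \<in> E" "2 \<le> mdeg Q"
  shows "\<exists>j. mpow (\<mu> i j) Q \<noteq> \<mu> i j $ l"
proof -
  obtain k where k: "\<And>j. cnj (\<mu> i j $ l) = inverse (\<mu> i j $ k)" using mu_cnj by blast
  have "mono_series Q \<notin> I" using assms(1) mono_in_ideal_not_support by blast
  then obtain j where "cnj (mpow (\<mu> i j) Q) \<noteq> inverse (\<mu> i j $ k)"
    using nonres assms(2) unfolding non_resonant_on_def by blast
  then show ?thesis using k[of j] by (metis)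
qed

lemma divisor_nonzero: "Q \<in> E \<Longrightarrow> 2 \<le> mdeg Q \<Longrightarrow> divisor \<mu> Q k \<noteq> 0"
  using nonresonant[of Q undefined k] le_divisor[of \<mu> undefined _ Q k] by (metis norm_le_zero_iff right_minus_eq)

lemma holomorphic_linearization:
  obtains \<Phi> f where "tangent_to_id \<Phi>" "\<And>k. convergent_series (\<Phi> k)"
    "\<And>i j k. has_expansion (\<lambda>z. F i j z $ k) 0 (f i j k)" "\<And>i j k. f i j k 0 = 0"
    "\<And>i j k l. f i j k (unit_index l) = (if l = k then \<mu> i j $ k else 0)"
    "\<And>i j k Q. Q \<in> E \<Longrightarrow> fsubst (f i j k) \<Phi> Q = \<Phi> k Q * mpow (\<mu> i j) Q"
proof -
  obtain f where f: "\<And>i j k. has_expansion (\<lambda>z. F i j z $ k) 0 (f i j k)" "\<And>i j. taylor_map (F i j) = f i j"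
    "\<And>i j k. f i j k 0 = 0" "\<And>i j k l. f i j k (unit_index l) = diag_mat (\<mu> i j) $ k $ l"
    by (rule F_expansion) (rule that)
  have f_unit: "f i j k (unit_index l) = (if l = k then \<mu> i j $ k else 0)" for i j k l
    by (simp add: f(4) diag_mat_def)
  obtain \<Phi> \<Psi> where \<Phi>: "tangent_to_id \<Phi>" and \<Psi>': "fcomp_map \<Phi> \<Psi> = linear_fmap (mat 1)"
    "fcomp_map \<Psi> \<Phi> = linear_fmap (mat 1)" "\<forall>k. \<Psi> k (\<lambda>_. 0) = 0"
    and lin0: "\<forall>i j k. (\<lambda>Q. fcomp_map \<Psi> (fcomp_map (taylor_map (F i j)) \<Phi>) k Q
        - linear_fmap (diag_mat (\<mu> i j)) k Q) \<in> genideal formal_ring I"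
    using formal_lin unfolding formally_linearizable_on_def by (elim exE conjE) (rule that)
  have \<Psi>: "fcomp_map \<Psi> \<Phi> = linear_fmap (mat 1)" "\<And>k. \<Psi> k 0 = 0"
    using \<Psi>' by (auto simp: zero_fun_def)
  have lin: "(\<lambda>Q. fcomp_map \<Psi> (fcomp_map (f i j) \<Phi>) k Q - linear_fmap (diag_mat (\<mu> i j)) k Q)
      \<in> genideal formal_ring I" for i j k
    using lin0 unfolding f(2) by blast
  have E: "down_closed E" by (rule down_closed_support_set)
  \<comment> \<open>Series in the formal ideal generated by \<open>I\<close> have no coefficients in
    \<open>E\<close>, so the linearization is exact there.\<close>
  have lin': "fcomp_map \<Psi> (fcomp_map (f i j) \<Phi>) k Q = linear_fmap (diag_mat (\<mu> i j)) k Q" if "Q \<in> E" for i j k Q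
  proof -
    have "c Q = 0" if "c \<in> genideal formal_ring I" for c
      by (rule genideal_vanishing[of formal_ring E I c Q]) (use that E ideal_vanishing[OF I] \<open>Q \<in> E\<close> in auto)
    from this[OF lin, of i j k] show ?thesis by simp
  qed
  have semi: "fsubst (f i j k) \<Phi> Q = \<Phi> k Q * mpow (\<mu> i j) Q" if "Q \<in> E" for i j k Q
    by (rule semiconjugacy_of_formal_linearization[OF E \<Phi> \<Psi> f(3) lin' that])
  obtain E' where E': "{Q. mono_series Q \<notin> I} \<subseteq> E'" "diophantine_over \<mu> E'" using dioph by blast
  have conv_E: "convergent_series (\<lambda>Q. if Q \<in> E then \<Phi> k Q else 0)" for k
  proof (rule small_divisor_convergence[where f = f and \<mu> = \<mu> and E' = E'])
    show "E \<subseteq> E'" using E'(1) mono_in_ideal_not_support by blast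
    show "convergent_series (f i j k)" for i j k
      by (rule has_expansion_convergent[OF f(1)])
    show "(mpow (\<mu> i j) Q - \<mu> i j $ k) * \<Phi> k Q = nonlin (f i j k) \<Phi> Q" if "Q \<in> E" "2 \<le> mdeg Q" for Q i j k
      using fsubst_eq_diag_iff[of "f i j k" k "\<mu> i j" Q \<Phi>] f_unit semi that by blast
  qed (use mu_nonzero E support_set_unit E' divisor_nonzero \<Phi> in auto)
  \<comment> \<open>Convergence is established only for the coefficients in \<open>E\<close>. The
    identity elsewhere restores the linear terms in the coordinates that vanish on
    \<open>Z\<close>.\<close>
  define \<Phi>' where "\<Phi>' k Q = (if Q \<in> E then \<Phi> k Q else if Q = unit_index k then 1 else 0)" for k Q
  have "convergent_series (\<Phi>' k)" for k
  proof -
    have "convergent_series (\<lambda>Q. if Q \<in> E then 0 else if Q = unit_index k then 1 else 0)"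
      by (rule convergent_series_finite) (rule finite_subset[of _ "{unit_index k}"], auto)
    from convergent_series_closed(1)[OF conv_E[of k] this]
    show ?thesis
      by (rule back_subst[where P = convergent_series]) (auto simp: \<Phi>'_def)
  qed
  moreover have "tangent_to_id \<Phi>'"
    by (rule tangent_to_idI) (auto simp: \<Phi>'_def tangent_to_id_coeff[OF \<Phi>] dest: sym)
  moreover have "fsubst (f i j k) \<Phi>' Q = \<Phi>' k Q * mpow (\<mu> i j) Q" if Q: "Q \<in> E" for i j k Q
  proof -
    have "sprod \<Phi>' ks Q = sprod \<Phi> ks Q" for ks
      using Q E by (intro sprod_cong_le) (auto simp: \<Phi>'_def down_closed_def)
    then have "fsubst (f i j k) \<Phi>' Q = fsubst (f i j k) \<Phi> Q" by (simp add: fsubst_eq)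
    then show ?thesis using semi[OF Q, of i j k] Q by (simp add: \<Phi>'_def)
  qed
  ultimately show ?thesis using f(1,3) f_unit by (intro that[of \<Phi>' f])
qed

text \<open>\<open>\<rho> i \<circ> \<Phi> \<circ> reflection i\<close> also linearizes the \<open>F i j\<close> on \<open>Z\<close>, so it coincides there with \<open>\<Phi>\<close>.\<close>

lemma involutions_linearized:
  assumes \<Phi>: "tangent_to_id \<Phi>" "\<And>k. convergent_series (\<Phi> k)"
    and f: "\<And>i j k. has_expansion (\<lambda>z. F i j z $ k) 0 (f i j k)" "\<And>i j k. f i j k 0 = 0"
    "\<And>i j k l. f i j k (unit_index l) = (if l = k then \<mu> i j $ k else 0)"
    and semi: "\<And>i j k Q. Q \<in> E \<Longrightarrow> fsubst (f i j k) \<Phi> Q = \<Phi> k Q * mpow (\<mu> i j) Q"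
  shows "\<forall>\<^sub>F z in nhds 0. z \<in> Z \<longrightarrow> \<rho> i (feval \<Phi> z) = feval \<Phi> (reflection i z)"
proof -
  have f_conv: "convergent_series (f i j k)" for i j k
    by (rule has_expansion_convergent[OF f(1)])
  have f_ev: "\<forall>\<^sub>F w in nhds 0. \<forall>k. F i j w $ k = seval (f i j k) w" for i j
  proof (rule eventually_all_nhds)
    fix k
    obtain r where "r > 0" "\<And>z. z \<in> polydisc r \<Longrightarrow> F i j (0 + z) $ k = seval (f i j k) z"
      using f(1) by (metis has_expansionE)
    then show "\<forall>\<^sub>F w in nhds 0. F i j w $ k = seval (f i j k) w"
      unfolding eventually_polydisc by auto
  qed
  have \<Phi>0: "\<Phi> k 0 = 0" for k by (rule tangent_to_id_coeff[OF \<Phi>(1)])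
  have tendsto_\<Phi>: "filterlim (feval \<Phi>) (nhds 0) (nhds 0)" by (intro tendsto_feval \<Phi> \<Phi>0)
  have conj: "\<forall>\<^sub>F z in nhds 0. z \<in> Z \<longrightarrow> F i j (feval \<Phi> z) = feval \<Phi> (diag_mat (\<mu> i j) *v z)" for i j
  proof -
    have "\<forall>\<^sub>F z in nhds 0. \<forall>k. seval (fsubst (f i j k) \<Phi>) z = seval (f i j k) (feval \<Phi> z)"
      by (intro eventually_all_nhds eventually_seval_fsubst(2) f_conv \<Phi> \<Phi>0)
    with eventually_compose0[OF tendsto_\<Phi> f_ev[of i j]] show ?thesis
    proof eventually_elim
      case (elim z)
      show ?case
      proof
        assume z: "z \<in> Z"
        have "F i j (feval \<Phi> z) $ k = feval \<Phi> (diag_mat (\<mu> i j) *v z) $ k" for k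
        proof -
          have "F i j (feval \<Phi> z) $ k = seval (fsubst (f i j k) \<Phi>) z" using elim by simp
          also have "\<dots> = seval (\<lambda>Q. \<Phi> k Q * mpow (\<mu> i j) Q) z"
            by (rule seval_eq_on_zero_locus[OF semi z])
          finally show ?thesis by (simp add: seval_diag feval_def)
        qed
        then show "F i j (feval \<Phi> z) = feval \<Phi> (diag_mat (\<mu> i j) *v z)" by (simp add: vec_eq_iff)
      qed
    qed
  qed
  \<comment> \<open>Two conjugations occur, so the map is holomorphic: \<open>h i\<close> is
    composed with the conjugate of \<open>\<Phi> \<circ> B i\<close>. Its linear part is the
    identity because \<open>B i\<close> times its conjugate is.\<close>
  define \<Theta> where "\<Theta> z = \<rho> i (feval \<Phi> (reflection i z))" for z
  obtain H where H: "\<And>i k. has_expansion (\<lambda>w. h i w $ k) 0 (H i k)"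
    "\<And>i k. H i k 0 = 0" "\<And>i k l. H i k (unit_index l) = B i $ k $ l"
    using h_expansion by metis
  define c1 where "c1 k = fsubst (\<Phi> k) (\<lambda>l Q. if Q = 0 then 0 else linear_fmap (B i) l Q)" for k
  have c1: "has_expansion (\<lambda>z. feval \<Phi> (B i *v z) $ k) 0 (c1 k)" for k
    unfolding c1_def feval_def vec_lambda_beta
    by (rule has_expansion_comp0[OF has_expansion_seval[OF \<Phi>(2)] has_expansion_linear]) simp
  define \<theta> where "\<theta> k = fsubst (H i k) (\<lambda>l Q. if Q = 0 then 0 else cnj (c1 l Q))" for k
  have feval0: "feval \<Phi> 0 = 0" by (simp add: feval_def vec_eq_iff seval_zero \<Phi>0)
  have \<theta>: "has_expansion (\<lambda>z. \<Theta> z $ k) 0 (\<theta> k)" for k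
    unfolding \<Theta>_def rho_h \<theta>_def reflection_def
    by (rule has_expansion_comp0[OF H(1)]) (use has_expansion_cnj[OF c1] feval0 in \<open>simp_all add: cnj_vec_nth\<close>)
  have \<theta>_conv: "convergent_series (\<theta> k)" for k
    by (rule has_expansion_convergent[OF \<theta>])
  have \<theta>_tan: "tangent_to_id \<theta>"
  proof (rule tangent_to_idI)
    show "\<theta> k 0 = 0" for k
      using has_expansion_value[OF \<theta>, of k] by (simp add: \<Theta>_def reflection_def feval0 rho_0)
    have "c1 k (unit_index l) = B i $ k $ l" for k l
      unfolding c1_def fsubst_unit_index
      by (simp add: tangent_to_id_coeff[OF \<Phi>(1)] linear_fmap_coeff(2) if_distrib[where f = "\<lambda>x. x * _"] cong: if_cong)
    then have "\<theta> k (unit_index l) = (B i ** map_matrix cnj (B i)) $ k $ l" for k l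
      unfolding \<theta>_def fsubst_unit_index by (simp add: H(3) matrix_matrix_mult_def)
    then show "\<theta> k (unit_index l) = (if k = l then 1 else 0)" for k l by (simp add: B mat_def)
  qed
  note \<theta>0 = tangent_to_id_coeff(1)[OF \<theta>_tan]
  have tendsto_\<theta>: "filterlim (feval \<theta>) (nhds 0) (nhds 0)" by (intro tendsto_feval \<theta>_conv \<theta>0)
  have \<Theta>_ev: "\<forall>\<^sub>F z in nhds 0. \<Theta> z = feval \<theta> z"
  proof -
    have "\<forall>\<^sub>F z in nhds 0. \<forall>k. \<Theta> z $ k = seval (\<theta> k) z"
    proof (rule eventually_all_nhds)
      fix k
      obtain r where "r > 0" "\<And>z. z \<in> polydisc r \<Longrightarrow> \<Theta> (0 + z) $ k = seval (\<theta> k) z"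
        using \<theta> by (metis has_expansionE)
      then show "\<forall>\<^sub>F z in nhds 0. \<Theta> z $ k = seval (\<theta> k) z"
        unfolding eventually_polydisc by auto
    qed
    then show ?thesis by eventually_elim (simp add: feval_def vec_eq_iff)
  qed
  \<comment> \<open>Both \<open>F i j \<circ> \<rho> i\<close> and
    \<open>\<rho> i \<circ> F j i\<close> are
    \<open>\<rho> i \<circ> \<rho> j \<circ> \<rho> i\<close>, and the reflection exchanges the two
    diagonal maps. Hence the transposed pair is used, at the reflected point.\<close>
  have \<Theta>_conj: "\<forall>\<^sub>F z in nhds 0. z \<in> Z \<longrightarrow> F i j (\<Theta> z) = \<Theta> (diag_mat (\<mu> i j) *v z)" for j
    using eventually_compose0[OF tendsto_reflection conj[of j i], of i]
  proof eventually_elim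
    case (elim z)
    show ?case
    proof
      assume "z \<in> Z"
      then have "feval \<Phi> (diag_mat (\<mu> j i) *v reflection i z) = F j i (feval \<Phi> (reflection i z))"
        using elim reflection_Z by simp
      then show "F i j (\<Theta> z) = \<Theta> (diag_mat (\<mu> i j) *v z)"
        by (simp add: \<Theta>_def reflection_D F)
    qed
  qed
  have D_lim: "filterlim (\<lambda>z. diag_mat (\<mu> i j) *v z) (nhds 0) (nhds 0)" for j
  proof -
    have "isCont (\<lambda>z. diag_mat (\<mu> i j) *v z) 0" by (rule linear_continuous_at) simp
    from isCont_nhds[OF this] show ?thesis by simp
  qed
  have \<theta>_semi: "fsubst (f i j k) \<theta> Q = \<theta> k Q * mpow (\<mu> i j) Q" if Q: "Q \<in> E" for j k Q
  proof (rule coeff_eq_on_support[OF _ _ _ Q])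
    show "convergent_series (fsubst (f i j k) \<theta>)"
      by (intro eventually_seval_fsubst(1) f_conv \<theta>_conv \<theta>0)
    show "convergent_series (\<lambda>Q. \<theta> k Q * mpow (\<mu> i j) Q)" by (intro convergent_diag \<theta>_conv)
    have "\<forall>\<^sub>F z in nhds 0. seval (fsubst (f i j k) \<theta>) z = seval (f i j k) (feval \<theta> z)"
      by (intro eventually_seval_fsubst(2) f_conv \<theta>_conv \<theta>0)
    then show "\<forall>\<^sub>F z in nhds 0. z \<in> Z \<longrightarrow>
        seval (fsubst (f i j k) \<theta>) z = seval (\<lambda>Q. \<theta> k Q * mpow (\<mu> i j) Q) z"
      using eventually_compose0[OF tendsto_\<theta> f_ev[of i j]] \<Theta>_ev
        eventually_compose0[OF D_lim \<Theta>_ev, of j] \<Theta>_conj[of j]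
    proof eventually_elim
      case (elim z)
      show ?case
      proof
        assume "z \<in> Z"
        then have "F i j (feval \<theta> z) = feval \<theta> (diag_mat (\<mu> i j) *v z)" using elim by simp
        then have "F i j (feval \<theta> z) $ k = seval (\<theta> k) (diag_mat (\<mu> i j) *v z)" by (simp add: feval_def)
        then show "seval (fsubst (f i j k) \<theta>) z = seval (\<lambda>Q. \<theta> k Q * mpow (\<mu> i j) Q) z"
          using elim by (simp add: seval_diag)
      qed
    qed
  qed
  have uniq: "\<forall>k. \<theta> k Q = \<Phi> k Q" if "Q \<in> E" for Q
    using that
  proof (induction "mdeg Q" arbitrary: Q rule: less_induct)
    case less
    show ?case
    proof (cases "2 \<le> mdeg Q")
      case False
      then show ?thesis using \<theta>_tan \<Phi>(1) by (simp add: tangent_to_id_def)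
    next
      case True
      show ?thesis
      proof
        fix k
        \<comment> \<open>The row \<open>i\<close> is prescribed, since \<open>\<Theta>\<close> is
          built from \<open>\<rho> i\<close>; one \<open>j\<close> in this row with a nonzero
          divisor determines the coefficient.\<close>
        obtain j where j: "mpow (\<mu> i j) Q \<noteq> \<mu> i j $ k" using nonresonant[OF less.prems True] by blast
        have "nonlin (f i j k) \<theta> Q = nonlin (f i j k) \<Phi> Q"
          using less down_closed_support_set[of Z]
          by (intro nonlin_cong \<theta>0 \<Phi>0) (auto simp: down_closed_def mdeg_strict_mono)
        then have "(mpow (\<mu> i j) Q - \<mu> i j $ k) * \<theta> k Q = (mpow (\<mu> i j) Q - \<mu> i j $ k) * \<Phi> k Q"
          using fsubst_eq_diag_iff[of "f i j k" k "\<mu> i j" Q] f(3) semi[OF less.prems] \<theta>_semi[OF less.prems] True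
          by metis
        then show "\<theta> k Q = \<Phi> k Q" using j by simp
      qed
    qed
  qed
  have "\<forall>\<^sub>F z in nhds 0. z \<in> Z \<longrightarrow> \<Theta> z = feval \<Phi> z"
    using \<Theta>_ev
  proof eventually_elim
    case (elim z)
    show ?case
    proof
      assume z: "z \<in> Z"
      have "seval (\<theta> k) z = seval (\<Phi> k) z" for k
        using uniq by (intro seval_eq_on_zero_locus[OF _ z]) auto
      then show "\<Theta> z = feval \<Phi> z" using elim by (simp add: feval_def)
    qed
  qed
  \<comment> \<open>Substituting the reflected point gives the claim, since
    \<open>reflection i\<close> is an involution that preserves \<open>Z\<close>.\<close>
  from eventually_compose0[OF tendsto_reflection this, of i] show ?thesis
    by eventually_elim (auto simp: \<Theta>_def reflection_Z)
qed

end

section \<open>The invariant variety\<close>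

lemma holo_at_coordinate: "holo_at (\<lambda>z :: complex ^ 'n::finite. z $ k) p"
proof -
  have "p \<in> polydisc (norm p)" by (simp add: polydisc_def Finite_Cartesian_Product.norm_nth_le)
  from holo_at_seval[OF seval_linear_fmap(2) this, of "norm p + 1" "mat 1" k]
  have "holo_at (seval (linear_fmap (mat 1) k)) p" by simp
  moreover have "seval (linear_fmap (mat 1) k) = (\<lambda>z :: complex ^ 'n. z $ k)"
    by (rule ext) (simp add: seval_linear_fmap)
  ultimately show ?thesis by simp
qed

lemma biholomorphic_map_id: "biholomorphic_map id UNIV UNIV"
proof -
  have id: "holo_map_at id z" for z :: "complex ^ 'n::finite"
    unfolding holo_map_at_def by (simp add: holo_at_coordinate)
  show ?thesis unfolding biholomorphic_map_def using id by (auto intro!: exI[of _ id])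
qed

text \<open>A union of coordinate hyperplanes is the zero set of the product of the coordinates, and
  the finite index type admits only finitely many \<open>J\<close>.\<close>

lemma analytic_subvariety_coordinates:
  assumes U: "open U" and \<psi>: "\<And>z k. z \<in> U \<Longrightarrow> holo_at (\<lambda>z. \<psi> z $ k) z"
  shows "analytic_subvariety U {z \<in> U. \<psi> z \<in> (\<Inter>J\<in>\<J>. \<Union>j\<in>J. {z. z $ j = 0})}"
  unfolding analytic_subvariety_def
proof (intro conjI ballI)
  let ?\<F> = "(\<lambda>J z. \<Prod>j\<in>J. \<psi> z $ j) ` \<J>"
  fix p assume p: "p \<in> U"
  have "finite ?\<F>" by (rule finite_imageI) (rule finite_subset[of _ UNIV], auto)
  moreover have "\<forall>f\<in>?\<F>. \<forall>q\<in>U. holo_at f q" using \<psi> by (auto intro: holo_at_prod)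
  moreover have "{z \<in> U. \<psi> z \<in> (\<Inter>J\<in>\<J>. \<Union>j\<in>J. {z. z $ j = 0})} \<inter> U = {z \<in> U. \<forall>f\<in>?\<F>. f z = 0}"
    by (auto simp: prod_zero_iff)
  ultimately show "\<exists>N \<F>. open N \<and> p \<in> N \<and> N \<subseteq> U \<and> finite \<F> \<and> (\<forall>f\<in>\<F>. \<forall>q\<in>N. holo_at f q) \<and>
      {z \<in> U. \<psi> z \<in> (\<Inter>J\<in>\<J>. \<Union>j\<in>J. {z. z $ j = 0})} \<inter> N = {z \<in> N. \<forall>f\<in>\<F>. f z = 0}"
    using U p by (intro exI[of _ U] exI[of _ ?\<F>]) simp
qed auto

lemma eventually_holo_map_at_feval:
  assumes "\<And>k. convergent_series (\<Phi> k)"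
  shows "\<forall>\<^sub>F z in nhds 0. holo_map_at (feval \<Phi>) z"
proof -
  obtain r where r: "r > 0" "\<And>k. absconv (\<Phi> k) r" using common_absconv_radius[of \<Phi>] assms by blast
  have "holo_map_at (feval \<Phi>) z" if "z \<in> polydisc (r / 2)" for z
    unfolding holo_map_at_def feval_def vec_lambda_beta
  proof
    fix k
    have "holo_at (seval (\<Phi> k)) z" using r by (intro holo_at_seval[OF r(2) that]) simp
    then show "holo_at (\<lambda>z. seval (\<Phi> k) z) z" by simp
  qed
  then show ?thesis unfolding eventually_polydisc using r by (intro exI[of _ "r / 2"]) auto
qed

context linearizable_family
begin

text \<open>The inverse of the linearization serves as coordinate change. On the zero set it carries
  \<open>\<rho> k\<close> to \<open>reflection k\<close>, so injectivity matches their fixed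
  points.\<close>

lemma invariant_variety:
  fixes M :: "'m \<Rightarrow> (complex ^ 'n) set" and \<J> :: "'n set set"
  assumes fixed: "\<And>i. \<forall>\<^sub>F z in nhds 0. z \<in> M i \<longleftrightarrow> \<rho> i z = z" and Z0: "0 \<in> Z"
    and Z: "Z = (\<Inter>J\<in>\<J>. \<Union>j\<in>J. {z. z $ j = 0})"
  obtains U V \<psi> S where "0 \<in> U" "biholomorphic_map \<psi> U V" "\<psi> 0 = 0" "analytic_subvariety U S" "0 \<in> S"
    "\<And>k. M k \<inter> S \<noteq> {}" "\<psi> ` S = V \<inter> Z" "\<And>k. \<psi> ` (M k \<inter> S) = {z \<in> V \<inter> Z. B k *v cnj_vec z = z}"
proof -
  obtain \<Phi> f where \<Phi>: "tangent_to_id \<Phi>" "\<And>k. convergent_series (\<Phi> k)"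
    and f: "\<And>i j k. has_expansion (\<lambda>z. F i j z $ k) 0 (f i j k)" "\<And>i j k. f i j k 0 = 0"
      "\<And>i j k l. f i j k (unit_index l) = (if l = k then \<mu> i j $ k else 0)"
      "\<And>i j k Q. Q \<in> E \<Longrightarrow> fsubst (f i j k) \<Phi> Q = \<Phi> k Q * mpow (\<mu> i j) Q"
    by (rule holomorphic_linearization) (rule that)
  have lin: "\<forall>\<^sub>F z in nhds 0. z \<in> Z \<longrightarrow> \<rho> i (feval \<Phi> z) = feval \<Phi> (reflection i z)" for i
    by (rule involutions_linearized[OF \<Phi> f])
  obtain \<Psi> where \<Psi>: "tangent_to_id \<Psi>" "\<And>k. convergent_series (\<Psi> k)"
    "\<forall>\<^sub>F z in nhds 0. feval \<Phi> (feval \<Psi> z) = z" "\<forall>\<^sub>F z in nhds 0. feval \<Psi> (feval \<Phi> z) = z"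
    by (rule convergent_inverse[OF \<Phi>]) (rule that)
  \<comment> \<open>The last clause is inverse cancellation at the reflected point, which need not
    lie in the neighbourhood chosen below.\<close>
  define good where "good z \<longleftrightarrow> feval \<Phi> (feval \<Psi> z) = z \<and> feval \<Psi> (feval \<Phi> z) = z \<and>
    holo_map_at (feval \<Phi>) z \<and> holo_map_at (feval \<Psi>) z \<and>
    (\<forall>i. z \<in> M i \<longleftrightarrow> \<rho> i z = z) \<and> (\<forall>i. z \<in> Z \<longrightarrow> \<rho> i (feval \<Phi> z) = feval \<Phi> (reflection i z)) \<and>
    (\<forall>i. feval \<Psi> (feval \<Phi> (reflection i z)) = reflection i z)" for z
  have "eventually good (nhds 0)"
    unfolding good_def
    by (intro eventually_conj \<Psi>(3,4) eventually_holo_map_at_feval[of \<Phi>, OF \<Phi>(2)]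
        eventually_holo_map_at_feval[of \<Psi>, OF \<Psi>(2)] eventually_all_nhds fixed lin
        eventually_compose0[OF tendsto_reflection \<Psi>(4)])
  then obtain N where N: "open N" "0 \<in> N" "\<And>z. z \<in> N \<Longrightarrow> good z"
    unfolding eventually_nhds by blast
  have goodD: "feval \<Phi> (feval \<Psi> z) = z" "feval \<Psi> (feval \<Phi> z) = z"
    "holo_map_at (feval \<Phi>) z" "holo_map_at (feval \<Psi>) z" "z \<in> M i \<longleftrightarrow> \<rho> i z = z"
    "z \<in> Z \<Longrightarrow> \<rho> i (feval \<Phi> z) = feval \<Phi> (reflection i z)" "feval \<Psi> (feval \<Phi> (reflection i z)) = reflection i z"
    if "z \<in> N" for z i
    using N(3)[OF that] unfolding good_def by simp_all
  \<comment> \<open>With both preimages built in, \<open>feval \<Psi>\<close> and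
    \<open>feval \<Phi>\<close> exchange \<open>U\<close> and \<open>V\<close> exactly.\<close>
  define U V where "U = N \<inter> feval \<Psi> -` N" and "V = N \<inter> feval \<Phi> -` N"
  have open_UV: "open U" "open V"
    unfolding U_def V_def using N(1) goodD(3,4)
    by (auto intro!: continuous_open_preimage continuous_at_imp_continuous_on holo_map_at_continuous)
  have \<Psi>U: "feval \<Psi> z \<in> V" if "z \<in> U" for z using that goodD(1) by (auto simp: U_def V_def)
  have \<Phi>V: "feval \<Phi> w \<in> U" if "w \<in> V" for w using that goodD(2) by (auto simp: U_def V_def)
  have UN: "z \<in> N" if "z \<in> U" for z using that by (simp add: U_def)
  have VN: "z \<in> N" if "z \<in> V" for z using that by (simp add: V_def)
  have zero: "feval \<Psi> 0 = 0" by (simp add: feval_def vec_eq_iff seval_zero tangent_to_id_coeff[OF \<Psi>(1)])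
  have U0: "0 \<in> U" using N zero by (simp add: U_def)
  define S where "S = {z \<in> U. feval \<Psi> z \<in> Z}"
  have MS: "z \<in> M k \<longleftrightarrow> B k *v cnj_vec w = w" if w: "w \<in> V" "w \<in> Z" and z: "z = feval \<Phi> w" for z w k
  proof -
    have "z \<in> M k \<longleftrightarrow> \<rho> k z = z" using goodD(5) UN \<Phi>V w z by blast
    also have "\<rho> k z = feval \<Phi> (reflection k w)" using goodD(6) VN w z by blast
    also have "feval \<Phi> (reflection k w) = z \<longleftrightarrow> reflection k w = w"
      using goodD(2)[of w] goodD(7)[of w k] VN[OF w(1)] z by metis
    finally show ?thesis by (simp add: reflection_def)
  qed
  have M0: "0 \<in> M k" for k
    using eventually_nhds_x_imp_x[OF fixed[of k]] by (simp add: rho_0)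
  have S0: "0 \<in> S" using U0 zero Z0 by (simp add: S_def)
  show ?thesis
  proof (rule that[of U "feval \<Psi>" V S])
    have "feval \<Psi> ` U = V"
    proof (intro equalityI subsetI)
      fix w assume "w \<in> V"
      then show "w \<in> feval \<Psi> ` U" using \<Phi>V goodD(2) VN by (intro image_eqI[of _ _ "feval \<Phi> w"]) auto
    qed (use \<Psi>U in auto)
    then show "biholomorphic_map (feval \<Psi>) U V"
      unfolding biholomorphic_map_def using open_UV goodD UN VN by (auto intro!: exI[of _ "feval \<Phi>"])
    show "analytic_subvariety U S"
      unfolding S_def Z using goodD(4) UN
      by (intro analytic_subvariety_coordinates open_UV) (auto simp: holo_map_at_def)
    show "feval \<Psi> ` S = V \<inter> Z"
    proof (intro equalityI subsetI)
      fix w assume w: "w \<in> V \<inter> Z"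
      then have "feval \<Phi> w \<in> S" using \<Phi>V goodD(2) VN by (auto simp: S_def)
      then show "w \<in> feval \<Psi> ` S" using w goodD(2) VN by (intro image_eqI[of _ _ "feval \<Phi> w"]) auto
    qed (use \<Psi>U in \<open>auto simp: S_def\<close>)
    show "feval \<Psi> ` (M k \<inter> S) = {z \<in> V \<inter> Z. B k *v cnj_vec z = z}" for k
    proof (intro equalityI subsetI)
      fix w assume w: "w \<in> {z \<in> V \<inter> Z. B k *v cnj_vec z = z}"
      then have "feval \<Phi> w \<in> M k \<inter> S" using \<Phi>V goodD(2) VN MS by (auto simp: S_def)
      then show "w \<in> feval \<Psi> ` (M k \<inter> S)" using w goodD(2) VN by (intro image_eqI[of _ _ "feval \<Phi> w"]) auto
    next
      fix w assume "w \<in> feval \<Psi> ` (M k \<inter> S)"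
      then obtain z where z: "z \<in> M k" "z \<in> U" "w = feval \<Psi> z" "w \<in> Z" by (auto simp: S_def)
      then have "w \<in> V" "z = feval \<Phi> w" using \<Psi>U goodD(1) UN by auto
      then show "w \<in> {z \<in> V \<inter> Z. B k *v cnj_vec z = z}" using MS z by blast
    qed
  qed (use U0 zero S0 M0 in blast)+
qed

end

theorem corollary3p1:
  fixes M :: "'m::finite \<Rightarrow> (complex ^ 'n::finite) set"
    and B :: "'m \<Rightarrow> complex ^ 'n ^ 'n"
    and R \<rho> :: "'m \<Rightarrow> complex ^ 'n \<Rightarrow> complex ^ 'n"
    and F :: "'m \<Rightarrow> 'm \<Rightarrow> complex ^ 'n \<Rightarrow> complex ^ 'n"
    and \<mu> :: "'m \<Rightarrow> 'm \<Rightarrow> complex ^ 'n"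
    and I :: "'n fseries set"
  assumes M: "\<And>i. totally_real_germ (M i)"
    and R: "\<And>i. holo_map_at (R i) 0" "\<And>i. R i 0 = 0" "\<And>i. (R i has_derivative (\<lambda>_. 0)) (at 0)"
    and B: "\<And>i. invertible (B i)" "\<And>i. B i ** map_matrix cnj (B i) = mat 1"
    and rho: "\<And>i z. \<rho> i z = B i *v cnj_vec z + R i (cnj_vec z)"
    and involution: "\<And>i. \<forall>\<^sub>F z in nhds 0. \<rho> i (\<rho> i z) = z"
    and fixed: "\<And>i. \<forall>\<^sub>F z in nhds 0. z \<in> M i \<longleftrightarrow> \<rho> i z = z"
    and distinct_tangents: "inj (\<lambda>i. {z. z = B i *v cnj_vec z})"
    and F: "\<And>i j. F i j = \<rho> i \<circ> \<rho> j"
    and abelian: "abelian_germs (generated_group {F i j | i j. True})"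
    and linear_part: "\<And>i j. (F i j has_derivative (\<lambda>v. diag_mat (\<mu> i j) *v v)) (at 0)"
    and I: "monomial_ideal I"
    and inv_D: "\<And>i j. left_invariant I (diag_mat (\<mu> i j))"
    and inv_B: "\<And>i. left_invariant I (B i)"
    and dioph: "diophantine \<mu> \<or> properly_embedded I \<and> diophantine_on \<mu> I"
    and nonres: "non_resonant_on \<mu> I"
    and formal_lin: "formally_linearizable_on F \<mu> I"
  shows "\<exists>U V \<psi> S. \<exists>\<J> :: 'n set set.
           0 \<in> U \<and> biholomorphic_map \<psi> U V \<and> \<psi> 0 = 0 \<and>
           analytic_subvariety U S \<and> 0 \<in> S \<and> (\<forall>k. M k \<inter> S \<noteq> {}) \<and>
           (I \<noteq> carrier germ_ring \<longrightarrow> (\<Inter>J\<in>\<J>. \<Union>j\<in>J. {z. z $ j = 0}) = zero_locus I) \<and>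
           \<psi> ` S = V \<inter> (\<Inter>J\<in>\<J>. \<Union>j\<in>J. {z. z $ j = 0}) \<and>
           (\<forall>k. \<psi> ` (M k \<inter> S) =
                {z \<in> V \<inter> (\<Inter>J\<in>\<J>. \<Union>j\<in>J. {z. z $ j = 0}). B k *v cnj_vec z = z})"
proof (cases "I = carrier germ_ring")
  case True
  \<comment> \<open>The unit ideal has an empty zero set, which misses the origin. The origin
    itself, as intersection of all coordinate hyperplanes, satisfies the conclusion.\<close>
  define \<J> :: "'n set set" where "\<J> = range (\<lambda>k. {k})"
  have Z: "(\<Inter>J\<in>\<J>. \<Union>j\<in>J. {z :: complex ^ 'n. z $ j = 0}) = {0}"
    by (auto simp: \<J>_def vec_eq_iff)
  have M0: "0 \<in> M k" for k
    using eventually_nhds_x_imp_x[OF fixed[of k]] by (simp add: rho R)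
  have "analytic_subvariety UNIV {z \<in> UNIV. id z \<in> (\<Inter>J\<in>\<J>. \<Union>j\<in>J. {z :: complex ^ 'n. z $ j = 0})}"
    by (rule analytic_subvariety_coordinates) (simp_all add: holo_at_coordinate)
  then have "analytic_subvariety UNIV {0 :: complex ^ 'n}" by (simp add: Z)
  then show ?thesis
    using M0 True biholomorphic_map_id
    by (intro exI[of _ UNIV] exI[of _ id] exI[of _ "{0}"] exI[of _ \<J>]) (auto simp: Z)
next
  case False
  have "\<exists>E. {Q. mono_series Q \<notin> I} \<subseteq> E \<and> diophantine_over \<mu> E"
    using dioph unfolding diophantine_def diophantine_on_def by blast
  then interpret linearizable_family B R \<rho> F \<mu> I
    using R B(2) rho F linear_part I inv_B nonres formal_lin by unfold_locales
  define \<J> where "\<J> = {{k. Q k \<noteq> 0} | Q. mono_series Q \<in> I}"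
  have Z: "zero_locus I = (\<Inter>J\<in>\<J>. \<Union>j\<in>J. {z. z $ j = 0})"
    unfolding \<J>_def by (rule zero_locus_eq_coordinate_hyperplanes)
  show ?thesis
  proof (rule invariant_variety[OF fixed zero_in_zero_locus[OF I False] Z])
    fix U V :: "(complex ^ 'n) set" and \<psi> S
    assume "0 \<in> U" "biholomorphic_map \<psi> U V" "\<psi> 0 = 0" "analytic_subvariety U S" "0 \<in> S"
      "\<And>k. M k \<inter> S \<noteq> {}" "\<psi> ` S = V \<inter> zero_locus I"
      "\<And>k. \<psi> ` (M k \<inter> S) = {z \<in> V \<inter> zero_locus I. B k *v cnj_vec z = z}"
    then show ?thesis
      unfolding Z[symmetric]
      by (intro exI[of _ U] exI[of _ V] exI[of _ \<psi>] exI[of _ S] exI[of _ \<J>]) (simp add: Z)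
  qed
qed

end
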